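(* Let $n\ge1$, $0<\alpha<1$, $1<p<1/\alpha$ and $q=\frac{p}{1-\alpha p}$. There is a constant $c>0$ depending only on $n$, $p$ and $\alpha$ such that for every weight $w\in A_{p,q}^{-(s)}(\mathbb{R}^n)$ and every $f\in L^p_{w^p}(\mathbb{R}^n)$, $$\|wM_{\alpha}^{-(s)}f\|_{L^{q}(\mathbb{R}^n)}\le c\,\big(\|w\|_{A_{p,q}^{-}(x_{1})}\cdots\|w\|_{A_{p,q}^{-}(x_{n})}\big)^{\frac{p'}{q}(1-\alpha)}\|wf\|_{L^{p}(\mathbb{R}^n)}.$$ Further, the power $\beta=\frac{p'}{q}(1-\alpha)$ is sharp: there is no positive non-decreasing function $\psi$ on $[1,\infty)$ with $\psi(t)/t^{\beta}\to0$ as $t\to\infty$ such that $\|wM_{\alpha}^{-(s)}f\|_{L^{q}(\mathbb{R}^n)}\le\psi\big(\prod_{i=1}^n\|w\|_{A_{p,q}^-(x_i)}\big)\|wf\|_{L^{p}(\mathbb{R}^n)}$ for all $w\in A_{p,q}^{-(s)}(\mathbb{R}^n)$ and all $f\in L^p_{w^p}(\mathbb{R}^n)$.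
   Context: A weight is an a.e. positive locally integrable function. $p'=p/(p-1)$; $f\in L^p_{w^p}(\mathbb{R}^n)$ means $\|wf\|_{L^p(\mathbb{R}^n)}<\infty$. The left-sided strong fractional maximal operator is $$M_\alpha^{-(s)}f(x)=\sup_{h_1,\dots,h_n>0}\frac{1}{\prod_{i=1}^n h_i^{1-\alpha}}\int_{x_1-h_1}^{x_1}\cdots\int_{x_n-h_n}^{x_n}|f(y)|\,dy.$$ For $x\in\mathbb{R}^n$ and $h=(h_1,\dots,h_n)$ with all $h_i>0$, put $P^+_{x,h}=\prod_i[x_i,x_i+h_i]$, $P^-_{x,h}=\prod_i[x_i-h_i,x_i]$, $|h|=h_1\cdots h_n$. Then $w\in A_{p,q}^{-(s)}(\mathbb{R}^n)$ if $$\sup_{x,h}\Big(\frac1{|h|}\int_{P^+_{x,h}}w^q\Big)^{1/q}\Big(\frac1{|h|}\int_{P^-_{x,h}}w^{-p'}\Big)^{1/p'}<\infty.$$ With $w_i(t)=w(x_1,\dots,x_{i-1},t,x_{i+1},\dots,x_n)$ for fixed $x_j$ ($j\ne i$), the characteristic in the variable $x_i$, uniform with respect to the other variables, is $$\|w\|_{A_{p,q}^-(x_i)}=\operatorname*{ess\,sup}_{(x_j)_{j\ne i}\in\mathbb{R}^{n-1}}\ \sup_{x_i\in\mathbb{R},\,h>0}\Big(\frac1h\int_{x_i}^{x_i+h}w_i(t)^q dt\Big)\Big(\frac1h\int_{x_i-h}^{x_i}w_i(t)^{-p'}dt\Big)^{q/p'}.$$ One has $w\in A_{p,q}^{-(s)}(\mathbb{R}^n)$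 if and only if $\|w\|_{A_{p,q}^-(x_i)}<\infty$ for all $i$. *)

theory Defs
  imports "HOL-Probability.Essential_Supremum"
begin

text \<open>
  Everything that may be infinite a priori (averages, the maximal function, norms, weight
  characteristics) takes values in \<^typ>\<open>ennreal\<close>. Negative powers only ever occur on the real
  values of a weight, so powers of extended values are needed for exponents \<open>r > 0\<close> only.
\<close>

definition epowr :: "ennreal \<Rightarrow> real \<Rightarrow> ennreal" where
  "epowr x r = (if x = \<infinity> then \<infinity> else ennreal (enn2real x powr r))"

definition dual_exp :: "real \<Rightarrow> real" where
  "dual_exp p = p / (p - 1)"

definition weight :: "(real ^ 'n::finite \<Rightarrow> real) \<Rightarrow> bool" where
  "weight w \<longleftrightarrow>
     w \<in> borel_measurable lebesgue \<and>
     (AE x in lebesgue. 0 < w x) \<and>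
     (\<forall>K. compact K \<longrightarrow> set_integrable lebesgue K w)"

definition Lp_norm :: "real \<Rightarrow> (real ^ 'n::finite \<Rightarrow> ennreal) \<Rightarrow> ennreal" where
  "Lp_norm p g = epowr (\<integral>\<^sup>+x. epowr (g x) p \<partial>lebesgue) (1 / p)"

text \<open>The norm of \<open>w f\<close> in \<open>L\<^sup>p\<close>, and the space of those \<open>f\<close> for which it is finite.\<close>

definition weighted_norm :: "real \<Rightarrow> (real ^ 'n::finite \<Rightarrow> real) \<Rightarrow> (real ^ 'n \<Rightarrow> real) \<Rightarrow> ennreal" where
  "weighted_norm p w f = Lp_norm p (\<lambda>x. ennreal \<bar>w x * f x\<bar>)"

definition weighted_Lp :: "real \<Rightarrow> (real ^ 'n::finite \<Rightarrow> real) \<Rightarrow> (real ^ 'n \<Rightarrow> real) set" where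
  "weighted_Lp p w = {f \<in> borel_measurable lebesgue. weighted_norm p w f < \<infinity>}"

definition pos_vecs :: "(real ^ 'n::finite) set" where
  "pos_vecs = {h. \<forall>i. 0 < h $ i}"

definition strong_frac_max :: "real \<Rightarrow> (real ^ 'n::finite \<Rightarrow> real) \<Rightarrow> real ^ 'n \<Rightarrow> ennreal" where
  "strong_frac_max \<alpha> f x =
     (SUP h \<in> pos_vecs.
        ennreal (1 / (\<Prod>i\<in>UNIV. (h $ i) powr (1 - \<alpha>))) *
        (\<integral>\<^sup>+y\<in>cbox (x - h) x. ennreal \<bar>f y\<bar> \<partial>lebesgue))"

definition weighted_max_norm ::
    "real \<Rightarrow> real \<Rightarrow> (real ^ 'n::finite \<Rightarrow> real) \<Rightarrow> (real ^ 'n \<Rightarrow> real) \<Rightarrow> ennreal" where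
  "weighted_max_norm q \<alpha> w f = Lp_norm q (\<lambda>x. ennreal \<bar>w x\<bar> * strong_frac_max \<alpha> f x)"

definition strong_A :: "real \<Rightarrow> real \<Rightarrow> (real ^ 'n::finite \<Rightarrow> real) set" where
  "strong_A p q =
     {w. weight w \<and>
         (SUP (x, h) \<in> UNIV \<times> pos_vecs.
            epowr (ennreal (1 / (\<Prod>i\<in>UNIV. h $ i)) *
                   (\<integral>\<^sup>+y\<in>cbox x (x + h). ennreal (w y powr q) \<partial>lebesgue)) (1 / q) *
            epowr (ennreal (1 / (\<Prod>i\<in>UNIV. h $ i)) *
                   (\<integral>\<^sup>+y\<in>cbox (x - h) x. ennreal (w y powr (- dual_exp p)) \<partial>lebesgue))
                  (1 / dual_exp p)) < \<infinity>}"

text \<open>\<open>t\<close> is the variable number \<open>i\<close>, and \<open>y\<close> supplies the remaining coordinates.\<close>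

definition slice :: "'n::finite \<Rightarrow> (real ^ 'n \<Rightarrow> real) \<Rightarrow> ('n \<Rightarrow> real) \<Rightarrow> real \<Rightarrow> real" where
  "slice i w y t = w (\<chi> j. if j = i then t else y j)"

definition A_char_line :: "real \<Rightarrow> real \<Rightarrow> (real \<Rightarrow> real) \<Rightarrow> ennreal" where
  "A_char_line p q v =
     (SUP (x, h) \<in> UNIV \<times> {0<..}.
        (ennreal (1 / h) * (\<integral>\<^sup>+t\<in>{x..x + h}. ennreal (v t powr q) \<partial>lebesgue)) *
        epowr (ennreal (1 / h) * (\<integral>\<^sup>+t\<in>{x - h..x}. ennreal (v t powr (- dual_exp p)) \<partial>lebesgue))
              (q / dual_exp p))"

text \<open>
  The space of the variables other than \<open>x\<^sub>i\<close> carries the completed product measure, i.e.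
  the Lebesgue measure in dimension \<open>n - 1\<close> (a point mass if \<open>n = 1\<close>). The completion matters:
  \<^const>\<open>esssup\<close> is infinite on non-measurable functions, and for Lebesgue measurable \<open>w\<close>
  the function below is measurable only with respect to the completion.
\<close>

definition A_char :: "real \<Rightarrow> real \<Rightarrow> 'n::finite \<Rightarrow> (real ^ 'n \<Rightarrow> real) \<Rightarrow> ennreal" where
  "A_char p q i w =
     esssup (completion (Pi\<^sub>M (UNIV - {i}) (\<lambda>_. lborel))) (\<lambda>y. A_char_line p q (slice i w y))"

end

theory Submission
  imports Defs
begin

text \<open>
  On the line, the one-sided operator is dominated by two dyadic operators, each averaging over the
  left half of a dyadic interval whose right half contains the point. Put \<open>u = w\<^sup>q\<close> and
  \<open>s = w\<^sup>-\<^sup>p\<^sup>'\<close>, let \<open>E\<close> be the part of the right half \<open>R\<close> where the average over the left half \<open>L\<close>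
  is the largest one, and let \<open>l\<close> be their common length. Hoelder's inequality reduces the bound
  to the Carleson embedding theorem for \<open>s\<close> with weights \<open>u(E) (s(L) / l)\<^bsup>1 + \<rho>\<^esup>\<close>, where \<open>\<rho> = q / p'\<close>.
  By the one-sided condition with constant \<open>a\<close> these weights are at most
  \<open>a\<^bsup>\<tau>\<^esup> u(E) (l / u(R))\<^bsup>\<tau>\<^esup>\<close> with \<open>\<tau> = 1 + 1 / \<rho> = \<beta> q\<close>, and a second application of the embedding theorem, to
  \<open>1 / u\<close> with respect to \<open>u\<close>, gives the packing condition with constant of order \<open>a\<^bsup>\<tau>\<^esup>\<close>. This produces
  the power \<open>\<beta>\<close> in one variable; since \<open>q \<ge> p\<close>, Minkowski's inequality iterates the bound
  over the coordinates.

  Sharpness is tested on products of \<open>\<bar>t\<bar>\<close> to the power \<open>(1 - \<epsilon>) / p'\<close>, with characteristic at most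
  \<open>(6 / \<epsilon>)\<^bsup>\<rho>\<^esup>\<close> in each variable, and \<open>f = \<Prod> t\<^bsup>\<epsilon> - 1\<^esup>\<close> on the unit cube.
\<close>

subsection \<open>Powers of extended nonnegative reals\<close>

text \<open>The obstacle is that \<open>u\<close> is controlled only on right halves and
  \<open>s\<close> only on left halves, and neither need be doubling, so the sides cannot be
  exchanged at the cost of a constant. The quotient \<open>l / u(R)\<close> is the
  \<open>u\<close>-average of \<open>1 / u\<close> over \<open>R\<close>, and the
  \<open>u\<close>-integral of \<open>1 / u\<close> to the power \<tau> over a left half
  \<open>L\<close> is exactly \<open>s(L)\<close>, because \<open>q - q \<tau> = - p'\<close>. So
  the second embedding returns the very measure against which packing is tested. It sees only
  intervals whose right half lies inside \<open>L\<close>; the interval owning \<open>L\<close> is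
  estimated directly with constant \<open>a\<close>, which is absorbed into \<open>a\<close> to the
  power \<tau> because a characteristic is never below 1.

  The operators used for the upper bound run over side lengths \<open>2 powi k\<close> only, which
  makes their suprema countable and measurable, and every weight is first replaced by a Borel
  function that is positive everywhere. In the examples \<open>f\<close> equals \<open>s\<close> on
  the open unit cube, the equality case of Hoelder's inequality.\<close>

lemma epowr_ennreal: "0 \<le> x \<Longrightarrow> epowr (ennreal x) r = ennreal (x powr r)"
  by (simp add: epowr_def)

lemma epowr_top [simp]: "epowr top r = top"
  by (simp add: epowr_def)

lemma epowr_0 [simp]: "epowr 0 r = 0"
  by (simp add: epowr_def)

lemma epowr_one [simp]: "epowr 1 r = 1"
  by (simp add: epowr_def)

lemma epowr_exp_one [simp]: "epowr x 1 = x"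
  by (cases x) (auto simp: epowr_ennreal)

lemma epowr_eq_0_iff [simp]: "epowr x r = 0 \<longleftrightarrow> x = 0"
  by (cases x) (auto simp: epowr_ennreal)

lemma epowr_eq_top_iff [simp]: "epowr x r = top \<longleftrightarrow> x = top"
  by (cases x) (auto simp: epowr_ennreal)

lemma epowr_mono: "0 \<le> r \<Longrightarrow> x \<le> y \<Longrightarrow> epowr x r \<le> epowr y r"
  by (cases x; cases y) (auto simp: epowr_ennreal top_unique intro: ennreal_leI powr_mono2)

lemma epowr_mult: "epowr (x * y) r = epowr x r * epowr y r"
proof (cases "x = top \<or> y = top")
  case True
  then show ?thesis
    by (auto simp: ennreal_mult_eq_top_iff ennreal_top_mult ennreal_mult_top)
next
  case False
  then obtain a b where "x = ennreal a" "y = ennreal b" "0 \<le> a" "0 \<le> b"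
    by (metis ennreal_cases)
  then show ?thesis
    by (simp add: epowr_ennreal powr_mult flip: ennreal_mult)
qed

lemma epowr_epowr: "epowr (epowr x r) s = epowr x (r * s)"
  by (cases x) (auto simp: epowr_ennreal powr_powr)

lemma epowr_add: "epowr x (r + s) = epowr x r * epowr x s"
  by (cases x) (auto simp: epowr_ennreal powr_add ennreal_mult)

lemma epowr_prod: "epowr (\<Prod>i\<in>I. f i) r = (\<Prod>i\<in>I. epowr (f i) r)"
  by (induction I rule: infinite_finite_induct) (auto simp: epowr_mult)

lemma epowr_inverse_cancel: "r \<noteq> 0 \<Longrightarrow> epowr (epowr x r) (1 / r) = x"
  by (simp add: epowr_epowr)

lemma epowr_inverse_cancel': "r \<noteq> 0 \<Longrightarrow> epowr (epowr x (1 / r)) r = x"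
  by (simp add: epowr_epowr)

lemma epowr_measurable [measurable (raw)]:
  assumes [measurable]: "f \<in> borel_measurable M"
  shows "(\<lambda>x. epowr (f x) r) \<in> borel_measurable M"
  unfolding epowr_def infinity_ennreal_def by measurable

text \<open>Raising to a positive power is monotone with a monotone inverse, and such maps preserve
  suprema.\<close>

lemma epowr_SUP:
  assumes "0 < r"
  shows "epowr (SUP i\<in>I. f i) r = (SUP i\<in>I. epowr (f i) r)"
proof (rule antisym)
  have "(SUP i\<in>I. f i) \<le> epowr (SUP i\<in>I. epowr (f i) r) (1 / r)"
  proof (rule SUP_least)
    fix i assume "i \<in> I"
    then have "epowr (epowr (f i) r) (1 / r) \<le> epowr (SUP i\<in>I. epowr (f i) r) (1 / r)"
      using assms by (intro epowr_mono SUP_upper) auto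
    then show "f i \<le> \<dots>"
      using assms by (simp add: epowr_inverse_cancel)
  qed
  then have "epowr (SUP i\<in>I. f i) r \<le> epowr (epowr (SUP i\<in>I. epowr (f i) r) (1 / r)) r"
    using assms by (intro epowr_mono) auto
  then show "epowr (SUP i\<in>I. f i) r \<le> (SUP i\<in>I. epowr (f i) r)"
    using assms by (simp add: epowr_inverse_cancel')
qed (use assms in \<open>auto intro!: SUP_least epowr_mono SUP_upper\<close>)

lemma epowr_add_le:
  assumes "0 < r"
  shows "epowr (x + y) r \<le> ennreal (2 powr r) * (epowr x r + epowr y r)"
proof -
  have "epowr (x + y) r \<le> epowr (2 * max x y) r"
    using assms by (intro epowr_mono) (auto simp: mult_2 intro: add_mono)
  also have "\<dots> = ennreal (2 powr r) * epowr (max x y) r"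
    using epowr_ennreal[of 2 r] by (simp add: epowr_mult)
  also have "epowr (max x y) r \<le> epowr x r + epowr y r"
    by (auto simp: max_def)
  finally show ?thesis
    by (simp add: mult_left_mono)
qed

section \<open>Jensen's inequality and the layer-cake formula\<close>

lemma nn_integral_null_space:
  assumes "emeasure M (space M) = 0"
  shows "(\<integral>\<^sup>+x. h x \<partial>M) = 0"
proof -
  have "AE x in M. h x = 0"
    using assms by (intro AE_I[where N = "space M"]) auto
  then have "(\<integral>\<^sup>+x. h x \<partial>M) = (\<integral>\<^sup>+x. 0 \<partial>M)"
    by (rule nn_integral_cong_AE)
  then show ?thesis by simp
qed

text \<open>Jensen's inequality for the power \<open>s\<close>, without normalising the measure.
  This is the form in which Hoelder's inequality is used below, always with a weighted measure in
  the role of \<open>M\<close>. The case distinction is forced by the conventions for products of 0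
  and \<open>top\<close>.\<close>

lemma nn_integral_power_mean:
  assumes "1 \<le> s" and [measurable]: "h \<in> borel_measurable M"
  shows "epowr (\<integral>\<^sup>+x. h x \<partial>M) s
    \<le> epowr (emeasure M (space M)) (s - 1) * (\<integral>\<^sup>+x. epowr (h x) s \<partial>M)"
proof -
  consider "s = 1" | "emeasure M (space M) = 0" "s > 1" | "AE x in M. h x = 0" "s > 1"
    | "(\<integral>\<^sup>+x. epowr (h x) s \<partial>M) = top" "emeasure M (space M) \<noteq> 0" "s > 1"
    | "(\<integral>\<^sup>+x. epowr (h x) s \<partial>M) < top" "\<not> (AE x in M. h x = 0)" "emeasure M (space M) = top" "s > 1"
    | "(\<integral>\<^sup>+x. epowr (h x) s \<partial>M) < top" "0 < emeasure M (space M)" "emeasure M (space M) < top" "s > 1"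
    using assms(1) by (metis order_le_less less_top zero_less_iff_neq_zero)
  then show ?thesis
  proof cases
    \<comment> \<open>\<open>epowr x 0\<close> is 1 except that it is 0 at 0 and \<open>top\<close>
      at \<open>top\<close>, so null and infinite measures are separated.\<close>
    case 1
    then show ?thesis
    proof (cases "emeasure M (space M) = 0 \<or> emeasure M (space M) = top")
      case True
      then show ?thesis
        using \<open>s = 1\<close> by (cases "(\<integral>\<^sup>+x. h x \<partial>M) = 0") (auto simp: nn_integral_null_space ennreal_top_mult)
    next
      case False
      then have "epowr (emeasure M (space M)) 0 = 1"
        by (cases "emeasure M (space M)") (auto simp: epowr_ennreal)
      then show ?thesis using \<open>s = 1\<close> by simp
    qed
  next
    case 2
    then show ?thesis by (simp add: nn_integral_null_space)
  next
    case 3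
    then have "(\<integral>\<^sup>+x. h x \<partial>M) = 0" by (subst nn_integral_0_iff_AE) auto
    then show ?thesis by simp
  next
    case 4
    then show ?thesis by (simp add: ennreal_mult_top)
  next
    case 5
    have "(\<integral>\<^sup>+x. epowr (h x) s \<partial>M) \<noteq> 0"
      using 5 by (simp add: nn_integral_0_iff_AE)
    then show ?thesis
      using 5 by (simp add: ennreal_top_mult)
  next
    case 6
    define m where "m = enn2real (emeasure M (space M))"
    have m: "emeasure M (space M) = ennreal m" "0 < m"
      using 6 by (auto simp: m_def enn2real_positive_iff less_top)
    have "(\<integral>\<^sup>+x. h x \<partial>M) \<le> (\<integral>\<^sup>+x. 1 + epowr (h x) s \<partial>M)"
    proof (rule nn_integral_mono)
      fix x
      \<comment> \<open>This makes the integral of \<open>h\<close> finite, given that the total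
        mass and the integral of the \<open>s\<close>-th power are.\<close>
      show "h x \<le> 1 + epowr (h x) s"
      proof (cases "h x \<le> 1")
        case True then show ?thesis by (simp add: add_increasing2)
      next
        case False
        then have "1 \<le> epowr (h x) (s - 1)"
          using epowr_mono[of "s - 1" 1 "h x"] \<open>s > 1\<close> by simp
        then have "h x * 1 \<le> h x * epowr (h x) (s - 1)"
          by (rule mult_left_mono) simp
        also have "\<dots> = epowr (h x) s"
          using epowr_add[of "h x" 1 "s - 1"] by simp
        finally show ?thesis by (simp add: add_increasing)
      qed
    qed
    also have "\<dots> < top"
      using 6 by (simp add: nn_integral_add)
    finally obtain I where I: "(\<integral>\<^sup>+x. h x \<partial>M) = ennreal I" "0 \<le> I"
      by (metis ennreal_cases less_irrefl)
    obtain J where J: "(\<integral>\<^sup>+x. epowr (h x) s \<partial>M) = ennreal J" "0 \<le> J"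
      using 6 by (metis ennreal_cases less_irrefl)
    define a where "a = I / m"
    have a: "0 \<le> a" using I m by (simp add: a_def)
    \<comment> \<open>The tangent of \<open>t powr s\<close> at \<open>a\<close> lies below the
      graph; Young's inequality gives this without calculus. At the mean value
      \<open>a = I / m\<close>, integration turns it into Jensen's inequality.\<close>
    have tangent: "s * a powr (s - 1) * t \<le> t powr s + (s - 1) * a powr s" if "0 \<le> t" for t
    proof (cases "a = 0")
      case True then show ?thesis using \<open>s > 1\<close> by simp
    next
      case False
      then have "0 < a" using a by simp
      have "a powr (s - 1) * t \<le> t powr s / s + (a powr (s-1)) powr (s / (s - 1)) / (s / (s - 1))"
        using Youngs_inequality[of s "s / (s - 1)" t "a powr (s - 1)"] \<open>s > 1\<close> that \<open>0 < a\<close>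
        by (simp add: field_simps)
      also have "(a powr (s-1)) powr (s / (s - 1)) = a powr s"
        using \<open>s > 1\<close> by (simp add: powr_powr)
      finally have "s * (a powr (s - 1) * t) \<le> s * (t powr s / s + a powr s / (s / (s - 1)))"
        using \<open>s > 1\<close> by (intro mult_left_mono) auto
      also have "\<dots> = t powr s + (s - 1) * a powr s"
        using \<open>s > 1\<close> by (simp add: distrib_left)
      finally show ?thesis by (simp add: mult.assoc)
    qed
    have "ennreal (s * a powr (s - 1)) * (\<integral>\<^sup>+x. h x \<partial>M)
        = (\<integral>\<^sup>+x. ennreal (s * a powr (s - 1)) * h x \<partial>M)"
      by (simp add: nn_integral_cmult)
    also have "\<dots> \<le> (\<integral>\<^sup>+x. epowr (h x) s + ennreal ((s - 1) * a powr s) \<partial>M)"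
    proof (rule nn_integral_mono)
      fix x
      show "ennreal (s * a powr (s - 1)) * h x \<le> epowr (h x) s + ennreal ((s - 1) * a powr s)"
        using tangent a \<open>s > 1\<close>
        by (cases "h x") (auto simp: epowr_ennreal simp flip: ennreal_mult ennreal_plus)
    qed
    also have "\<dots> = ennreal J + ennreal ((s - 1) * a powr s) * ennreal m"
      by (simp add: nn_integral_add m J)
    finally have "s * a powr (s - 1) * I \<le> J + (s - 1) * a powr s * m"
      using I J m a \<open>s > 1\<close> by (simp flip: ennreal_mult ennreal_plus)
    moreover have "a powr (s - 1) * I = a powr s * m"
      using m I by (cases "I = 0") (auto simp: a_def powr_diff)
    ultimately have "s * (a powr s * m) \<le> J + (s - 1) * (a powr s * m)"
      by (simp add: mult.assoc)
    then have *: "a powr s * m \<le> J"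
      using \<open>s > 1\<close> by (simp add: algebra_simps)
    have "I powr s = m powr (s - 1) * (a powr s * m)"
      using m I by (simp add: a_def powr_divide powr_diff)
    also have "\<dots> \<le> m powr (s - 1) * J"
      using * by (intro mult_left_mono) auto
    finally show ?thesis
      using I J m by (simp add: epowr_ennreal flip: ennreal_mult)
  qed
qed

text \<open>Trades powers for level sets, so that a weak type bound can be integrated to a strong
  one. The value \<open>a = top\<close> is included.\<close>

lemma epowr_layer_cake:
  assumes "0 < c"
  shows "epowr a c
    = (\<integral>\<^sup>+t. ennreal (c * t powr (c - 1)) * indicator {t. 0 < t \<and> ennreal t < a} t \<partial>lborel)"
proof -
  have fin: "(\<integral>\<^sup>+t. ennreal (c * t powr (c - 1)) * indicator {0<..<b} t \<partial>lborel) = ennreal (b powr c)"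
    if "0 \<le> b" for b
  proof -
    have "((\<lambda>t. c * t powr (c - 1)) has_integral c * (b powr (c - 1 + 1) / (c - 1 + 1))) {0..b}"
      using assms that by (intro has_integral_mult_right has_integral_powr_from_0) auto
    then have "((\<lambda>t. indicator {0..b} t * (c * t powr (c - 1))) has_integral b powr c) UNIV"
      using assms has_integral_restrict_UNIV[of "{0..b}" "\<lambda>t. c * t powr (c - 1)"]
      by (simp add: indicator_def of_bool_def if_distrib[where f = "\<lambda>x. x * _"] cong: if_cong)
    then have "(\<integral>\<^sup>+t. ennreal (indicator {0..b} t * (c * t powr (c - 1))) \<partial>lborel) = ennreal (b powr c)"
      using assms by (intro nn_integral_has_integral_lborel) auto
    moreover have "(\<integral>\<^sup>+t. ennreal (c * t powr (c - 1)) * indicator {0<..<b} t \<partial>lborel)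
       = (\<integral>\<^sup>+t. ennreal (indicator {0..b} t * (c * t powr (c - 1))) \<partial>lborel)"
    proof (rule nn_integral_cong_AE)
      have "AE t in lborel. t \<noteq> 0 \<and> t \<noteq> b"
        using AE_lborel_singleton[of 0] AE_lborel_singleton[of b] by auto
      then show "AE t in lborel. ennreal (c * t powr (c - 1)) * indicator {0<..<b} t
          = ennreal (indicator {0..b} t * (c * t powr (c - 1)))"
        by eventually_elim (auto simp: indicator_def)
    qed
    ultimately show ?thesis by simp
  qed
  show ?thesis
  proof (cases a)
    case (real b)
    then have "{t. 0 < t \<and> ennreal t < a} = {0<..<b}"
      by (auto simp: ennreal_less_iff)
    then show ?thesis using fin real by (simp add: epowr_ennreal)
  next
    case top
    have "ennreal (real n) \<le> (\<integral>\<^sup>+t. ennreal (c * t powr (c - 1)) * indicator {t. 0 < t \<and> ennreal t < a} t \<partial>lborel)"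
      (is "_ \<le> ?I") for n :: nat
    proof -
      have "ennreal (real n) = ennreal ((real n powr (1 / c)) powr c)"
        using assms by (simp add: powr_powr)
      also have "\<dots> = (\<integral>\<^sup>+t. ennreal (c * t powr (c - 1)) * indicator {0<..<real n powr (1 / c)} t \<partial>lborel)"
        by (subst fin) auto
      also have "\<dots> \<le> ?I"
        by (intro nn_integral_mono) (auto simp: indicator_def top)
      finally show ?thesis .
    qed
    then have "?I = top"
      by (metis ennreal_Ex_less_of_nat ennreal_of_nat_eq_real_of_nat leD less_top)
    then show ?thesis using top by simp
  qed
qed

subsection \<open>Carleson embedding for laminar families\<close>

text \<open>The only feature of dyadic intervals that the embedding uses. Indexing allows equal sets
  with different weights.\<close>

definition laminar_on :: "('i \<Rightarrow> 'a set) \<Rightarrow> 'i set \<Rightarrow> bool" where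
  "laminar_on Q F \<longleftrightarrow> (\<forall>i\<in>F. \<forall>j\<in>F. Q i \<subseteq> Q j \<or> Q j \<subseteq> Q i \<or> Q i \<inter> Q j = {})"

lemma laminar_on_mono: "laminar_on Q F \<Longrightarrow> G \<subseteq> F \<Longrightarrow> laminar_on Q G"
  by (auto simp: laminar_on_def)

text \<open>The maximal members, found by induction: a new set is discarded if an old one contains
  it, and otherwise replaces the old ones that it contains.\<close>

lemma laminar_maximal_subfamily:
  assumes "finite F" "laminar_on Q F"
  shows "\<exists>G\<subseteq>F. disjoint_family_on Q G \<and> (\<forall>i\<in>F. \<exists>j\<in>G. Q i \<subseteq> Q j)"
  using assms
proof (induction F rule: finite_induct)
  case empty
  then show ?case by (auto simp: disjoint_family_on_def)
next
  case (insert i F)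
  then obtain G where G: "G \<subseteq> F" "disjoint_family_on Q G" "\<forall>k\<in>F. \<exists>j\<in>G. Q k \<subseteq> Q j"
    using laminar_on_mono[of Q "insert i F" F] by auto
  show ?case
  proof (cases "\<exists>j\<in>G. Q i \<subseteq> Q j")
    case True
    then show ?thesis using G by (intro exI[of _ G]) auto
  next
    case False
    define G' where "G' = insert i {j\<in>G. \<not> Q j \<subseteq> Q i}"
    have "disjoint_family_on Q G'"
      using G(1,2) False insert.prems
      unfolding disjoint_family_on_def G'_def laminar_on_def by (auto; blast)
    moreover have "\<forall>k\<in>insert i F. \<exists>j\<in>G'. Q k \<subseteq> Q j"
      using G(3) unfolding G'_def by (auto; blast)
    ultimately show ?thesis
      using G(1) by (intro exI[of _ G']) (auto simp: G'_def)
  qed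
qed

text \<open>Only the part of \<open>g\<close> above \<open>l / 2\<close> contributes to averages larger than \<open>l\<close>; this makes
  the layer-cake integral of the right-hand side converge without a maximal theorem.\<close>

lemma carleson_weak_type:
  fixes g :: "'a \<Rightarrow> ennreal"
  assumes fin: "finite F" and lam: "laminar_on Q F"
    and [measurable]: "\<And>i. i \<in> F \<Longrightarrow> Q i \<in> sets \<mu>" "g \<in> borel_measurable \<mu>"
    and pos: "\<And>i. i \<in> F \<Longrightarrow> 0 < emeasure \<mu> (Q i)" and finm: "\<And>i. i \<in> F \<Longrightarrow> emeasure \<mu> (Q i) < top"
    and carl: "\<And>j. j \<in> F \<Longrightarrow> (\<Sum>i\<in>{i\<in>F. Q i \<subseteq> Q j}. b i) \<le> B * emeasure \<mu> (Q j)"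
    and "0 < l"
  shows "(\<Sum>i\<in>{i\<in>F. ennreal l < (\<integral>\<^sup>+x\<in>Q i. g x \<partial>\<mu>) / emeasure \<mu> (Q i)}. b i)
      \<le> B * (ennreal (2 / l) * (\<integral>\<^sup>+x. g x * indicator {x. ennreal (l / 2) < g x} x \<partial>\<mu>))"
proof -
  define F' where "F' = {i\<in>F. ennreal l < (\<integral>\<^sup>+x\<in>Q i. g x \<partial>\<mu>) / emeasure \<mu> (Q i)}"
  define h where "h x = g x * indicator {x. ennreal (l / 2) < g x} x" for x
  have h_m [measurable]: "h \<in> borel_measurable \<mu>"
  proof -
    have "h = (\<lambda>x. if ennreal (l / 2) < g x then g x else 0)"
      by (auto simp: h_def fun_eq_iff)
    then show ?thesis by simp
  qed
  have "F' \<subseteq> F" "finite F'" using fin by (auto simp: F'_def)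
  then obtain G where G: "G \<subseteq> F'" "disjoint_family_on Q G" "\<forall>i\<in>F'. \<exists>j\<in>G. Q i \<subseteq> Q j"
    using laminar_maximal_subfamily[of F' Q] laminar_on_mono[OF lam] by auto
  have finG: "finite G" using G(1) \<open>finite F'\<close> by (rule finite_subset)
  \<comment> \<open>The average exceeds \<open>l\<close>, while the part of \<open>g\<close> up to
    \<open>l / 2\<close> contributes at most half of this; the rest, \<open>h\<close>, accounts for
    the other half.\<close>
  have large: "emeasure \<mu> (Q j) \<le> ennreal (2 / l) * (\<integral>\<^sup>+x\<in>Q j. h x \<partial>\<mu>)" if "j \<in> G" for j
  proof -
    have j: "j \<in> F" "j \<in> F'" using that G \<open>F' \<subseteq> F\<close> by auto
    note [measurable] = assms(3)[OF j(1)]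
    obtain m where m: "emeasure \<mu> (Q j) = ennreal m" "0 < m"
      using pos[OF j(1)] finm[OF j(1)] by (cases "emeasure \<mu> (Q j)") auto
    have "ennreal l * ennreal m \<le> (\<integral>\<^sup>+x\<in>Q j. g x \<partial>\<mu>)"
    proof (cases "(\<integral>\<^sup>+x\<in>Q j. g x \<partial>\<mu>)")
      case (real r)
      then have "l < r / m"
        using j(2) m \<open>0 < l\<close> by (simp add: F'_def divide_ennreal ennreal_less_iff)
      then have "l * m \<le> r" using m by (simp add: field_simps)
      then show ?thesis using real m \<open>0 < l\<close> by (simp flip: ennreal_mult)
    qed simp
    also have "\<dots> \<le> (\<integral>\<^sup>+x. h x * indicator (Q j) x + ennreal (l / 2) * indicator (Q j) x \<partial>\<mu>)"
      by (intro nn_integral_mono) (auto simp: h_def indicator_def)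
    also have "\<dots> = (\<integral>\<^sup>+x\<in>Q j. h x \<partial>\<mu>) + ennreal (l / 2) * ennreal m"
      by (simp add: nn_integral_add nn_integral_cmult m)
    finally have *: "ennreal l * ennreal m \<le> (\<integral>\<^sup>+x\<in>Q j. h x \<partial>\<mu>) + ennreal (l / 2) * ennreal m" .
    have "ennreal m \<le> ennreal (2 / l) * (\<integral>\<^sup>+x\<in>Q j. h x \<partial>\<mu>)"
    proof (cases "(\<integral>\<^sup>+x\<in>Q j. h x \<partial>\<mu>)")
      case (real r)
      then have "l * m \<le> r + l / 2 * m"
        using * m \<open>0 < l\<close> by (simp flip: ennreal_mult ennreal_plus)
      then have "m \<le> 2 / l * r" using \<open>0 < l\<close> by (simp add: field_simps)
      then show ?thesis using real \<open>0 < l\<close> by (simp flip: ennreal_mult)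
    qed (use \<open>0 < l\<close> in \<open>simp add: ennreal_mult_top\<close>)
    then show ?thesis using m by simp
  qed
  \<comment> \<open>Each set with a large average lies in a maximal one, so its weight is counted in
    the packing sum of that one.\<close>
  have "(\<Sum>i\<in>F'. b i) \<le> (\<Sum>j\<in>G. \<Sum>i\<in>{i\<in>F. Q i \<subseteq> Q j}. b i)"
  proof -
    have "F' \<subseteq> (\<Union>j\<in>G. {i\<in>F. Q i \<subseteq> Q j})" using G(3) \<open>F' \<subseteq> F\<close> by auto
    then have "(\<Sum>i\<in>F'. b i) \<le> (\<Sum>i\<in>(\<Union>j\<in>G. {i\<in>F. Q i \<subseteq> Q j}). b i)"
      using fin finG by (intro sum_mono2) auto
    also have "\<dots> \<le> (\<Sum>j\<in>G. \<Sum>i\<in>{i\<in>F. Q i \<subseteq> Q j}. b i)"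
      using finG
    proof (induction G rule: finite_induct)
      case (insert x A)
      let ?U = "\<Union>j\<in>A. {i\<in>F. Q i \<subseteq> Q j}"
      have "sum b ({i\<in>F. Q i \<subseteq> Q x} \<union> ?U) = sum b ({i\<in>F. Q i \<subseteq> Q x} - ?U) + sum b ?U"
        using fin insert.hyps by (subst sum.union_disjoint[symmetric]) (auto intro!: arg_cong[where f="sum b"])
      also have "\<dots> \<le> sum b {i\<in>F. Q i \<subseteq> Q x} + sum b ?U"
        using fin insert.hyps by (intro add_mono sum_mono2) auto
      finally show ?case
        using insert by (auto intro: order_trans add_left_mono)
    qed simp
    finally show ?thesis .
  qed
  also have "\<dots> \<le> (\<Sum>j\<in>G. B * (ennreal (2 / l) * (\<integral>\<^sup>+x\<in>Q j. h x \<partial>\<mu>)))"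
    using G(1) \<open>F' \<subseteq> F\<close> large by (intro sum_mono order_trans[OF carl] mult_left_mono) auto
  also have "\<dots> = B * (ennreal (2 / l) * (\<Sum>j\<in>G. \<integral>\<^sup>+x\<in>Q j. h x \<partial>\<mu>))"
    by (simp add: sum_distrib_left)
  also have "(\<Sum>j\<in>G. \<integral>\<^sup>+x\<in>Q j. h x \<partial>\<mu>) = (\<integral>\<^sup>+x. (\<Sum>j\<in>G. h x * indicator (Q j) x) \<partial>\<mu>)"
    using G(1) \<open>F' \<subseteq> F\<close> assms(3) by (intro nn_integral_sum[symmetric] borel_measurable_times) auto
  also have "\<dots> \<le> (\<integral>\<^sup>+x. h x \<partial>\<mu>)"
  proof (rule nn_integral_mono)
    fix x
    have "(\<Sum>j\<in>G. indicator (Q j) x :: ennreal) = indicator (\<Union>j\<in>G. Q j) x"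
      by (rule indicator_UN_disjoint[OF finG G(2), symmetric])
    then show "(\<Sum>j\<in>G. h x * indicator (Q j) x) \<le> h x"
      by (simp add: sum_distrib_left[symmetric] indicator_def)
  qed
  finally show ?thesis
    unfolding F'_def h_def by (simp add: mult_left_mono)
qed

text \<open>The weak type estimate is integrated against \<open>p * t powr (p - 1)\<close>. After
  exchanging integrals, the inner one is \<open>2 * p * g\<close> times the integral of
  \<open>t powr (p - 2)\<close> up to \<open>2 * g\<close>, which converges because
  \<open>1 < p\<close> and produces \<open>2 powr p * dual_exp p\<close>.\<close>

theorem carleson_embedding:
  fixes g :: "'a \<Rightarrow> ennreal"
  assumes "1 < p" and "sigma_finite_measure \<mu>" and fin: "finite F" and lam: "laminar_on Q F"
    and Q: "\<And>i. i \<in> F \<Longrightarrow> Q i \<in> sets \<mu>" and [measurable]: "g \<in> borel_measurable \<mu>"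
    and pos: "\<And>i. i \<in> F \<Longrightarrow> 0 < emeasure \<mu> (Q i)" and finm: "\<And>i. i \<in> F \<Longrightarrow> emeasure \<mu> (Q i) < top"
    and carl: "\<And>j. j \<in> F \<Longrightarrow> (\<Sum>i\<in>{i\<in>F. Q i \<subseteq> Q j}. b i) \<le> B * emeasure \<mu> (Q j)"
  shows "(\<Sum>i\<in>F. b i * epowr ((\<integral>\<^sup>+x\<in>Q i. g x \<partial>\<mu>) / emeasure \<mu> (Q i)) p)
      \<le> ennreal (2 powr p * dual_exp p) * B * (\<integral>\<^sup>+x. epowr (g x) p \<partial>\<mu>)"
proof -
  interpret sigma_finite_measure \<mu> by fact
  interpret pair_sigma_finite lborel \<mu> ..
  define a where "a i = (\<integral>\<^sup>+x\<in>Q i. g x \<partial>\<mu>) / emeasure \<mu> (Q i)" for i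
  define k where "k t = ennreal (p * t powr (p - 1)) * indicator {0<..} t" for t
  have [measurable]: "k \<in> borel_measurable lborel" unfolding k_def[abs_def] by measurable
  have cake: "epowr y p = (\<integral>\<^sup>+t. k t * (if ennreal t < y then 1 else 0) \<partial>lborel)" for y
    using assms(1) by (subst epowr_layer_cake)
      (auto simp: k_def indicator_def intro!: nn_integral_cong)
  have "(\<Sum>i\<in>F. b i * epowr (a i) p) = (\<Sum>i\<in>F. \<integral>\<^sup>+t. b i * (k t * (if ennreal t < a i then 1 else 0)) \<partial>lborel)"
    by (simp add: cake nn_integral_cmult)
  also have "\<dots> = (\<integral>\<^sup>+t. (\<Sum>i\<in>F. b i * (k t * (if ennreal t < a i then 1 else 0))) \<partial>lborel)"
    by (subst nn_integral_sum) auto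
  also have "\<dots> = (\<integral>\<^sup>+t. k t * (\<Sum>i\<in>{i\<in>F. ennreal t < a i}. b i) \<partial>lborel)"
  proof (rule nn_integral_cong)
    fix t
    have "(\<Sum>i\<in>F. b i * (k t * (if ennreal t < a i then 1 else 0))) = k t * (\<Sum>i\<in>F. if ennreal t < a i then b i else 0)"
      by (subst sum_distrib_left) (auto intro!: sum.cong simp: mult_ac)
    then show "(\<Sum>i\<in>F. b i * (k t * (if ennreal t < a i then 1 else 0))) = k t * (\<Sum>i\<in>{i\<in>F. ennreal t < a i}. b i)"
      using fin by (simp add: sum.inter_filter)
  qed
  also have "\<dots> \<le> (\<integral>\<^sup>+t. k t * (B * (ennreal (2 / t) * (\<integral>\<^sup>+x. (if ennreal (t / 2) < g x then g x else 0) \<partial>\<mu>))) \<partial>lborel)"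
  proof (rule nn_integral_mono)
    fix t :: real
    show "k t * (\<Sum>i\<in>{i\<in>F. ennreal t < a i}. b i) \<le> k t * (B * (ennreal (2 / t) * (\<integral>\<^sup>+x. (if ennreal (t / 2) < g x then g x else 0) \<partial>\<mu>)))"
    proof (cases "0 < t")
      case True
      have "(\<lambda>x. (if ennreal (t / 2) < g x then g x else 0)) = (\<lambda>x. g x * indicator {x. ennreal (t / 2) < g x} x)"
        by auto
      then show ?thesis
        unfolding a_def using True
        by (intro mult_left_mono) (simp_all only: carleson_weak_type[OF fin lam Q _ pos finm carl True] assms zero_le)
    qed (simp add: k_def)
  qed
  also have "\<dots> = (\<integral>\<^sup>+t. \<integral>\<^sup>+x. k t * (B * (ennreal (2 / t) * (if ennreal (t / 2) < g x then g x else 0))) \<partial>\<mu> \<partial>lborel)"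
    by (simp add: nn_integral_cmult)
  also have "\<dots> = (\<integral>\<^sup>+x. \<integral>\<^sup>+t. k t * (B * (ennreal (2 / t) * (if ennreal (t / 2) < g x then g x else 0))) \<partial>lborel \<partial>\<mu>)"
    by (rule Fubini'[symmetric]) measurable
  also have "\<dots> = (\<integral>\<^sup>+x. ennreal (2 powr p * dual_exp p) * B * epowr (g x) p \<partial>\<mu>)"
  proof (rule nn_integral_cong)
    fix x
    have "(\<integral>\<^sup>+t. k t * (B * (ennreal (2 / t) * (if ennreal (t / 2) < g x then g x else 0))) \<partial>lborel)
      = (\<integral>\<^sup>+t. (ennreal (2 * dual_exp p) * B * g x) * (ennreal ((p - 1) * t powr (p - 1 - 1))
          * indicator {t. 0 < t \<and> ennreal t < 2 * g x} t) \<partial>lborel)"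
    proof (rule nn_integral_cong)
      fix t :: real
      have iff: "ennreal (t / 2) < g x \<longleftrightarrow> ennreal t < 2 * g x" if "0 < t"
      proof -
        have "ennreal t = ennreal 2 * ennreal (t / 2)"
          using that by (subst ennreal_mult[symmetric]) auto
        then show ?thesis
          using that by (cases "g x") (auto simp: ennreal_mult_top ennreal_less_iff simp flip: ennreal_mult ennreal_numeral)
      qed
      show "k t * (B * (ennreal (2 / t) * (if ennreal (t / 2) < g x then g x else 0)))
         = (ennreal (2 * dual_exp p) * B * g x) * (ennreal ((p - 1) * t powr (p - 1 - 1))
          * indicator {t. 0 < t \<and> ennreal t < 2 * g x} t)"
      proof (cases "0 < t \<and> ennreal t < 2 * g x")
        case True
        have "p * t powr (p - 1) * (2 / t) = 2 * dual_exp p * ((p - 1) * t powr (p - 1 - 1))"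
          using True assms(1) by (simp add: dual_exp_def powr_diff field_simps power2_eq_square)
        then have "ennreal (p * t powr (p - 1)) * ennreal (2 / t) = ennreal (2 * dual_exp p) * ennreal ((p - 1) * t powr (p - 1 - 1))"
          using True assms(1) by (simp add: dual_exp_def flip: ennreal_mult)
        then show ?thesis
          using True iff by (simp add: k_def mult_ac)
      qed (use iff in \<open>auto simp: k_def indicator_def\<close>)
    qed
    also have "\<dots> = ennreal (2 * dual_exp p) * B * g x * epowr (2 * g x) (p - 1)"
      using assms(1) by (subst nn_integral_cmult) (auto simp: epowr_layer_cake)
    also have "\<dots> = ennreal (2 * dual_exp p) * ennreal (2 powr (p - 1)) * B * (g x * epowr (g x) (p - 1))"
      using epowr_ennreal[of 2 "p - 1"] by (simp add: epowr_mult mult_ac)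
    also have "ennreal (2 * dual_exp p) * ennreal (2 powr (p - 1)) = ennreal (2 powr p * dual_exp p)"
    proof -
      have "0 \<le> dual_exp p" using assms(1) by (simp add: dual_exp_def)
      then show ?thesis by (simp add: powr_diff flip: ennreal_mult)
    qed
    also have "g x * epowr (g x) (p - 1) = epowr (g x) p"
      using epowr_add[of "g x" 1 "p - 1"] by simp
    finally show "(\<integral>\<^sup>+t. k t * (B * (ennreal (2 / t) * (if ennreal (t / 2) < g x then g x else 0))) \<partial>lborel)
       = ennreal (2 powr p * dual_exp p) * B * epowr (g x) p" .
  qed
  also have "\<dots> = ennreal (2 powr p * dual_exp p) * B * (\<integral>\<^sup>+x. epowr (g x) p \<partial>\<mu>)"
    by (simp add: nn_integral_cmult)
  finally show ?thesis by (simp add: a_def)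
qed

subsection \<open>The two-weight testing argument\<close>

locale frac_exponents =
  fixes \<alpha> p q :: real
  assumes \<alpha>: "0 < \<alpha>" "\<alpha> < 1" and p: "1 < p" "p < 1 / \<alpha>" and q: "q = p / (1 - \<alpha> * p)"
begin

definition "\<rho> = q / dual_exp p"

definition "\<tau> = 1 + 1 / \<rho>"

lemma p': "1 < dual_exp p" "dual_exp p * (p - 1) = p"
  using p by (auto simp: dual_exp_def)

lemma \<alpha>p: "\<alpha> * p < 1"
  using p \<alpha> by (simp add: field_simps)

lemma p_less_q: "p < q"
proof -
  have "p * (1 - \<alpha> * p) < p * 1"
    using p \<alpha> by (intro mult_strict_left_mono) auto
  then show ?thesis
    using \<alpha>p by (simp add: q less_divide_eq)
qed

lemma q_pos: "0 < q" "1 < q"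
  using p_less_q p by auto

lemma inverse_q: "1 / q = 1 / p - \<alpha>"
  using p \<alpha>p by (simp add: q field_simps)

lemma \<rho>_eq: "\<rho> = q - q / p"
  using p by (simp add: \<rho>_def dual_exp_def field_simps)

lemma \<rho>_pos: "0 < \<rho>"
  using q_pos p' by (simp add: \<rho>_def)

text \<open>Homogeneity: the normalisation \<open>l powr (\<alpha> - 1)\<close> of an average,
  raised to \<open>q\<close>, cancels the power of the length in the one-sided condition.\<close>

lemma one_plus_\<rho>: "q * (1 - \<alpha>) = 1 + \<rho>"
proof -
  have "q * \<alpha> = q * (1 / p - 1 / q)" by (simp add: inverse_q)
  also have "\<dots> = q / p - 1" using q_pos by (simp add: right_diff_distrib)
  finally show ?thesis by (simp add: \<rho>_eq right_diff_distrib)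
qed

lemma \<tau>_gt_1: "1 < \<tau>"
  using \<rho>_pos by (simp add: \<tau>_def)

lemma \<tau>_\<rho>: "\<tau> * \<rho> = 1 + \<rho>"
  using \<rho>_pos by (simp add: \<tau>_def distrib_right)

lemma q_over_\<rho>: "q / \<rho> = dual_exp p"
  using q_pos p' by (simp add: \<rho>_def)

text \<open>The testing argument bounds the \<open>q\<close>-th power of a norm with the factor
  \<open>a powr \<tau>\<close>, so the \<open>q\<close>-th root leaves exactly the power
  \<beta>.\<close>

lemma \<tau>_beta: "dual_exp p / q * (1 - \<alpha>) * q = \<tau>"
proof -
  have "\<tau> = (1 + \<rho>) / \<rho>" using \<rho>_pos by (simp add: \<tau>_def add_divide_distrib)
  also have "\<dots> = (q * (1 - \<alpha>)) / (q / dual_exp p)" by (simp add: one_plus_\<rho>) (simp add: \<rho>_def)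
  finally show ?thesis using q_pos p' by simp
qed

text \<open>The outer factor is the embedding for \<open>s\<close> with exponent \<open>p\<close>.
  In the bracket, 1 comes from the interval itself and the rest from the embedding for
  \<open>1 / u\<close> with exponent \<tau>.\<close>

definition C_test :: real where
  "C_test = 2 powr p * dual_exp p * (1 + 2 powr \<tau> * dual_exp \<tau>)"

lemma C_test_pos: "0 < C_test"
proof -
  have "0 < dual_exp \<tau>" using \<tau>_gt_1 by (simp add: dual_exp_def)
  then show ?thesis using p' by (simp add: C_test_def add_pos_pos)
qed

end

text \<open>\<open>L i\<close> and \<open>R i\<close> are abstract left and right halves of dyadic intervals of length \<open>2 l i\<close>. Only
  the condition named \<open>cross\<close> links the two laminar families.\<close>

locale testing_family = frac_exponents + sigma_finite_measure M
  for M :: "'a measure" +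
  fixes v :: "'a \<Rightarrow> real" and F :: "'i set" and L R E :: "'i \<Rightarrow> 'a set" and l :: "'i \<Rightarrow> real" and a :: real
  assumes v_meas [measurable]: "v \<in> borel_measurable M" and v_pos: "\<And>x. 0 < v x"
    and fin: "finite F" and lamL: "laminar_on L F" and lamR: "laminar_on R F"
    and cross: "\<And>i j. i \<in> F \<Longrightarrow> j \<in> F \<Longrightarrow> i \<noteq> j \<Longrightarrow> L i \<subseteq> L j \<Longrightarrow> R i \<subseteq> L j"
    and L_meas: "\<And>i. i \<in> F \<Longrightarrow> L i \<in> sets M"
    and R_meas: "\<And>i. i \<in> F \<Longrightarrow> R i \<in> sets M"
    and E_meas: "\<And>i. i \<in> F \<Longrightarrow> E i \<in> sets M"
    and ER: "\<And>i. i \<in> F \<Longrightarrow> E i \<subseteq> R i" and E_disj: "disjoint_family_on E F"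
    and l_pos: "\<And>i. i \<in> F \<Longrightarrow> 0 < l i"
    and L_pos: "\<And>i. i \<in> F \<Longrightarrow> 0 < emeasure M (L i)"
    and R_size: "\<And>i. i \<in> F \<Longrightarrow> emeasure M (R i) = ennreal (l i)"
    and a: "1 \<le> a"
    and A_cond: "\<And>i. i \<in> F \<Longrightarrow>
      (\<integral>\<^sup>+x\<in>R i. ennreal (v x powr q) \<partial>M) * epowr (\<integral>\<^sup>+x\<in>L i. ennreal (v x powr (- dual_exp p)) \<partial>M) \<rho>
        \<le> ennreal (a * l i powr (1 + \<rho>))"
begin

definition "\<mu>\<^sub>u = density M (\<lambda>x. ennreal (v x powr q))"
definition "\<mu>\<^sub>s = density M (\<lambda>x. ennreal (v x powr (- dual_exp p)))"

lemma sigma_finite_us: "sigma_finite_measure \<mu>\<^sub>u" "sigma_finite_measure \<mu>\<^sub>s"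
  unfolding \<mu>\<^sub>u_def \<mu>\<^sub>s_def by (subst sigma_finite_iff_density_finite; simp)+

lemma sets_us [measurable_cong]: "sets \<mu>\<^sub>u = sets M" "sets \<mu>\<^sub>s = sets M"
  by (simp_all add: \<mu>\<^sub>u_def \<mu>\<^sub>s_def)

lemma emeasure_us:
  assumes "X \<in> sets M"
  shows "emeasure \<mu>\<^sub>u X = (\<integral>\<^sup>+x\<in>X. ennreal (v x powr q) \<partial>M)"
    and "emeasure \<mu>\<^sub>s X = (\<integral>\<^sup>+x\<in>X. ennreal (v x powr (- dual_exp p)) \<partial>M)"
  using assms by (simp_all add: \<mu>\<^sub>u_def \<mu>\<^sub>s_def emeasure_density)

lemma emeasure_us_pos:
  assumes "X \<in> sets M" "0 < emeasure M X"
  shows "0 < emeasure \<mu>\<^sub>u X" "0 < emeasure \<mu>\<^sub>s X"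
proof -
  have "\<not> (AE x in M. x \<notin> X)"
    using assms AE_iff_null_sets[of X M] by auto
  then show "0 < emeasure \<mu>\<^sub>u X" "0 < emeasure \<mu>\<^sub>s X"
    using assms(1) v_pos[THEN less_imp_neq, symmetric]
    by (auto simp: emeasure_us zero_less_iff_neq_zero nn_integral_0_iff_AE indicator_def less_imp_neq
        simp del: not_gr_zero)
qed

text \<open>A finite product of positive factors has finite factors, so the weights of the halves
  may be treated as positive reals from here on.\<close>

lemma us_finite:
  assumes "i \<in> F"
  obtains U S where "emeasure \<mu>\<^sub>u (R i) = ennreal U" "emeasure \<mu>\<^sub>s (L i) = ennreal S" "0 < U" "0 < S"
    "U * S powr \<rho> \<le> a * l i powr (1 + \<rho>)"
proof -
  have pos: "0 < emeasure \<mu>\<^sub>u (R i)" "0 < emeasure \<mu>\<^sub>s (L i)"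
    using assms L_meas R_meas L_pos R_size l_pos by (auto intro!: emeasure_us_pos)
  have le: "emeasure \<mu>\<^sub>u (R i) * epowr (emeasure \<mu>\<^sub>s (L i)) \<rho> \<le> ennreal (a * l i powr (1 + \<rho>))"
    using A_cond[OF assms] by (simp add: emeasure_us assms L_meas R_meas)
  then have "emeasure \<mu>\<^sub>u (R i) * epowr (emeasure \<mu>\<^sub>s (L i)) \<rho> \<noteq> top"
    by (auto simp: top_unique)
  then have "emeasure \<mu>\<^sub>u (R i) \<noteq> top" "emeasure \<mu>\<^sub>s (L i) \<noteq> top"
    using pos by (auto simp: ennreal_mult_eq_top_iff)
  then obtain U S where US: "emeasure \<mu>\<^sub>u (R i) = ennreal U" "emeasure \<mu>\<^sub>s (L i) = ennreal S" "0 \<le> U" "0 \<le> S"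
    by (metis ennreal_cases)
  moreover have "0 < U" "0 < S" using pos US by auto
  moreover have "U * S powr \<rho> \<le> a * l i powr (1 + \<rho>)"
    using le a US by (simp add: epowr_ennreal flip: ennreal_mult)
  ultimately show ?thesis using that by blast
qed

text \<open>Since the \<open>E i\<close> are disjoint parts of the \<open>R i\<close>, the weights
  \<open>u(E i)\<close> satisfy the Carleson condition for \<open>\<mu>\<^sub>u\<close> with
  constant 1.\<close>

lemma sum_E_le:
  assumes "X \<in> sets M"
  shows "(\<Sum>i\<in>{i\<in>F. R i \<subseteq> X}. emeasure \<mu>\<^sub>u (E i)) \<le> emeasure \<mu>\<^sub>u X"
proof -
  have "(\<Sum>i\<in>{i\<in>F. R i \<subseteq> X}. emeasure \<mu>\<^sub>u (E i)) = emeasure \<mu>\<^sub>u (\<Union>i\<in>{i\<in>F. R i \<subseteq> X}. E i)"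
    using fin E_disj E_meas sets_us by (intro sum_emeasure) (auto simp: disjoint_family_on_def)
  also have "\<dots> \<le> emeasure \<mu>\<^sub>u X"
    using assms ER sets_us by (intro emeasure_mono) blast+
  finally show ?thesis .
qed

text \<open>The conversion \<open>enn2real\<close> is harmless, as \<open>s(L i)\<close> is finite
  by \<open>us_finite\<close>.\<close>

definition "b i = emeasure \<mu>\<^sub>u (E i) * ennreal ((enn2real (emeasure \<mu>\<^sub>s (L i)) / l i) powr (1 + \<rho>))"

text \<open>For the interval that owns the packing sum, the right half need not lie in the left
  half, so the second embedding does not reach it. This direct estimate serves there.\<close>

lemma b_le_self: "i \<in> F \<Longrightarrow> b i \<le> ennreal a * emeasure \<mu>\<^sub>s (L i)"
proof -
  assume i: "i \<in> F"
  from us_finite[OF i] obtain U S where US: "emeasure \<mu>\<^sub>u (R i) = ennreal U" "emeasure \<mu>\<^sub>s (L i) = ennreal S" "0 < U" "0 < S"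
    "U * S powr \<rho> \<le> a * l i powr (1 + \<rho>)" .
  have "b i \<le> ennreal U * ennreal ((S / l i) powr (1 + \<rho>))"
    unfolding b_def US(2) US(1)[symmetric] using US(4) ER[OF i] R_meas[OF i] sets_us
    by (auto intro!: mult_right_mono emeasure_mono)
  also have "\<dots> = ennreal (U * S powr \<rho> / l i powr (1 + \<rho>) * S)"
    using US l_pos[OF i] by (simp add: powr_divide powr_add field_simps flip: ennreal_mult)
  also have "\<dots> \<le> ennreal (a * S)"
    using US l_pos[OF i] by (intro ennreal_leI mult_right_mono) (auto simp: divide_le_eq)
  also have "\<dots> = ennreal a * emeasure \<mu>\<^sub>s (L i)"
    using US a by (simp add: ennreal_mult)
  finally show ?thesis .
qed

text \<open>The condition reads \<open>(S / l) powr \<rho> \<le> a * l / U\<close>; both sides are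
  raised to \<tau>, where \<open>\<tau> * \<rho> = 1 + \<rho>\<close>.\<close>

lemma b_le_avg:
  assumes i: "i \<in> F"
  shows "b i \<le> ennreal (a powr \<tau>) * (emeasure \<mu>\<^sub>u (E i) * epowr (ennreal (l i) / emeasure \<mu>\<^sub>u (R i)) \<tau>)"
proof -
  from us_finite[OF i] obtain U S where US: "emeasure \<mu>\<^sub>u (R i) = ennreal U" "emeasure \<mu>\<^sub>s (L i) = ennreal S" "0 < U" "0 < S"
    "U * S powr \<rho> \<le> a * l i powr (1 + \<rho>)" .
  have l: "0 < l i" using l_pos i by simp
  have "(S / l i) powr \<rho> \<le> a * l i / U"
    using US l by (simp add: powr_divide powr_add field_simps)
  then have "((S / l i) powr \<rho>) powr \<tau> \<le> (a * l i / U) powr \<tau>"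
    using \<tau>_gt_1 by (intro powr_mono2) auto
  moreover have "((S / l i) powr \<rho>) powr \<tau> = (S / l i) powr (1 + \<rho>)"
    using \<tau>_\<rho> by (simp add: powr_powr mult.commute)
  moreover have "(a * l i / U) powr \<tau> = a powr \<tau> * (l i / U) powr \<tau>"
    using a l US by (simp add: powr_mult powr_divide)
  ultimately have "ennreal ((S / l i) powr (1 + \<rho>)) \<le> ennreal (a powr \<tau>) * epowr (ennreal (l i) / ennreal U) \<tau>"
    using l US by (simp add: divide_ennreal epowr_ennreal flip: ennreal_mult)
  then have "emeasure \<mu>\<^sub>u (E i) * ennreal ((S / l i) powr (1 + \<rho>)) \<le> emeasure \<mu>\<^sub>u (E i) * (ennreal (a powr \<tau>) * epowr (ennreal (l i) / ennreal U) \<tau>)"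
    by (rule mult_left_mono) simp
  then show ?thesis
    using US by (simp add: b_def mult_ac)
qed

text \<open>By \<open>cross\<close>, every other interval with left half in \<open>L j\<close> has
  its right half there too, so the second embedding needs \<open>1 / u\<close> on \<open>L j\<close>
  only.\<close>

lemma carleson_b:
  assumes j: "j \<in> F"
  shows "(\<Sum>i\<in>{i\<in>F. L i \<subseteq> L j}. b i)
    \<le> ennreal (a powr \<tau> * (1 + 2 powr \<tau> * dual_exp \<tau>)) * emeasure \<mu>\<^sub>s (L j)"
proof -
  have \<tau>': "0 \<le> dual_exp \<tau>" using \<tau>_gt_1 by (simp add: dual_exp_def)
  define F' where "F' = {i\<in>F. R i \<subseteq> L j}"
  have F': "finite F'" "F' \<subseteq> F" using fin by (auto simp: F'_def)
  note [measurable] = L_meas[OF j]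
  define g where "g x = indicator (L j) x * ennreal (v x powr (- q))" for x
  have [measurable]: "g \<in> borel_measurable M" unfolding g_def[abs_def] by measurable
  have one: "ennreal (v x powr q) * ennreal (v x powr (- q)) = 1" for x
    using v_pos[of x] by (simp add: powr_minus flip: ennreal_mult)
  \<comment> \<open>Integrating \<open>1 / u\<close> against \<open>u\<close> returns the length, so
    the averages of \<open>g\<close> are the quotients \<open>l / u(R)\<close> of
    \<open>b_le_avg\<close>.\<close>
  have avg: "(\<integral>\<^sup>+x\<in>R i. g x \<partial>\<mu>\<^sub>u) = ennreal (l i)" if "i \<in> F'" for i
  proof -
    have i: "i \<in> F" "R i \<subseteq> L j" using that by (auto simp: F'_def)
    note [measurable] = R_meas[OF i(1)]
    have "ennreal (v x powr q) * (g x * indicator (R i) x) = indicator (R i) x" for x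
      using i(2) one[of x] by (auto simp: g_def indicator_def)
    then have "(\<integral>\<^sup>+x\<in>R i. g x \<partial>\<mu>\<^sub>u) = (\<integral>\<^sup>+x. indicator (R i) x \<partial>M)"
      unfolding \<mu>\<^sub>u_def by (subst nn_integral_density) auto
    then show ?thesis using R_size i by simp
  qed
  have "(\<Sum>i\<in>F'. emeasure \<mu>\<^sub>u (E i) * epowr ((\<integral>\<^sup>+x\<in>R i. g x \<partial>\<mu>\<^sub>u) / emeasure \<mu>\<^sub>u (R i)) \<tau>)
      \<le> ennreal (2 powr \<tau> * dual_exp \<tau>) * 1 * (\<integral>\<^sup>+x. epowr (g x) \<tau> \<partial>\<mu>\<^sub>u)"
  proof (rule carleson_embedding[OF \<tau>_gt_1 sigma_finite_us(1) F'(1)])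
    show "laminar_on R F'" using lamR F'(2) by (rule laminar_on_mono)
    fix i assume "i \<in> F'"
    then have i: "i \<in> F" using F' by auto
    show "R i \<in> sets \<mu>\<^sub>u" using i R_meas sets_us by auto
    show "0 < emeasure \<mu>\<^sub>u (R i)" "emeasure \<mu>\<^sub>u (R i) < top"
      using us_finite[OF i] by (metis ennreal_less_zero_iff, metis ennreal_less_top)
    have "(\<Sum>k\<in>{k\<in>F'. R k \<subseteq> R i}. emeasure \<mu>\<^sub>u (E k)) \<le> (\<Sum>k\<in>{k\<in>F. R k \<subseteq> R i}. emeasure \<mu>\<^sub>u (E k))"
      using fin F' by (intro sum_mono2) auto
    also have "\<dots> \<le> emeasure \<mu>\<^sub>u (R i)" using sum_E_le R_meas i by auto
    finally show "(\<Sum>k\<in>{k\<in>F'. R k \<subseteq> R i}. emeasure \<mu>\<^sub>u (E k)) \<le> 1 * emeasure \<mu>\<^sub>u (R i)" by simp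
  qed measurable
  also have "(\<integral>\<^sup>+x. epowr (g x) \<tau> \<partial>\<mu>\<^sub>u) = emeasure \<mu>\<^sub>s (L j)"
  proof -
    \<comment> \<open>This identity makes the \<open>u\<close>-integral of \<open>g\<close> to the
      power \<tau> equal to \<open>s(L j)\<close>.\<close>
    have ex: "q - q * \<tau> = - dual_exp p"
      using q_over_\<rho> by (simp add: \<tau>_def distrib_left)
    have "ennreal (v x powr q) * epowr (g x) \<tau> = ennreal (v x powr (- dual_exp p)) * indicator (L j) x" for x
      using v_pos[of x] ex
      by (simp add: g_def indicator_def epowr_ennreal powr_powr flip: ennreal_mult powr_add)
    then show ?thesis
      unfolding emeasure_us(2)[OF L_meas[OF j]] by (simp add: \<mu>\<^sub>u_def nn_integral_density)
  qed
  finally have *: "(\<Sum>i\<in>F'. emeasure \<mu>\<^sub>u (E i) * epowr (ennreal (l i) / emeasure \<mu>\<^sub>u (R i)) \<tau>)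
      \<le> ennreal (2 powr \<tau> * dual_exp \<tau>) * emeasure \<mu>\<^sub>s (L j)"
    by (simp add: avg cong: sum.cong)
  have "(\<Sum>i\<in>{i\<in>F. L i \<subseteq> L j}. b i) \<le> (\<Sum>i\<in>insert j F'. b i)"
    using F' j cross by (intro sum_mono2) (auto simp: F'_def)
  also have "\<dots> \<le> b j + (\<Sum>i\<in>F'. b i)"
    using F' by (cases "j \<in> F'") (auto simp: insert_absorb add_increasing)
  also have "\<dots> \<le> ennreal (a powr \<tau>) * emeasure \<mu>\<^sub>s (L j)
      + ennreal (a powr \<tau>) * (ennreal (2 powr \<tau> * dual_exp \<tau>) * emeasure \<mu>\<^sub>s (L j))"
  proof (rule add_mono)
    \<comment> \<open>The interval \<open>j\<close> itself costs only the first power of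
      \<open>a\<close>, absorbed because \<open>1 \<le> a\<close>.\<close>
    have "a \<le> a powr \<tau>" using powr_mono[of 1 \<tau> a] a \<tau>_gt_1 by simp
    then show "b j \<le> ennreal (a powr \<tau>) * emeasure \<mu>\<^sub>s (L j)"
      using b_le_self[OF j] by (meson ennreal_leI mult_right_mono order_trans zero_le)
    have "(\<Sum>i\<in>F'. b i) \<le> ennreal (a powr \<tau>) * (\<Sum>i\<in>F'. emeasure \<mu>\<^sub>u (E i) * epowr (ennreal (l i) / emeasure \<mu>\<^sub>u (R i)) \<tau>)"
      unfolding sum_distrib_left using F' b_le_avg by (intro sum_mono) auto
    also have "\<dots> \<le> ennreal (a powr \<tau>) * (ennreal (2 powr \<tau> * dual_exp \<tau>) * emeasure \<mu>\<^sub>s (L j))"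
      using * by (rule mult_left_mono) simp
    finally show "(\<Sum>i\<in>F'. b i) \<le> \<dots>" .
  qed
  also have "\<dots> = (ennreal (a powr \<tau>) * (ennreal 1 + ennreal (2 powr \<tau> * dual_exp \<tau>))) * emeasure \<mu>\<^sub>s (L j)"
    by (simp add: distrib_left distrib_right mult.assoc)
  also have "ennreal (a powr \<tau>) * (ennreal 1 + ennreal (2 powr \<tau> * dual_exp \<tau>)) = ennreal (a powr \<tau> * (1 + 2 powr \<tau> * dual_exp \<tau>))"
    using \<tau>' by (subst ennreal_plus[symmetric]) (auto simp: ennreal_mult)
  finally show ?thesis .
qed

text \<open>The embedding has exponent \<open>p\<close> while the left side has exponent
  \<open>q\<close>. Hoelder's inequality bounds the surplus \<open>q - p\<close> powers of each
  integral by the full norm, whose power \<open>(q - p) / p\<close> completes \<open>G\<close> to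
  \<open>G powr (q / p)\<close>.\<close>

theorem testing_bound:
  assumes [measurable]: "f \<in> borel_measurable M"
  shows "(\<Sum>i\<in>F. emeasure \<mu>\<^sub>u (E i) * epowr (ennreal (l i powr (\<alpha> - 1)) * (\<integral>\<^sup>+x\<in>L i. f x \<partial>M)) q)
    \<le> ennreal (C_test * a powr \<tau>) * epowr (\<integral>\<^sup>+x. epowr (f x * ennreal (v x)) p \<partial>M) (q / p)"
proof (cases "(\<integral>\<^sup>+x. epowr (f x * ennreal (v x)) p \<partial>M)")
  case top
  then show ?thesis using C_test_pos a by (simp add: ennreal_mult_top)
next
  case (real G)
  \<comment> \<open>With \<open>g = f / s\<close>, integrals of \<open>f\<close> become
    \<open>\<mu>\<^sub>s\<close>-integrals of \<open>g\<close>, and the integral of the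
    \<open>p\<close>-th power of \<open>f v\<close> becomes that of \<open>g\<close>.\<close>
  define g where "g x = f x * ennreal (v x powr dual_exp p)" for x
  have [measurable]: "g \<in> borel_measurable M" unfolding g_def[abs_def] by measurable
  have sg: "ennreal (v x powr (- dual_exp p)) * g x = f x" for x
  proof -
    have "ennreal (v x powr (- dual_exp p)) * ennreal (v x powr dual_exp p) = 1"
      using v_pos[of x] by (simp add: powr_minus flip: ennreal_mult)
    then show ?thesis by (simp add: g_def mult.left_commute[of _ "f x"])
  qed
  have sgp: "ennreal (v x powr (- dual_exp p)) * epowr (g x) p = epowr (f x * ennreal (v x)) p" for x
  proof -
    have "- dual_exp p + dual_exp p * p = p" using p'(2) by (simp add: algebra_simps)
    then have "ennreal (v x powr (- dual_exp p)) * ennreal (v x powr (dual_exp p * p)) = ennreal (v x powr p)"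
      using v_pos[of x] by (simp flip: ennreal_mult powr_add)
    then show ?thesis
      using v_pos[of x] by (simp add: g_def epowr_mult epowr_ennreal powr_powr mult.left_commute[of _ "epowr (f x) p"])
  qed
  have gG: "(\<integral>\<^sup>+x. epowr (g x) p \<partial>\<mu>\<^sub>s) = ennreal G"
    unfolding real(2)[symmetric] \<mu>\<^sub>s_def by (subst nn_integral_density) (auto simp: sgp)
  have fL: "(\<integral>\<^sup>+x\<in>X. g x \<partial>\<mu>\<^sub>s) = (\<integral>\<^sup>+x\<in>X. f x \<partial>M)" if [measurable]: "X \<in> sets M" for X
    unfolding \<mu>\<^sub>s_def by (subst nn_integral_density) (auto simp: sg mult.assoc[symmetric])
  have summand: "emeasure \<mu>\<^sub>u (E i) * epowr (ennreal (l i powr (\<alpha> - 1)) * (\<integral>\<^sup>+x\<in>L i. f x \<partial>M)) q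
     \<le> ennreal (G powr ((q - p) / p)) * (b i * epowr ((\<integral>\<^sup>+x\<in>L i. g x \<partial>\<mu>\<^sub>s) / emeasure \<mu>\<^sub>s (L i)) p)"
    if i: "i \<in> F" for i
  proof -
    from us_finite[OF i] obtain U S where US: "emeasure \<mu>\<^sub>u (R i) = ennreal U" "emeasure \<mu>\<^sub>s (L i) = ennreal S" "0 < U" "0 < S"
      "U * S powr \<rho> \<le> a * l i powr (1 + \<rho>)" .
    note [measurable] = L_meas[OF i]
    have l: "0 < l i" using l_pos i by simp
    have "epowr (\<integral>\<^sup>+x\<in>L i. g x \<partial>\<mu>\<^sub>s) p = epowr (\<integral>\<^sup>+x. g x \<partial>restrict_space \<mu>\<^sub>s (L i)) p"
      using sets_us by (subst nn_integral_restrict_space) auto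
    also have "\<dots> \<le> epowr (emeasure (restrict_space \<mu>\<^sub>s (L i)) (space (restrict_space \<mu>\<^sub>s (L i)))) (p - 1)
        * (\<integral>\<^sup>+x. epowr (g x) p \<partial>restrict_space \<mu>\<^sub>s (L i))"
      using p by (intro nn_integral_power_mean) (auto intro!: measurable_restrict_space1)
    also have "emeasure (restrict_space \<mu>\<^sub>s (L i)) (space (restrict_space \<mu>\<^sub>s (L i))) = ennreal S"
      using US sets_us sets.sets_into_space[OF L_meas[OF i]] sets_eq_imp_space_eq[OF sets_us(2)]
      by (subst emeasure_restrict_space) (auto simp: space_restrict_space Int_absorb1 Int_absorb2)
    also have "(\<integral>\<^sup>+x. epowr (g x) p \<partial>restrict_space \<mu>\<^sub>s (L i)) \<le> (\<integral>\<^sup>+x. epowr (g x) p \<partial>\<mu>\<^sub>s)"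
      using sets_us by (subst nn_integral_restrict_space) (auto intro!: nn_integral_mono simp: indicator_def)
    finally have *: "epowr (\<integral>\<^sup>+x\<in>L i. g x \<partial>\<mu>\<^sub>s) p \<le> ennreal (S powr (p - 1) * G)"
      using US real by (simp add: gG epowr_ennreal mult_left_mono flip: ennreal_mult)
    have "(\<integral>\<^sup>+x\<in>L i. g x \<partial>\<mu>\<^sub>s) \<noteq> top"
      using * by (metis ennreal_less_top epowr_eq_top_iff leD top_greatest less_top order_le_less_trans)
    then obtain I where I: "(\<integral>\<^sup>+x\<in>L i. g x \<partial>\<mu>\<^sub>s) = ennreal I" "0 \<le> I"
      by (metis ennreal_cases)
    have Ip: "I powr p \<le> S powr (p - 1) * G"
      using * I real by (simp add: epowr_ennreal)
    have "I powr q = I powr p * (I powr p) powr ((q - p) / p)"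
      using p by (simp add: powr_powr flip: powr_add)
    also have "\<dots> \<le> I powr p * (S powr (p - 1) * G) powr ((q - p) / p)"
      using Ip p p_less_q by (intro mult_left_mono powr_mono2) auto
    also have "\<dots> = G powr ((q - p) / p) * (S powr ((p - 1) * ((q - p) / p)) * I powr p)"
      using US real by (simp add: powr_mult powr_powr mult_ac)
    \<comment> \<open>Together with the \<open>p\<close> powers of \<open>S\<close> that turn
      \<open>I\<close> into an average, the exponents of \<open>S\<close> add up to
      \<open>1 + \<rho>\<close>, as in \<open>b\<close>.\<close>
    also have "(p - 1) * ((q - p) / p) = (1 + \<rho>) - p"
      using p by (simp add: \<rho>_eq field_simps)
    also have "S powr ((1 + \<rho>) - p) * I powr p = S powr (1 + \<rho>) * (I / S) powr p"
      using US I by (simp add: powr_diff powr_divide)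
    finally have Iq: "I powr q \<le> G powr ((q - p) / p) * (S powr (1 + \<rho>) * (I / S) powr p)" .
    have "(\<alpha> - 1) * q = - (1 + \<rho>)" using one_plus_\<rho> by (simp add: algebra_simps)
    then have "(l i powr (\<alpha> - 1) * I) powr q = l i powr (- (1 + \<rho>)) * I powr q"
      using I l by (simp add: powr_mult powr_powr)
    also have "\<dots> \<le> l i powr (- (1 + \<rho>)) * (G powr ((q - p) / p) * (S powr (1 + \<rho>) * (I / S) powr p))"
      using Iq by (intro mult_left_mono) auto
    also have "\<dots> = G powr ((q - p) / p) * ((S / l i) powr (1 + \<rho>) * (I / S) powr p)"
      using US l unfolding powr_minus by (simp add: powr_divide field_simps)
    finally have "emeasure \<mu>\<^sub>u (E i) * ennreal ((l i powr (\<alpha> - 1) * I) powr q)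
        \<le> emeasure \<mu>\<^sub>u (E i) * ennreal (G powr ((q - p) / p) * ((S / l i) powr (1 + \<rho>) * (I / S) powr p))"
      by (intro mult_left_mono ennreal_leI) auto
    then have "emeasure \<mu>\<^sub>u (E i) * ennreal ((l i powr (\<alpha> - 1) * I) powr q)
        \<le> ennreal (G powr ((q - p) / p)) * (emeasure \<mu>\<^sub>u (E i) * ennreal ((S / l i) powr (1 + \<rho>)) * ennreal ((I / S) powr p))"
      by (simp add: ennreal_mult mult_ac)
    moreover have "epowr (ennreal (l i powr (\<alpha> - 1)) * ennreal I) q = ennreal ((l i powr (\<alpha> - 1) * I) powr q)"
      using I by (simp add: epowr_ennreal flip: ennreal_mult)
    ultimately show ?thesis
      using I US fL[OF L_meas[OF i]] l
      by (simp add: b_def divide_ennreal epowr_ennreal)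
  qed
  have "(\<Sum>i\<in>F. emeasure \<mu>\<^sub>u (E i) * epowr (ennreal (l i powr (\<alpha> - 1)) * (\<integral>\<^sup>+x\<in>L i. f x \<partial>M)) q)
     \<le> ennreal (G powr ((q - p) / p)) * (\<Sum>i\<in>F. b i * epowr ((\<integral>\<^sup>+x\<in>L i. g x \<partial>\<mu>\<^sub>s) / emeasure \<mu>\<^sub>s (L i)) p)"
    unfolding sum_distrib_left by (intro sum_mono summand)
  also have "\<dots> \<le> ennreal (G powr ((q - p) / p)) * (ennreal (2 powr p * dual_exp p) * ennreal (a powr \<tau> * (1 + 2 powr \<tau> * dual_exp \<tau>)) * (\<integral>\<^sup>+x. epowr (g x) p \<partial>\<mu>\<^sub>s))"
  proof (intro mult_left_mono carleson_embedding[OF p(1) sigma_finite_us(2) fin lamL _ _ _ _ carleson_b])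
    fix i assume i: "i \<in> F"
    show "L i \<in> sets \<mu>\<^sub>s" using i L_meas sets_us by auto
    show "0 < emeasure \<mu>\<^sub>s (L i)" "emeasure \<mu>\<^sub>s (L i) < top"
      using us_finite[OF i] by (metis ennreal_less_zero_iff, metis ennreal_less_top)
  qed (auto)
  also have "\<dots> = ennreal (C_test * a powr \<tau>) * ennreal (G powr ((q - p) / p) * G)"
  proof -
    have "0 \<le> dual_exp \<tau>" using \<tau>_gt_1 by (simp add: dual_exp_def)
    then show ?thesis
      using p' real by (simp add: gG C_test_def mult_ac flip: ennreal_mult)
  qed
  also have "G powr ((q - p) / p) * G = G powr (q / p)"
    using p real by (cases "G = 0") (auto simp: diff_divide_distrib powr_diff)
  finally show ?thesis using real by (simp add: epowr_ennreal)
qed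

end

subsection \<open>Dyadic grids\<close>

text \<open>Makes a finite supremum disjoint: each point is assigned to an index of largest value
  among the sets containing it. An added set takes over the unowned points and those whose owner has
  a strictly smaller value; ties stay with the old owner.\<close>

lemma disjoint_linearization:
  fixes c :: "'i \<Rightarrow> 'b :: linorder"
  assumes "finite F" "\<And>i. i \<in> F \<Longrightarrow> K i \<in> sets M"
  shows "\<exists>E. (\<forall>i\<in>F. E i \<in> sets M \<and> E i \<subseteq> K i) \<and> disjoint_family_on E F \<and>
    (\<forall>i\<in>F. \<forall>x\<in>K i. \<exists>j\<in>F. x \<in> E j \<and> c i \<le> c j)"
  using assms
proof (induction F rule: finite_induct)
  case empty
  then show ?case by (auto simp: disjoint_family_on_def)
next
  case (insert n F)
  then obtain E where E: "\<And>i. i \<in> F \<Longrightarrow> E i \<in> sets M" "\<And>i. i \<in> F \<Longrightarrow> E i \<subseteq> K i" "disjoint_family_on E F"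
    "\<And>i x. i \<in> F \<Longrightarrow> x \<in> K i \<Longrightarrow> \<exists>j\<in>F. x \<in> E j \<and> c i \<le> c j"
    by (metis insertCI)
  define E' where "E' i = (if i = n then K n - (\<Union>k\<in>{k\<in>F. c n \<le> c k}. E k) else
    E i - (K n - (\<Union>k\<in>{k\<in>F. c n \<le> c k}. E k)))" for i
  have U: "(\<Union>k\<in>{k\<in>F. c n \<le> c k}. E k) \<in> sets M"
    using insert.hyps E by (intro sets.finite_UN) auto
  have "E' i \<in> sets M" "E' i \<subseteq> K i" if "i \<in> insert n F" for i
    using that insert.prems E U by (auto simp: E'_def)
  moreover have "disjoint_family_on E' (insert n F)"
    using E(3) insert.hyps(2) unfolding disjoint_family_on_def E'_def by auto
  moreover have "\<exists>j\<in>insert n F. x \<in> E' j \<and> c i \<le> c j" if i: "i \<in> insert n F" "x \<in> K i" for i x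
  proof (cases "x \<in> E' n")
    case True
    then have lt: "\<And>k. k \<in> F \<Longrightarrow> x \<in> E k \<Longrightarrow> c k < c n"
      unfolding E'_def by (auto simp: not_le[symmetric])
    have "c i \<le> c n"
    proof (cases "i = n")
      case False
      then obtain k where "k \<in> F" "x \<in> E k" "c i \<le> c k" using i E(4) by blast
      then show ?thesis using lt by force
    qed simp
    then show ?thesis using True by auto
  next
    case False
    have "\<exists>k\<in>F. x \<in> E k \<and> c i \<le> c k"
    proof (cases "i = n")
      case True
      then show ?thesis using False i by (auto simp: E'_def)
    qed (use i E(4) in blast)
    then obtain k where k: "k \<in> F" "x \<in> E k" "c i \<le> c k" by blast
    moreover have "k \<noteq> n" using k insert.hyps by auto
    ultimately have "x \<in> E' k" using False by (auto simp: E'_def)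
    then show ?thesis using k by auto
  qed
  ultimately show ?case by blast
qed

text \<open>The shift \<open>\<sigma> k\<close> of the grid of scale \<open>2\<^sup>k\<close> may depend on the scale, as long as consecutive
  grids stay nested; this accommodates the one-third shifted grid on all scales at once.\<close>

definition grid_shift :: "(int \<Rightarrow> real) \<Rightarrow> bool" where
  "grid_shift \<sigma> \<longleftrightarrow> (\<forall>k. \<exists>z::int. \<sigma> (k + 1) = \<sigma> k + 2 powi k * real_of_int z)"

definition dyad :: "(int \<Rightarrow> real) \<Rightarrow> int \<Rightarrow> int \<Rightarrow> real set" where
  "dyad \<sigma> k m = {\<sigma> k + 2 powi k * real_of_int m ..< \<sigma> k + 2 powi k * (real_of_int m + 1)}"

definition left_half :: "(int \<Rightarrow> real) \<Rightarrow> int \<times> int \<Rightarrow> real set" where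
  "left_half \<sigma> = (\<lambda>(k, m). {\<sigma> k + 2 powi k * real_of_int m ..< \<sigma> k + 2 powi k * real_of_int m + 2 powi (k - 1)})"

definition right_half :: "(int \<Rightarrow> real) \<Rightarrow> int \<times> int \<Rightarrow> real set" where
  "right_half \<sigma> = (\<lambda>(k, m). {\<sigma> k + 2 powi k * real_of_int m + 2 powi (k - 1) ..< \<sigma> k + 2 powi k * (real_of_int m + 1)})"

lemma powi_pred: "(2::real) powi k = 2 * 2 powi (k - 1)"
  using power_int_add[of "2::real" 1 "k - 1"] by simp

lemma powi_pos: "0 < (2::real) powi k"
  by simp

lemma grid_shift_le:
  assumes "grid_shift \<sigma>" "k \<le> k'"
  shows "\<exists>z::int. \<sigma> k' = \<sigma> k + 2 powi k * real_of_int z"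
  using assms(2)
proof (induction k' rule: int_ge_induct)
  case base
  show ?case by (intro exI[of _ 0]) simp
next
  case (step i)
  then obtain z where z: "\<sigma> i = \<sigma> k + 2 powi k * real_of_int z" by blast
  obtain z' where z': "\<sigma> (i + 1) = \<sigma> i + 2 powi i * real_of_int z'"
    using assms(1) by (auto simp: grid_shift_def)
  have "(2::real) powi i = 2 powi k * real_of_int (2 ^ nat (i - k))"
    using step.hyps power_int_add[of "2::real" k "i - k"] by (simp add: power_int_def)
  then have "\<sigma> (i + 1) = \<sigma> k + 2 powi k * real_of_int (z + 2 ^ nat (i - k) * z')"
    using z z' by (simp add: distrib_left mult.assoc)
  then show ?case by blast
qed

text \<open>Relative to \<open>\<sigma> k\<close> and in units of \<open>2 powi k\<close>, both
  intervals have integer endpoints, so a common point forces inclusion.\<close>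

lemma dyad_nested:
  assumes "grid_shift \<sigma>" "k \<le> k'"
  shows "dyad \<sigma> k m \<subseteq> dyad \<sigma> k' m' \<or> dyad \<sigma> k m \<inter> dyad \<sigma> k' m' = {}"
proof (cases "dyad \<sigma> k m \<inter> dyad \<sigma> k' m' = {}")
  case False
  then obtain x where x: "x \<in> dyad \<sigma> k m" "x \<in> dyad \<sigma> k' m'" by blast
  obtain z where z: "\<sigma> k' = \<sigma> k + 2 powi k * real_of_int z"
    using grid_shift_le[OF assms] by blast
  define N :: int where "N = 2 ^ nat (k' - k)"
  have N: "(2::real) powi k' = 2 powi k * real_of_int N"
    using assms(2) power_int_add[of "2::real" k "k' - k"] by (simp add: power_int_def N_def)
  define c where "c = (2::real) powi k"
  have c: "0 < c" by (simp add: c_def)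
  have ends: "dyad \<sigma> k' m' = {\<sigma> k + c * real_of_int (z + N * m') ..< \<sigma> k + c * real_of_int (z + N * (m' + 1))}"
    unfolding dyad_def z N c_def[symmetric] by (simp add: algebra_simps)
  have "c * real_of_int (z + N * m') < c * real_of_int (m + 1)" "c * real_of_int m < c * real_of_int (z + N * (m' + 1))"
    using x unfolding ends unfolding dyad_def c_def[symmetric] by auto
  then have "z + N * m' \<le> m" "m + 1 \<le> z + N * (m' + 1)"
    using c by (simp_all only: mult_less_cancel_left_pos of_int_less_iff)
  then have "c * real_of_int (z + N * m') \<le> c * real_of_int m" "c * real_of_int (m + 1) \<le> c * real_of_int (z + N * (m' + 1))"
    using c by (simp_all only: mult_le_cancel_left_pos of_int_le_iff)
  then have "dyad \<sigma> k m \<subseteq> dyad \<sigma> k' m'"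
    unfolding ends unfolding dyad_def c_def[symmetric] by auto
  then show ?thesis by blast
qed simp

text \<open>The halves are intervals of the next finer grid, which makes both families of halves
  laminar.\<close>

lemma half_dyads:
  assumes "grid_shift \<sigma>"
  obtains z where "left_half \<sigma> (k, m) = dyad \<sigma> (k - 1) z" "right_half \<sigma> (k, m) = dyad \<sigma> (k - 1) (z + 1)"
proof -
  obtain z where z: "\<sigma> k = \<sigma> (k - 1) + 2 powi (k - 1) * real_of_int z"
    using assms by (metis diff_add_cancel grid_shift_def)
  show ?thesis
    by (rule that[of "z + 2 * m"])
       (simp_all add: left_half_def right_half_def dyad_def z powi_pred[of k] algebra_simps)
qed

lemma left_half_subset_dyad: "left_half \<sigma> (k, m) \<subseteq> dyad \<sigma> k m"
  and right_half_subset_dyad: "right_half \<sigma> (k, m) \<subseteq> dyad \<sigma> k m"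
  by (auto simp: left_half_def right_half_def dyad_def powi_pred[of k] algebra_simps intro: order_trans add_increasing2)

lemma left_half_nonempty: "left_half \<sigma> i \<noteq> {}"
  by (auto simp: left_half_def split: prod.splits)

lemma laminar_halves:
  assumes "grid_shift \<sigma>"
  shows "laminar_on (left_half \<sigma>) F" "laminar_on (right_half \<sigma>) F"
proof -
  have *: "dyad \<sigma> k m \<subseteq> dyad \<sigma> k' m' \<or> dyad \<sigma> k' m' \<subseteq> dyad \<sigma> k m \<or> dyad \<sigma> k m \<inter> dyad \<sigma> k' m' = {}" for k m k' m'
    using dyad_nested[OF assms, of k k' m m'] dyad_nested[OF assms, of k' k m' m] by (cases "k \<le> k'") auto
  show "laminar_on (left_half \<sigma>) F" "laminar_on (right_half \<sigma>) F"
    unfolding laminar_on_def by (metis half_dyads[OF assms] * surj_pair)+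
qed

text \<open>This is the condition \<open>cross\<close>. Inclusion with distinct indices forces a
  strictly smaller scale; then the whole interval of \<open>i\<close> has scale at most that of
  \<open>left_half \<sigma> j\<close>, meets it, and is nested in it.\<close>

lemma right_half_in_left_half:
  assumes "grid_shift \<sigma>" "i \<noteq> j" "left_half \<sigma> i \<subseteq> left_half \<sigma> j"
  shows "right_half \<sigma> i \<subseteq> left_half \<sigma> j"
proof -
  obtain k m k' m' where ij: "i = (k, m)" "j = (k', m')" by fastforce
  have le: "\<sigma> k' + 2 powi k' * real_of_int m' \<le> \<sigma> k + 2 powi k * real_of_int m"
    "\<sigma> k + 2 powi k * real_of_int m + 2 powi (k - 1) \<le> \<sigma> k' + 2 powi k' * real_of_int m' + 2 powi (k' - 1)"
  proof -
    have *: "Y \<le> X \<and> X + c \<le> Y + d" if "{X..<X + c} \<subseteq> {Y..<Y + d}" "0 < c" for X Y c d :: real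
      using that by auto
    show "\<sigma> k' + 2 powi k' * real_of_int m' \<le> \<sigma> k + 2 powi k * real_of_int m"
      "\<sigma> k + 2 powi k * real_of_int m + 2 powi (k - 1) \<le> \<sigma> k' + 2 powi k' * real_of_int m' + 2 powi (k' - 1)"
      using * assms(3) powi_pos[of "k - 1"] unfolding ij left_half_def prod.case by blast+
  qed
  then have "(2::real) powi (k - 1) \<le> 2 powi (k' - 1)" by simp
  then have "k \<le> k'"
    using power_int_strict_increasing[of "k' - 1" "k - 1" "2::real"] by force
  moreover have "k \<noteq> k'"
  proof
    assume "k = k'"
    then have "m = m'" using le by simp
    then show False using \<open>k = k'\<close> assms(2) ij by simp
  qed
  ultimately have "k \<le> k' - 1" by simp
  obtain z where z: "left_half \<sigma> j = dyad \<sigma> (k' - 1) z"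
    using half_dyads[OF assms(1)] ij by metis
  have "dyad \<sigma> k m \<inter> left_half \<sigma> j \<noteq> {}"
    using left_half_nonempty[of \<sigma> i] left_half_subset_dyad[of \<sigma> k m] assms(3) ij by blast
  then have "dyad \<sigma> k m \<subseteq> left_half \<sigma> j"
    using dyad_nested[OF assms(1) \<open>k \<le> k' - 1\<close>] z by auto
  then show ?thesis using right_half_subset_dyad[of \<sigma> k m] ij by auto
qed

section \<open>Dyadic one-sided maximal operators\<close>

context frac_exponents
begin

text \<open>The characteristic with its averages cleared of lengths; the exponent
  \<open>1 + \<rho>\<close> counts one length for \<open>u\<close> and \<rho> for
  \<open>s\<close>.\<close>

definition one_sided_cond :: "real \<Rightarrow> (real \<Rightarrow> real) \<Rightarrow> bool" where
  "one_sided_cond a v \<longleftrightarrow> (\<forall>x. \<forall>h>0.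
     (\<integral>\<^sup>+t\<in>{x..x + h}. ennreal (v t powr q) \<partial>lborel)
       * epowr (\<integral>\<^sup>+t\<in>{x - h..x}. ennreal (v t powr (- dual_exp p)) \<partial>lborel) \<rho>
     \<le> ennreal (a * h powr (1 + \<rho>)))"

text \<open>Normalised by the length of the half, which is the \<open>l i\<close> of
  \<open>testing_family\<close>.\<close>

definition dyadic_term :: "(int \<Rightarrow> real) \<Rightarrow> (real \<Rightarrow> ennreal) \<Rightarrow> int \<times> int \<Rightarrow> ennreal" where
  "dyadic_term \<sigma> f i = ennreal ((2 powi (fst i - 1)) powr (\<alpha> - 1)) * (\<integral>\<^sup>+y\<in>left_half \<sigma> i. f y \<partial>lborel)"

definition dyadic_max :: "(int \<Rightarrow> real) \<Rightarrow> (real \<Rightarrow> ennreal) \<Rightarrow> real \<Rightarrow> ennreal" where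
  "dyadic_max \<sigma> f x = (SUP i. dyadic_term \<sigma> f i * indicator (right_half \<sigma> i) x)"

lemma half_measurable [measurable]: "left_half \<sigma> i \<in> sets borel" "right_half \<sigma> i \<in> sets borel"
  by (auto simp: left_half_def right_half_def split: prod.splits)

lemma dyadic_max_measurable [measurable]: "dyadic_max \<sigma> f \<in> borel_measurable borel"
  unfolding dyadic_max_def[abs_def] by measurable

lemma dyadic_max_finite_bound:
  assumes "grid_shift \<sigma>" and [measurable]: "v \<in> borel_measurable borel" "f \<in> borel_measurable borel"
    and "\<And>x. 0 < v x" "1 \<le> a" and A: "one_sided_cond a v" and "finite F"
  shows "(\<integral>\<^sup>+x. ennreal (v x powr q) * epowr (SUP i\<in>F. dyadic_term \<sigma> f i * indicator (right_half \<sigma> i) x) q \<partial>lborel)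
    \<le> ennreal (C_test * a powr \<tau>) * epowr (\<integral>\<^sup>+x. epowr (f x * ennreal (v x)) p \<partial>lborel) (q / p)"
proof -
  obtain E where E: "\<And>i. i \<in> F \<Longrightarrow> E i \<in> sets lborel" "\<And>i. i \<in> F \<Longrightarrow> E i \<subseteq> right_half \<sigma> i" "disjoint_family_on E F"
    "\<And>i x. i \<in> F \<Longrightarrow> x \<in> right_half \<sigma> i \<Longrightarrow> \<exists>j\<in>F. x \<in> E j \<and> dyadic_term \<sigma> f i \<le> dyadic_term \<sigma> f j"
  proof -
    have "\<exists>E. (\<forall>i\<in>F. E i \<in> sets lborel \<and> E i \<subseteq> right_half \<sigma> i) \<and> disjoint_family_on E F \<and>
        (\<forall>i\<in>F. \<forall>x\<in>right_half \<sigma> i. \<exists>j\<in>F. x \<in> E j \<and> dyadic_term \<sigma> f i \<le> dyadic_term \<sigma> f j)"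
      by (rule disjoint_linearization[OF \<open>finite F\<close>]) simp
    then show ?thesis using that by blast
  qed
  interpret testing_family \<alpha> p q lborel v F "left_half \<sigma>" "right_half \<sigma>" E "\<lambda>i. 2 powi (fst i - 1)" a
  proof unfold_locales
    show "laminar_on (left_half \<sigma>) F" "laminar_on (right_half \<sigma>) F"
      using laminar_halves assms(1) by auto
    show "\<And>i j. i \<in> F \<Longrightarrow> j \<in> F \<Longrightarrow> i \<noteq> j \<Longrightarrow> left_half \<sigma> i \<subseteq> left_half \<sigma> j \<Longrightarrow> right_half \<sigma> i \<subseteq> left_half \<sigma> j"
      using right_half_in_left_half assms(1) by blast
    fix i assume "i \<in> F"
    obtain k m where i: "i = (k, m)" by fastforce
    show "0 < emeasure lborel (left_half \<sigma> i)"
      by (simp add: i left_half_def)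
    show "emeasure lborel (right_half \<sigma> i) = ennreal (2 powi (fst i - 1))"
      by (simp add: i right_half_def powi_pred[of k] algebra_simps)
    define x where "x = \<sigma> k + 2 powi k * real_of_int m + 2 powi (k - 1)"
    have "left_half \<sigma> i \<subseteq> {x - 2 powi (k - 1)..x}" "right_half \<sigma> i \<subseteq> {x..x + 2 powi (k - 1)}"
      by (auto simp: i left_half_def right_half_def x_def powi_pred[of k] algebra_simps)
    then have "(\<integral>\<^sup>+x\<in>right_half \<sigma> i. ennreal (v x powr q) \<partial>lborel) * epowr (\<integral>\<^sup>+x\<in>left_half \<sigma> i. ennreal (v x powr (- dual_exp p)) \<partial>lborel) \<rho>
      \<le> (\<integral>\<^sup>+t\<in>{x..x + 2 powi (k - 1)}. ennreal (v t powr q) \<partial>lborel)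
       * epowr (\<integral>\<^sup>+t\<in>{x - 2 powi (k - 1)..x}. ennreal (v t powr (- dual_exp p)) \<partial>lborel) \<rho>"
      using \<rho>_pos by (intro mult_mono epowr_mono nn_integral_mono mult_left_mono) (auto simp: indicator_def)
    also have "\<dots> \<le> ennreal (a * (2 powi (k - 1)) powr (1 + \<rho>))"
      using A by (auto simp: one_sided_cond_def)
    finally show "(\<integral>\<^sup>+x\<in>right_half \<sigma> i. ennreal (v x powr q) \<partial>lborel) * epowr (\<integral>\<^sup>+x\<in>left_half \<sigma> i. ennreal (v x powr (- dual_exp p)) \<partial>lborel) \<rho>
      \<le> ennreal (a * (2 powi (fst i - 1)) powr (1 + \<rho>))" by (simp add: i)
  qed (use assms E in \<open>auto\<close>)
  let ?c = "dyadic_term \<sigma> f"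
  have "(\<integral>\<^sup>+x. ennreal (v x powr q) * epowr (SUP i\<in>F. ?c i * indicator (right_half \<sigma> i) x) q \<partial>lborel)
    \<le> (\<integral>\<^sup>+x. (\<Sum>i\<in>F. epowr (?c i) q * (ennreal (v x powr q) * indicator (E i) x)) \<partial>lborel)"
  proof (rule nn_integral_mono)
    fix x
    have "epowr (SUP i\<in>F. ?c i * indicator (right_half \<sigma> i) x) q = (SUP i\<in>F. epowr (?c i * indicator (right_half \<sigma> i) x) q)"
      using q_pos by (intro epowr_SUP) auto
    also have "\<dots> \<le> (\<Sum>i\<in>F. epowr (?c i) q * indicator (E i) x)"
    proof (rule SUP_least)
      fix i assume i: "i \<in> F"
      show "epowr (?c i * indicator (right_half \<sigma> i) x) q \<le> (\<Sum>i\<in>F. epowr (?c i) q * indicator (E i) x)"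
      proof (cases "x \<in> right_half \<sigma> i")
        case True
        then obtain j where j: "j \<in> F" "x \<in> E j" "?c i \<le> ?c j" using E(4) i by blast
        have "epowr (?c i) q \<le> epowr (?c j) q * indicator (E j) x"
          using j q_pos by (auto intro: epowr_mono)
        also have "\<dots> \<le> (\<Sum>i\<in>F. epowr (?c i) q * indicator (E i) x)"
          using j \<open>finite F\<close> by (intro member_le_sum) auto
        finally show ?thesis using True by simp
      qed simp
    qed
    finally have "ennreal (v x powr q) * epowr (SUP i\<in>F. ?c i * indicator (right_half \<sigma> i) x) q
        \<le> ennreal (v x powr q) * (\<Sum>i\<in>F. epowr (?c i) q * indicator (E i) x)"
      by (rule mult_left_mono) simp
    then show "ennreal (v x powr q) * epowr (SUP i\<in>F. ?c i * indicator (right_half \<sigma> i) x) q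
        \<le> (\<Sum>i\<in>F. epowr (?c i) q * (ennreal (v x powr q) * indicator (E i) x))"
      by (simp add: sum_distrib_left mult_ac)
  qed
  also have "\<dots> = (\<Sum>i\<in>F. epowr (?c i) q * emeasure \<mu>\<^sub>u (E i))"
    using E by (subst nn_integral_sum) (auto simp: nn_integral_cmult emeasure_us intro!: sum.cong)
  also have "\<dots> \<le> ennreal (C_test * a powr \<tau>) * epowr (\<integral>\<^sup>+x. epowr (f x * ennreal (v x)) p \<partial>lborel) (q / p)"
    using testing_bound[of f] by (simp add: dyadic_term_def mult.commute)
  finally show ?thesis .
qed

text \<open>The finite bound does not depend on \<open>F\<close>, so the countable index set is
  exhausted by monotone convergence.\<close>

lemma dyadic_max_bound:
  assumes "grid_shift \<sigma>" and [measurable]: "v \<in> borel_measurable borel" "f \<in> borel_measurable borel"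
    and "\<And>x. 0 < v x" "1 \<le> a" "one_sided_cond a v"
  shows "(\<integral>\<^sup>+x. ennreal (v x powr q) * epowr (dyadic_max \<sigma> f x) q \<partial>lborel)
    \<le> ennreal (C_test * a powr \<tau>) * epowr (\<integral>\<^sup>+x. epowr (f x * ennreal (v x)) p \<partial>lborel) (q / p)"
proof -
  let ?e = "from_nat :: nat \<Rightarrow> int \<times> int"
  let ?c = "\<lambda>x i. dyadic_term \<sigma> f i * indicator (right_half \<sigma> i) x"
  let ?g = "\<lambda>n x. ennreal (v x powr q) * epowr (SUP i\<in>?e ` {..n}. ?c x i) q"
  have "dyadic_max \<sigma> f x = (SUP n. SUP i\<in>?e ` {..n}. ?c x i)" for x
    unfolding dyadic_max_def
  proof (intro antisym SUP_least)
    fix i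
    have "?c x i \<le> (SUP j\<in>?e ` {..to_nat i}. ?c x j)"
      by (intro SUP_upper image_eqI[of _ _ "to_nat i"]) auto
    also have "\<dots> \<le> (SUP n. SUP i\<in>?e ` {..n}. ?c x i)" by (rule SUP_upper) simp
    finally show "?c x i \<le> (SUP n. SUP i\<in>?e ` {..n}. ?c x i)" .
  qed (auto intro: SUP_upper)
  then have "(\<integral>\<^sup>+x. ennreal (v x powr q) * epowr (dyadic_max \<sigma> f x) q \<partial>lborel) = (\<integral>\<^sup>+x. (SUP n. ?g n x) \<partial>lborel)"
    using q_pos by (simp add: epowr_SUP SUP_mult_left_ennreal)
  also have "\<dots> = (SUP n. \<integral>\<^sup>+x. ?g n x \<partial>lborel)"
  proof (rule nn_integral_monotone_convergence_SUP)
    show "incseq ?g"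
      using q_pos by (intro monoI le_funI mult_left_mono epowr_mono SUP_subset_mono image_mono) auto
  qed measurable
  also have "\<dots> \<le> ennreal (C_test * a powr \<tau>) * epowr (\<integral>\<^sup>+x. epowr (f x * ennreal (v x)) p \<partial>lborel) (q / p)"
    using assms by (intro SUP_least dyadic_max_finite_bound) auto
  finally show ?thesis .
qed

end

subsection \<open>The one-sided maximal operator on the line\<close>

text \<open>Left endpoint of the interval of scale \<open>k\<close> that contains
  \<open>x\<close>.\<close>

definition grid_left :: "(int \<Rightarrow> real) \<Rightarrow> int \<Rightarrow> real \<Rightarrow> real" where
  "grid_left \<sigma> k x = \<sigma> k + 2 powi k * of_int \<lfloor>(x - \<sigma> k) / 2 powi k\<rfloor>"

lemma grid_left_bounds: "grid_left \<sigma> k x \<le> x" "x < grid_left \<sigma> k x + 2 powi k"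
proof -
  define y where "y = (x - \<sigma> k) / 2 powi k"
  have y: "x = \<sigma> k + 2 powi k * y" by (simp add: y_def)
  have "2 powi k * of_int \<lfloor>y\<rfloor> \<le> 2 powi k * y" "2 powi k * y < 2 powi k * (of_int \<lfloor>y\<rfloor> + 1)"
    by (intro mult_left_mono mult_strict_left_mono; simp)+
  then show "grid_left \<sigma> k x \<le> x" "x < grid_left \<sigma> k x + 2 powi k"
    unfolding grid_left_def y_def[symmetric] by (subst y; simp add: algebra_simps)+
qed

lemma grid_left_eq:
  assumes "x \<in> dyad \<sigma> k m"
  shows "grid_left \<sigma> k x = \<sigma> k + 2 powi k * of_int m"
proof -
  have "\<lfloor>(x - \<sigma> k) / 2 powi k\<rfloor> = m"
    using assms by (intro floor_unique) (auto simp: dyad_def field_simps)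
  then show ?thesis by (simp add: grid_left_def)
qed

text \<open>Refining the grid by one scale leaves the left endpoint alone or moves it across
  precisely the left half of the coarse interval, so left halves tile the points before
  \<open>x\<close>.\<close>

lemma grid_left_pred:
  assumes "grid_shift \<sigma>"
  shows "grid_left \<sigma> (k - 1) x = grid_left \<sigma> k x \<or>
    (\<exists>m. left_half \<sigma> (k, m) = {grid_left \<sigma> k x..<grid_left \<sigma> (k - 1) x} \<and> x \<in> right_half \<sigma> (k, m))"
proof -
  define m where "m = \<lfloor>(x - \<sigma> k) / 2 powi k\<rfloor>"
  have gl: "grid_left \<sigma> k x = \<sigma> k + 2 powi k * of_int m" by (simp add: grid_left_def m_def)
  have x: "x \<in> dyad \<sigma> k m"
    using grid_left_bounds[where \<sigma>=\<sigma> and k=k and x=x] by (simp add: dyad_def gl algebra_simps)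
  obtain z where z: "left_half \<sigma> (k, m) = dyad \<sigma> (k - 1) z" "right_half \<sigma> (k, m) = dyad \<sigma> (k - 1) (z + 1)"
    using half_dyads[OF assms] by blast
  have halves: "x \<in> left_half \<sigma> (k, m) \<or> x \<in> right_half \<sigma> (k, m)"
    using x by (auto simp: left_half_def right_half_def dyad_def)
  have *: "\<sigma> (k - 1) + 2 powi (k - 1) * of_int z = grid_left \<sigma> k x"
  proof -
    have inj: "X = Y" if "{X..<X + c} = {Y..<Y + c}" "0 < c" for X Y c :: real
    proof -
      have "X \<in> {X..<X + c}" "Y \<in> {Y..<Y + c}" using that(2) by auto
      then have "X \<in> {Y..<Y + c}" "Y \<in> {X..<X + c}" using that(1) by auto
      then show ?thesis by auto
    qed
    have "{\<sigma> k + 2 powi k * real_of_int m ..< \<sigma> k + 2 powi k * real_of_int m + 2 powi (k - 1)}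
      = {\<sigma> (k - 1) + 2 powi (k - 1) * real_of_int z ..< \<sigma> (k - 1) + 2 powi (k - 1) * real_of_int z + 2 powi (k - 1)}"
      using z(1) by (simp add: left_half_def dyad_def distrib_left add.assoc)
    from inj[OF this] show ?thesis
      by (simp add: gl)
  qed
  from halves show ?thesis
  proof
    assume "x \<in> left_half \<sigma> (k, m)"
    then show ?thesis using grid_left_eq[of x \<sigma> "k - 1" z] z * by simp
  next
    assume r: "x \<in> right_half \<sigma> (k, m)"
    then have "grid_left \<sigma> (k - 1) x = \<sigma> (k - 1) + 2 powi (k - 1) * (of_int z + 1)"
      using grid_left_eq[of x \<sigma> "k - 1" "z + 1"] z by simp
    then have "left_half \<sigma> (k, m) = {grid_left \<sigma> k x..<grid_left \<sigma> (k - 1) x}"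
      unfolding z(1) dyad_def * by simp
    then show ?thesis using r by blast
  qed
qed

lemma grid_shift_zero: "grid_shift (\<lambda>_. 0)"
  by (auto simp: grid_shift_def intro: exI[of _ 0])

text \<open>The shifts at scales \<open>k + 1\<close> and \<open>k\<close> differ by
  \<open>(-2) powi k\<close> up to sign, a multiple of \<open>2 powi k\<close>. The alternating sign
  keeps every scale a third of its length away from the standard grid.\<close>

lemma grid_shift_third: "grid_shift (\<lambda>k. (- 2) powi k / 3)"
  unfolding grid_shift_def
proof
  fix k :: int
  have "(- 2 :: real) powi (k + 1) = (- 2) * (- 2) powi k"
    by (simp add: power_int_add)
  moreover have "(- 2 :: real) powi k = 2 powi k \<or> (- 2 :: real) powi k = - (2 powi k)"
    using power_int_minus_left[of "2::real" k] by (cases "even k") auto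
  ultimately show "\<exists>z::int. (- 2 :: real) powi (k + 1) / 3 = (- 2) powi k / 3 + 2 powi k * real_of_int z"
    by (elim disjE) (auto intro: exI[of _ "-1"] exI[of _ 1])
qed

text \<open>If \<open>x\<close> is within \<open>2 powi k\<close> of its left endpoint in the
  standard grid, the shifted endpoints are a third of \<open>2 powi (k + 2)\<close> or more away
  from the standard one. That third exceeds \<open>2 powi k\<close>, which would fail at scale
  \<open>k + 1\<close>.\<close>

lemma one_third_trick:
  fixes x :: real
  shows "\<exists>\<sigma>\<in>{\<lambda>_. 0, \<lambda>k. (- 2) powi k / 3}. grid_left \<sigma> (k + 2) x \<le> x - 2 powi k"
proof (cases "grid_left (\<lambda>_. 0) (k + 2) x \<le> x - 2 powi k")
  case False
  define c where "c = (2::real) powi k"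
  have c: "(2::real) powi (k + 2) = 4 * c" "0 < c"
    by (auto simp: c_def power_int_add)
  define m where "m = \<lfloor>x / 2 powi (k + 2)\<rfloor>"
  have gl: "grid_left (\<lambda>_. 0) (k + 2) x = 4 * c * of_int m"
    by (simp add: grid_left_def m_def c(1))
  have m: "x < 4 * c * of_int m + c" "4 * c * of_int m \<le> x"
    using False grid_left_bounds(1)[of "\<lambda>_. 0" "k + 2" x] unfolding gl c_def[symmetric] by auto
  have "(- 2 :: real) powi (k + 2) = 4 * c \<or> (- 2 :: real) powi (k + 2) = - 4 * c"
    using power_int_minus_left[of "2::real" "k + 2"] c by auto
  then have "grid_left (\<lambda>k. (- 2) powi k / 3) (k + 2) x \<le> x - c"
  proof
    assume s: "(- 2 :: real) powi (k + 2) = 4 * c"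
    \<comment> \<open>The shifted interval with index \<open>m\<close> starts at
      \<open>4 * c * m + 4 * c / 3\<close>, beyond \<open>x\<close>, so \<open>x\<close> lies in its
      predecessor.\<close>
    have "x \<in> dyad (\<lambda>k. (- 2) powi k / 3) (k + 2) (m - 1)"
      using m c(2) unfolding dyad_def s c by (simp add: algebra_simps)
    then have "grid_left (\<lambda>k. (- 2) powi k / 3) (k + 2) x = 4 * c / 3 + 4 * c * of_int (m - 1)"
      by (subst grid_left_eq) (auto simp: s c)
    then show ?thesis using m c(2) by (simp add: algebra_simps)
  next
    assume s: "(- 2 :: real) powi (k + 2) = - 4 * c"
    have "x \<in> dyad (\<lambda>k. (- 2) powi k / 3) (k + 2) m"
      using m c(2) unfolding dyad_def s c by (simp add: algebra_simps)
    then have "grid_left (\<lambda>k. (- 2) powi k / 3) (k + 2) x = - 4 * c / 3 + 4 * c * of_int m"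
      by (subst grid_left_eq) (auto simp: s c)
    then show ?thesis using m c(2) by (simp add: algebra_simps)
  qed
  then show ?thesis by (auto simp: c_def)
qed simp

lemma powi_powr: "((2::real) powi k) powr x = 2 powr (of_int k * x)"
proof -
  have "(2::real) powi k = 2 powr of_int k" by (simp add: powr_real_of_int')
  then show ?thesis by (simp add: powr_powr)
qed

section \<open>From dyadic operators to the operator on the line\<close>

context frac_exponents
begin

text \<open>Only the lengths \<open>2 powi k\<close> occur, which keeps the supremum countable;
  \<open>strong_frac_max_le_prod_max\<close> pays for the other lengths.\<close>

definition line_max :: "(real \<Rightarrow> ennreal) \<Rightarrow> real \<Rightarrow> ennreal" where
  "line_max f x = (SUP k::int. ennreal ((2 powi k) powr (\<alpha> - 1)) * (\<integral>\<^sup>+y\<in>{x - 2 powi k..x}. f y \<partial>lborel))"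

definition "\<theta> = 2 powr (\<alpha> - 1)"

lemma \<theta>: "0 < \<theta>" "\<theta> < 1"
  using \<alpha> powr_less_mono[of "\<alpha> - 1" 0 2] by (auto simp: \<theta>_def)

text \<open>The points to the left of \<open>x\<close> in a dyadic interval are covered by the left halves of the smaller
  dyadic intervals that have \<open>x\<close> in their right half; the resulting sum is geometric.\<close>

lemma integral_le_dyadic_max:
  assumes "grid_shift \<sigma>" and [measurable]: "f \<in> borel_measurable borel"
  shows "(\<integral>\<^sup>+y\<in>{grid_left \<sigma> K x..x}. f y \<partial>lborel)
    \<le> ennreal (\<theta> / (1 - \<theta>) * (2 powi K) powr (1 - \<alpha>)) * dyadic_max \<sigma> f x"
proof -
  let ?l = "\<lambda>j::nat. grid_left \<sigma> (K - int j) x"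
  \<comment> \<open>The gap between consecutive left endpoints: empty or a left half, by
    \<open>grid_left_pred\<close>.\<close>
  define A where "A j = {?l j..<?l (Suc j)}" for j
  have Suc: "K - int (Suc j) = K - int j - 1" for j by simp
  have piece: "(\<integral>\<^sup>+y\<in>A j. f y \<partial>lborel) \<le> ennreal (\<theta> ^ Suc j * (2 powi K) powr (1 - \<alpha>)) * dyadic_max \<sigma> f x" for j
  proof (cases "?l (Suc j) = ?l j")
    case True
    then show ?thesis by (simp add: A_def)
  next
    case False
    then obtain m where m: "left_half \<sigma> (K - int j, m) = A j" "x \<in> right_half \<sigma> (K - int j, m)"
      using grid_left_pred[OF assms(1), of "K - int j" x] unfolding A_def Suc by auto
    define d where "d = ((2::real) powi (K - int (Suc j))) powr (1 - \<alpha>)"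
    have d: "d = \<theta> ^ Suc j * (2 powi K) powr (1 - \<alpha>)"
      unfolding d_def \<theta>_def powi_powr
      by (simp add: powr_realpow[symmetric] powr_powr powr_add[symmetric] algebra_simps del: power_Suc)
    have dm: "ennreal d * ennreal ((2 powi (K - int (Suc j))) powr (\<alpha> - 1)) = 1"
      unfolding d_def by (simp add: powr_add[symmetric] flip: ennreal_mult)
    have "dyadic_term \<sigma> f (K - int j, m) * indicator (right_half \<sigma> (K - int j, m)) x \<le> dyadic_max \<sigma> f x"
      unfolding dyadic_max_def by (rule SUP_upper) simp
    then have "ennreal ((2 powi (K - int (Suc j))) powr (\<alpha> - 1)) * (\<integral>\<^sup>+y\<in>A j. f y \<partial>lborel) \<le> dyadic_max \<sigma> f x"
      using m(2) by (simp add: dyadic_term_def m(1) Suc del: of_nat_Suc)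
    then have "ennreal d * (ennreal ((2 powi (K - int (Suc j))) powr (\<alpha> - 1)) * (\<integral>\<^sup>+y\<in>A j. f y \<partial>lborel)) \<le> ennreal d * dyadic_max \<sigma> f x"
      by (rule mult_left_mono) simp
    then have "ennreal d * ennreal ((2 powi (K - int (Suc j))) powr (\<alpha> - 1)) * (\<integral>\<^sup>+y\<in>A j. f y \<partial>lborel) \<le> ennreal d * dyadic_max \<sigma> f x"
      by (simp only: mult.assoc)
    then show ?thesis unfolding dm unfolding mult_1 unfolding d .
  qed
  have cover: "{grid_left \<sigma> K x..<x} \<subseteq> (\<Union>j. A j)"
  proof
    fix y assume y: "y \<in> {grid_left \<sigma> K x..<x}"
    obtain n where n: "2 powi K / (x - y) < 2 ^ n"
      using real_arch_pow[of 2 "2 powi K / (x - y)"] by auto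
    have "(2::real) powi (K - int n) = 2 powi K / 2 ^ n"
      by (simp add: power_int_diff)
    also have "\<dots> < x - y" using n y by (simp add: field_simps)
    finally have ex: "y < ?l n" using grid_left_bounds(2)[of x \<sigma> "K - int n"] by simp
    \<comment> \<open>The first scale whose endpoint has passed \<open>y\<close>; it is not 0
      because \<open>y\<close> is not to the left of the endpoint of scale \<open>K\<close>.\<close>
    define j where "j = (LEAST j. y < ?l j)"
    have j: "y < ?l j" "\<And>i. i < j \<Longrightarrow> \<not> y < ?l i"
      unfolding j_def using ex by (rule LeastI) (rule not_less_Least)
    then have "j \<noteq> 0" using y by (intro notI) simp
    then obtain i where "j = Suc i" by (cases j) auto
    then have "y \<in> A i" using j(1) j(2)[of i] by (simp add: A_def not_less)
    then show "y \<in> (\<Union>j. A j)" by blast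
  qed
  have "(\<integral>\<^sup>+y\<in>{grid_left \<sigma> K x..x}. f y \<partial>lborel) = (\<integral>\<^sup>+y\<in>{grid_left \<sigma> K x..<x}. f y \<partial>lborel)"
    by (rule nn_integral_cong_AE, use AE_lborel_singleton[of x] in eventually_elim) (auto simp: indicator_def)
  also have "\<dots> \<le> (\<integral>\<^sup>+y. (\<Sum>j. f y * indicator (A j) y) \<partial>lborel)"
  proof (rule nn_integral_mono)
    fix y
    show "f y * indicator {grid_left \<sigma> K x..<x} y \<le> (\<Sum>j. f y * indicator (A j) y)"
    proof (cases "y \<in> {grid_left \<sigma> K x..<x}")
      case True
      then obtain j where "y \<in> A j" using cover by blast
      then have "f y * indicator {grid_left \<sigma> K x..<x} y \<le> (\<Sum>i\<in>{j}. f y * indicator (A i) y)"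
        using True by simp
      also have "\<dots> \<le> (\<Sum>j. f y * indicator (A j) y)" by (intro sum_le_suminf) auto
      finally show ?thesis .
    qed simp
  qed
  also have "\<dots> = (\<Sum>j. \<integral>\<^sup>+y\<in>A j. f y \<partial>lborel)"
    by (rule nn_integral_suminf) (simp add: A_def)
  also have "\<dots> \<le> (\<Sum>j. ennreal (\<theta> ^ Suc j * (2 powi K) powr (1 - \<alpha>)) * dyadic_max \<sigma> f x)"
    by (intro suminf_le piece) auto
  also have "\<dots> = (\<Sum>j. ennreal (\<theta> ^ Suc j * (2 powi K) powr (1 - \<alpha>))) * dyadic_max \<sigma> f x"
    by simp
  also have "(\<Sum>j. ennreal (\<theta> ^ Suc j * (2 powi K) powr (1 - \<alpha>))) = ennreal (\<theta> / (1 - \<theta>) * (2 powi K) powr (1 - \<alpha>))"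
  proof -
    have "(\<lambda>j. \<theta> * \<theta> ^ j * (2 powi K) powr (1 - \<alpha>)) sums (\<theta> * (1 / (1 - \<theta>)) * (2 powi K) powr (1 - \<alpha>))"
      using \<theta> by (intro sums_mult sums_mult2 geometric_sums) auto
    then show ?thesis using \<theta> by (intro suminf_ennreal_eq) auto
  qed
  finally show ?thesis .
qed

text \<open>The factor \<open>4 powr (1 - \<alpha>)\<close> compares the lengths
  \<open>2 powi (k + 2)\<close> and \<open>2 powi k\<close> of the one-third trick.\<close>

definition C_dyadic :: real where
  "C_dyadic = \<theta> / (1 - \<theta>) * 4 powr (1 - \<alpha>)"

lemma C_dyadic_pos: "0 < C_dyadic"
  using \<theta> by (simp add: C_dyadic_def)

lemma line_max_le_dyadic_max:
  assumes [measurable]: "f \<in> borel_measurable borel"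
  shows "line_max f x \<le> ennreal C_dyadic * (dyadic_max (\<lambda>_. 0) f x + dyadic_max (\<lambda>k. (- 2) powi k / 3) f x)"
  unfolding line_max_def
proof (rule SUP_least)
  fix k :: int
  obtain \<sigma> where \<sigma>: "\<sigma> \<in> {\<lambda>_. 0, \<lambda>k. (- 2) powi k / 3}" "grid_left \<sigma> (k + 2) x \<le> x - 2 powi k"
    using one_third_trick by blast
  have "grid_shift \<sigma>" using \<sigma>(1) grid_shift_zero grid_shift_third by auto
  have "(\<integral>\<^sup>+y\<in>{x - 2 powi k..x}. f y \<partial>lborel) \<le> (\<integral>\<^sup>+y\<in>{grid_left \<sigma> (k + 2) x..x}. f y \<partial>lborel)"
    using \<sigma>(2) by (intro nn_integral_mono) (auto simp: indicator_def)
  also have "\<dots> \<le> ennreal (\<theta> / (1 - \<theta>) * (2 powi (k + 2)) powr (1 - \<alpha>)) * dyadic_max \<sigma> f x"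
    using \<open>grid_shift \<sigma>\<close> by (intro integral_le_dyadic_max) auto
  finally have "ennreal ((2 powi k) powr (\<alpha> - 1)) * (\<integral>\<^sup>+y\<in>{x - 2 powi k..x}. f y \<partial>lborel)
      \<le> ennreal ((2 powi k) powr (\<alpha> - 1)) * (ennreal (\<theta> / (1 - \<theta>) * (2 powi (k + 2)) powr (1 - \<alpha>)) * dyadic_max \<sigma> f x)"
    by (rule mult_left_mono) simp
  also have "\<dots> = ennreal ((2 powi k) powr (\<alpha> - 1) * (\<theta> / (1 - \<theta>) * (2 powi (k + 2)) powr (1 - \<alpha>))) * dyadic_max \<sigma> f x"
    using \<theta> by (subst ennreal_mult) (auto simp: mult.assoc)
  also have "(2 powi k) powr (\<alpha> - 1) * (\<theta> / (1 - \<theta>) * (2 powi (k + 2)) powr (1 - \<alpha>)) = C_dyadic"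
  proof -
    have "((2::real) powi (k + 2)) powr (1 - \<alpha>) = (2 powi k) powr (1 - \<alpha>) * 4 powr (1 - \<alpha>)"
      by (simp add: power_int_add powr_mult)
    moreover have "((2::real) powi k) powr (\<alpha> - 1) * (2 powi k) powr (1 - \<alpha>) = 1"
      by (simp add: powr_add[symmetric])
    ultimately show ?thesis by (simp add: C_dyadic_def algebra_simps)
  qed
  also have "dyadic_max \<sigma> f x \<le> dyadic_max (\<lambda>_. 0) f x + dyadic_max (\<lambda>k. (- 2) powi k / 3) f x"
    using \<sigma>(1) by (auto simp: add_increasing add_increasing2)
  finally show "ennreal ((2 powi k) powr (\<alpha> - 1)) * (\<integral>\<^sup>+y\<in>{x - 2 powi k..x}. f y \<partial>lborel)
    \<le> ennreal C_dyadic * (dyadic_max (\<lambda>_. 0) f x + dyadic_max (\<lambda>k. (- 2) powi k / 3) f x)"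
    by (simp add: mult_left_mono)
qed

text \<open>The leading 2 counts the grids; the 2 in the bracket comes from
  \<open>epowr_add_le\<close>.\<close>

definition C_line :: real where
  "C_line = 2 * (2 * C_dyadic) powr q * C_test"

lemma C_line_pos: "0 < C_line"
  using C_dyadic_pos C_test_pos by (simp add: C_line_def)

theorem line_max_bound:
  assumes [measurable]: "v \<in> borel_measurable borel" "f \<in> borel_measurable borel"
    and "\<And>x. 0 < v x" "1 \<le> a" "one_sided_cond a v"
  shows "(\<integral>\<^sup>+x. ennreal (v x powr q) * epowr (line_max f x) q \<partial>lborel)
    \<le> ennreal (C_line * a powr \<tau>) * epowr (\<integral>\<^sup>+x. epowr (f x * ennreal (v x)) p \<partial>lborel) (q / p)"
proof -
  let ?N0 = "dyadic_max (\<lambda>_. 0) f" and ?N1 = "dyadic_max (\<lambda>k. (- 2) powi k / 3) f"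
  let ?B = "ennreal (C_test * a powr \<tau>) * epowr (\<integral>\<^sup>+x. epowr (f x * ennreal (v x)) p \<partial>lborel) (q / p)"
  let ?c = "ennreal ((2 * C_dyadic) powr q)"
  have "(\<integral>\<^sup>+x. ennreal (v x powr q) * epowr (line_max f x) q \<partial>lborel)
     \<le> (\<integral>\<^sup>+x. ?c * (ennreal (v x powr q) * epowr (?N0 x) q + ennreal (v x powr q) * epowr (?N1 x) q) \<partial>lborel)"
  proof (rule nn_integral_mono)
    fix x
    have "epowr (line_max f x) q \<le> epowr (ennreal C_dyadic * (?N0 x + ?N1 x)) q"
      using q_pos by (intro epowr_mono line_max_le_dyadic_max) auto
    also have "\<dots> = ennreal (C_dyadic powr q) * epowr (?N0 x + ?N1 x) q"
      using C_dyadic_pos by (simp add: epowr_mult epowr_ennreal)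
    also have "\<dots> \<le> ennreal (C_dyadic powr q) * (ennreal (2 powr q) * (epowr (?N0 x) q + epowr (?N1 x) q))"
      using q_pos by (intro mult_left_mono epowr_add_le) auto
    also have "\<dots> = ?c * (epowr (?N0 x) q + epowr (?N1 x) q)"
      using C_dyadic_pos by (simp add: powr_mult ennreal_mult mult_ac)
    finally have "ennreal (v x powr q) * epowr (line_max f x) q \<le> ennreal (v x powr q) * (?c * (epowr (?N0 x) q + epowr (?N1 x) q))"
      by (rule mult_left_mono) simp
    then show "ennreal (v x powr q) * epowr (line_max f x) q
        \<le> ?c * (ennreal (v x powr q) * epowr (?N0 x) q + ennreal (v x powr q) * epowr (?N1 x) q)"
      by (simp add: distrib_left mult_ac)
  qed
  also have "\<dots> = ?c * ((\<integral>\<^sup>+x. ennreal (v x powr q) * epowr (?N0 x) q \<partial>lborel) + (\<integral>\<^sup>+x. ennreal (v x powr q) * epowr (?N1 x) q \<partial>lborel))"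
    by (simp add: nn_integral_cmult nn_integral_add)
  also have "\<dots> \<le> ?c * (?B + ?B)"
    using assms grid_shift_zero grid_shift_third by (intro mult_left_mono add_mono dyadic_max_bound) auto
  also have "\<dots> = (2 * ?c * ennreal (C_test * a powr \<tau>)) * epowr (\<integral>\<^sup>+x. epowr (f x * ennreal (v x)) p \<partial>lborel) (q / p)"
    by (simp add: mult_2 distrib_left distrib_right mult_ac)
  also have "2 * ?c * ennreal (C_test * a powr \<tau>) = ennreal (C_line * a powr \<tau>)"
    using C_test_pos by (simp add: C_line_def mult_ac flip: ennreal_mult ennreal_numeral)
  finally show ?thesis .
qed

text \<open>By Hoelder's inequality the condition gives \<open>u(I\<^sup>+) \<le> a u(I\<^sup>-)\<close> for adjacent intervals of equal length.
  Halving the intervals squares the constant, so \<open>a < 1\<close> would force \<open>u = 0\<close>.\<close>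

lemma one_sided_cond_ge_1:
  assumes [measurable]: "v \<in> borel_measurable borel" and v_pos: "\<And>x. 0 < v x" and "0 \<le> a" and A: "one_sided_cond a v"
  shows "1 \<le> a"
proof (rule ccontr)
  assume "\<not> 1 \<le> a"
  then have a: "0 \<le> a" "a < 1" using assms by auto
  define \<mu> where "\<mu> = density lborel (\<lambda>t. ennreal (v t powr q))"
  \<comment> \<open>Half-open intervals, so that cutting one in two is exactly additive.\<close>
  define U where "U x h = emeasure \<mu> {x<..x + h}" for x h :: real
  have [measurable_cong]: "sets \<mu> = sets borel" by (simp add: \<mu>_def)
  have U: "U x h = (\<integral>\<^sup>+t\<in>{x<..x + h}. ennreal (v t powr q) \<partial>lborel)" for x h
    by (simp add: U_def \<mu>_def emeasure_density)
  have v_ne: "v x \<noteq> 0" for x using v_pos[of x] by simp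
  have pos: "0 < (\<integral>\<^sup>+t\<in>X. ennreal (v t powr r) \<partial>lborel)" if "X \<in> sets borel" "0 < emeasure lborel X" for X r
  proof -
    have "\<not> (AE x in lborel. x \<notin> X)" using that AE_iff_null_sets[of X lborel] by auto
    then show ?thesis using that(1) v_ne
      by (auto simp: zero_less_iff_neq_zero nn_integral_0_iff_AE indicator_def simp del: not_gr_zero)
  qed
  have one_step: "U x h \<le> ennreal a * U (x - h) h \<and> U x h < top" if h: "0 < h" for x h
  proof -
    let ?s = "\<lambda>t. ennreal (v t powr (- dual_exp p))"
    define S where "S = (\<integral>\<^sup>+t\<in>{x - h..x}. ?s t \<partial>lborel)"
    \<comment> \<open>Against this measure \<open>v powr dual_exp p\<close> has integral
      \<open>h\<close>, and its power \<open>1 + \<rho>\<close> integrates to \<open>u\<close> of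
      the left interval. Jensen's inequality then bounds \<open>h powr (1 + \<rho>)\<close> by
      \<open>s\<close> to the power \<rho> times \<open>u\<close>, both over the left
      interval.\<close>
    define \<nu> where "\<nu> = density lborel (\<lambda>t. ?s t * indicator {x - h<..x} t)"
    have m\<nu>: "emeasure \<nu> (space \<nu>) = (\<integral>\<^sup>+t\<in>{x - h<..x}. ?s t \<partial>lborel)"
      by (simp add: \<nu>_def emeasure_density)
    have "(\<integral>\<^sup>+t. ennreal (v t powr dual_exp p) \<partial>\<nu>) = (\<integral>\<^sup>+t. indicator {x - h<..x} t \<partial>lborel)"
    proof -
      have "?s t * indicator {x - h<..x} t * ennreal (v t powr dual_exp p) = indicator {x - h<..x} t" for t
        using v_ne[of t] by (auto simp: powr_minus indicator_def simp flip: ennreal_mult)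
      then show ?thesis unfolding \<nu>_def by (subst nn_integral_density) auto
    qed
    also have "\<dots> = ennreal h" using h by simp
    finally have "ennreal (h powr (1 + \<rho>)) = epowr (\<integral>\<^sup>+t. ennreal (v t powr dual_exp p) \<partial>\<nu>) (1 + \<rho>)"
      using h by (simp add: epowr_ennreal)
    also have "\<dots> \<le> epowr (emeasure \<nu> (space \<nu>)) (1 + \<rho> - 1) * (\<integral>\<^sup>+t. epowr (ennreal (v t powr dual_exp p)) (1 + \<rho>) \<partial>\<nu>)"
      using \<rho>_pos by (intro nn_integral_power_mean) (auto simp: \<nu>_def)
    also have "(\<integral>\<^sup>+t. epowr (ennreal (v t powr dual_exp p)) (1 + \<rho>) \<partial>\<nu>) = U (x - h) h"
    proof -
      have "- dual_exp p + dual_exp p * (1 + \<rho>) = q"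
        using p' by (simp add: \<rho>_def distrib_left)
      then have "?s t * epowr (ennreal (v t powr dual_exp p)) (1 + \<rho>) = ennreal (v t powr q)" for t
        using v_ne by (simp add: epowr_ennreal powr_powr flip: ennreal_mult powr_add)
      then show ?thesis
        unfolding \<nu>_def U by (subst nn_integral_density) (auto intro!: nn_integral_cong simp: indicator_def)
    qed
    also have "epowr (emeasure \<nu> (space \<nu>)) (1 + \<rho> - 1) \<le> epowr S \<rho>"
      unfolding m\<nu> S_def using \<rho>_pos by (auto intro!: epowr_mono nn_integral_mono simp: indicator_def)
    finally have *: "ennreal (h powr (1 + \<rho>)) \<le> epowr S \<rho> * U (x - h) h"
      by (simp add: mult_right_mono)
    have "U x h * epowr S \<rho> \<le> (\<integral>\<^sup>+t\<in>{x..x + h}. ennreal (v t powr q) \<partial>lborel) * epowr S \<rho>"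
      unfolding U by (auto intro!: mult_right_mono nn_integral_mono simp: indicator_def)
    also have "\<dots> \<le> ennreal (a * h powr (1 + \<rho>))"
      using A h unfolding S_def one_sided_cond_def by blast
    finally have US: "U x h * epowr S \<rho> \<le> ennreal (a * h powr (1 + \<rho>))" .
    have "0 < U x h" unfolding U using h by (intro pos) auto
    moreover have "0 < S" unfolding S_def using h by (intro pos) auto
    moreover have "U x h * epowr S \<rho> \<noteq> top" using US by (auto simp: top_unique)
    ultimately have fin: "S \<noteq> top" "U x h \<noteq> top"
      by (auto simp: ennreal_mult_eq_top_iff)
    have "epowr S \<rho> * U x h \<le> ennreal a * ennreal (h powr (1 + \<rho>))"
      using US a by (simp add: ennreal_mult mult.commute)
    also have "\<dots> \<le> ennreal a * (epowr S \<rho> * U (x - h) h)"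
      using * by (rule mult_left_mono) simp
    finally have "epowr S \<rho> * U x h \<le> epowr S \<rho> * (ennreal a * U (x - h) h)"
      by (simp add: mult_ac)
    then have "U x h \<le> ennreal a * U (x - h) h"
      using \<open>0 < S\<close> fin by (subst (asm) ennreal_mult_le_mult_iff) auto
    then show ?thesis using fin by (simp add: less_top)
  qed
  have add: "U x h = U x (h / 2) + U (x + h / 2) (h / 2)" if "0 < h" for x h
  proof -
    have "{x<..x + h} = {x<..x + h / 2} \<union> {x + h / 2<..x + h / 2 + h / 2}" using that by auto
    then show ?thesis unfolding U_def by (subst plus_emeasure) (auto simp: \<mu>_def)
  qed
  have iter: "U x h \<le> ennreal (a ^ 2 ^ n) * U (x - h) h" if "0 < h" for x h n
    using that
  proof (induction n arbitrary: x h)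
    case 0
    then show ?case using one_step by simp
  next
    case (Suc n)
    let ?c = "ennreal (a ^ 2 ^ n)"
    \<comment> \<open>Each half of an interval must be moved by twice its own length to reach the
      matching half of the neighbour; the two moves square the constant.\<close>
    have twice: "U (y + h) h \<le> ?c * (?c * U (y - h) h)" if "0 < h" for y h
      using Suc.IH[OF that, of "y + h"] mult_left_mono[OF Suc.IH[OF that, of y], of ?c] by simp
    have "U x h = U (x - h / 2 + h / 2) (h / 2) + U (x + h / 2) (h / 2)"
      using add[of h x] Suc.prems by simp
    also have "\<dots> \<le> ?c * (?c * U (x - h / 2 - h / 2) (h / 2)) + ?c * (?c * U (x - h / 2) (h / 2))"
      using Suc.prems by (intro add_mono twice) auto
    also have "\<dots> = ?c * ?c * U (x - h) h"
      using add[of h "x - h"] Suc.prems by (simp add: distrib_left mult.assoc)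
    also have "?c * ?c = ennreal (a ^ 2 ^ Suc n)"
      using a by (simp add: power_add[symmetric] mult_2 flip: ennreal_mult)
    finally show ?case .
  qed
  have "0 < U 0 1" unfolding U by (intro pos) auto
  then obtain r s where rs: "U 0 1 = ennreal r" "U (0 - 1) 1 = ennreal s" "0 < r" "0 \<le> s"
    using one_step[of 1 0] one_step[of 1 "0 - 1"]
    by (metis ennreal_cases ennreal_less_zero_iff less_irrefl zero_less_one)
  have le: "r \<le> a ^ 2 ^ n * s" for n
    using iter[of 1 0 n] rs a by (simp flip: ennreal_mult)
  have "0 < s" using le[of 0] rs a by (cases "s = 0") auto
  then obtain n where "a ^ n < r / s"
    using real_arch_pow_inv[of "r / s" a] a rs by auto
  moreover have "a ^ 2 ^ n \<le> a ^ n"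
    using a by (intro power_decreasing) auto
  ultimately have "a ^ 2 ^ n < r / s" by simp
  then have "a ^ 2 ^ n * s < r" using \<open>0 < s\<close> by (simp add: field_simps)
  then show False using le[of n] by simp
qed

end

subsection \<open>Minkowski's integral inequality\<close>

text \<open>Jensen's inequality for the measure with density \<open>H\<close>, the norm in the
  second variable, applied to the quotient of \<open>h\<close> by \<open>H\<close>; the total mass
  of this measure is the norm integral on the right. No duality, and so no finiteness of the left
  side, enters.\<close>

lemma minkowski_integral:
  assumes "sigma_finite_measure M" "sigma_finite_measure N" and "1 \<le> s"
    and h [measurable]: "(\<lambda>(x, t). h x t) \<in> borel_measurable (M \<Otimes>\<^sub>M N)"
  shows "(\<integral>\<^sup>+t. epowr (\<integral>\<^sup>+x. h x t \<partial>M) s \<partial>N)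
    \<le> epowr (\<integral>\<^sup>+x. epowr (\<integral>\<^sup>+t. epowr (h x t) s \<partial>N) (1 / s) \<partial>M) s"
proof -
  interpret M: sigma_finite_measure M by fact
  interpret N: sigma_finite_measure N by fact
  interpret pair_sigma_finite M N ..
  define H where "H x = epowr (\<integral>\<^sup>+t. epowr (h x t) s \<partial>N) (1 / s)" for x
  have [measurable]: "H \<in> borel_measurable M" unfolding H_def[abs_def] by measurable
  have Hs: "(\<integral>\<^sup>+t. epowr (h x t) s \<partial>N) = epowr (H x) s" for x
    using assms(3) by (simp add: H_def epowr_inverse_cancel')
  define T where "T = (\<integral>\<^sup>+x. H x \<partial>M)"
  show ?thesis
  proof (cases "T = top")
    case True
    then show ?thesis by (simp add: T_def H_def)
  next
    case False
    then have "AE x in M. H x \<noteq> top"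
      unfolding T_def by (intro nn_integral_noteq_infinite[simplified]) auto
    have "(\<integral>\<^sup>+t. \<integral>\<^sup>+x. (if H x = 0 then epowr (h x t) s else 0) \<partial>M \<partial>N)
        = (\<integral>\<^sup>+x. \<integral>\<^sup>+t. (if H x = 0 then epowr (h x t) s else 0) \<partial>N \<partial>M)"
      by (rule Fubini') measurable
    also have "\<dots> = (\<integral>\<^sup>+x. 0 \<partial>M)"
    proof (rule nn_integral_cong)
      fix x
      show "(\<integral>\<^sup>+t. (if H x = 0 then epowr (h x t) s else 0) \<partial>N) = 0"
        by (cases "H x = 0") (simp_all add: Hs)
    qed
    also have "\<dots> = 0" by simp
    \<comment> \<open>For almost every \<open>t\<close>, the function \<open>h\<close> vanishes at
      almost every \<open>x\<close> with \<open>H x = 0\<close>, so dividing by \<open>H\<close>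
      loses nothing.\<close>
    finally have "AE t in N. (\<integral>\<^sup>+x. (if H x = 0 then epowr (h x t) s else 0) \<partial>M) = 0"
      by (subst (asm) nn_integral_0_iff_AE) auto
    then have "AE t in N. epowr (\<integral>\<^sup>+x. h x t \<partial>M) s \<le> epowr T (s - 1) * (\<integral>\<^sup>+x. H x * epowr (h x t * inverse (H x)) s \<partial>M)"
      using AE_space
    proof eventually_elim
      case (elim t)
      note [measurable] = elim(2)
      have "AE x in M. (if H x = 0 then epowr (h x t) s else 0) = 0"
        using elim by (subst (asm) nn_integral_0_iff_AE) auto
      with \<open>AE x in M. H x \<noteq> top\<close> have "AE x in M. h x t = H x * (h x t * inverse (H x))"
      proof eventually_elim
        case (elim x)
        show ?case
        proof (cases "H x = 0")
          case True then show ?thesis using elim by simp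
        next
          case False
          then have "H x * inverse (H x) = 1"
            using elim by (metis ennreal_inverse_mult less_top mult.commute divide_ennreal_def ennreal_divide_self)
          then show ?thesis by (simp add: mult.left_commute[of "H x" "h x t"])
        qed
      qed
      then have "(\<integral>\<^sup>+x. h x t \<partial>M) = (\<integral>\<^sup>+x. H x * (h x t * inverse (H x)) \<partial>M)"
        by (rule nn_integral_cong_AE)
      also have "\<dots> = (\<integral>\<^sup>+x. h x t * inverse (H x) \<partial>density M H)"
        by (subst nn_integral_density) auto
      finally have "epowr (\<integral>\<^sup>+x. h x t \<partial>M) s \<le> epowr (emeasure (density M H) (space (density M H))) (s - 1)
          * (\<integral>\<^sup>+x. epowr (h x t * inverse (H x)) s \<partial>density M H)"
        using assms(3) by (simp only:) (intro nn_integral_power_mean; simp)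
      also have "emeasure (density M H) (space (density M H)) = T"
        unfolding T_def by (simp add: emeasure_density cong: nn_integral_cong)
      also have "(\<integral>\<^sup>+x. epowr (h x t * inverse (H x)) s \<partial>density M H) = (\<integral>\<^sup>+x. H x * epowr (h x t * inverse (H x)) s \<partial>M)"
        by (subst nn_integral_density) auto
      finally show ?case .
    qed
    then have "(\<integral>\<^sup>+t. epowr (\<integral>\<^sup>+x. h x t \<partial>M) s \<partial>N)
        \<le> (\<integral>\<^sup>+t. epowr T (s - 1) * (\<integral>\<^sup>+x. H x * epowr (h x t * inverse (H x)) s \<partial>M) \<partial>N)"
      by (rule nn_integral_mono_AE)
    also have "\<dots> = epowr T (s - 1) * (\<integral>\<^sup>+t. \<integral>\<^sup>+x. H x * epowr (h x t * inverse (H x)) s \<partial>M \<partial>N)"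
      by (rule nn_integral_cmult) measurable
    also have "(\<integral>\<^sup>+t. \<integral>\<^sup>+x. H x * epowr (h x t * inverse (H x)) s \<partial>M \<partial>N) = (\<integral>\<^sup>+x. \<integral>\<^sup>+t. H x * epowr (h x t * inverse (H x)) s \<partial>N \<partial>M)"
      by (rule Fubini') measurable
    also have "\<dots> = (\<integral>\<^sup>+x. H x * (epowr (H x) s * epowr (inverse (H x)) s) \<partial>M)"
      by (intro nn_integral_cong) (simp add: epowr_mult nn_integral_cmult nn_integral_multc Hs)
    also have "\<dots> \<le> T"
      unfolding T_def
    proof (rule nn_integral_mono)
      fix x
      show "H x * (epowr (H x) s * epowr (inverse (H x)) s) \<le> H x"
      proof (cases "H x = 0 \<or> H x = top")
        case False
        then have "H x * inverse (H x) = 1"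
          by (metis divide_ennreal_def ennreal_divide_self less_top)
        then show ?thesis by (simp flip: epowr_mult)
      qed auto
    qed
    also have "epowr T (s - 1) * T = epowr T s"
      using epowr_add[of T "s - 1" 1] by simp
    finally show ?thesis by (simp add: T_def H_def mult_left_mono)
  qed
qed

subsection \<open>Iteration over the coordinates\<close>

interpretation lborel_product: product_sigma_finite "\<lambda>_. lborel :: real measure"
  by unfold_locales

abbreviation lborel_PiM :: "'i set \<Rightarrow> ('i \<Rightarrow> real) measure" where
  "lborel_PiM I \<equiv> Pi\<^sub>M I (\<lambda>_. lborel)"

text \<open>Fubini's theorem for null sets. The first order freezes the new variable in the
  induction over coordinates; the second passes to slices of a representative.\<close>

lemma AE_PiM_insert:
  assumes "finite I" "i \<notin> I" "AE y in lborel_PiM (insert i I). P y"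
  shows "AE t in lborel. AE y in lborel_PiM I. P (y(i := t))"
    and "AE y in lborel_PiM I. AE t in lborel. P (y(i := t))"
proof -
  interpret I: sigma_finite_measure "lborel_PiM I" using lborel_product.sigma_finite assms(1) .
  obtain N where N: "N \<in> sets (lborel_PiM (insert i I))" "emeasure (lborel_PiM (insert i I)) N = 0"
    "\<And>y. y \<in> space (lborel_PiM (insert i I)) \<Longrightarrow> \<not> P y \<Longrightarrow> y \<in> N"
    using assms(3) by (rule AE_E) blast
  note [measurable] = N(1)
  have upd: "y(i := t) \<in> space (lborel_PiM (insert i I))" if "y \<in> space (lborel_PiM I)" for y t
    using that by (auto simp: space_PiM PiE_def extensional_def)
  have upd_m [measurable]: "(\<lambda>(y, t). y(i := t)) \<in> measurable (lborel_PiM I \<Otimes>\<^sub>M lborel) (lborel_PiM (insert i I))"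
    by (rule measurable_add_dim)
  have [measurable]: "(\<lambda>(y, t). indicator N (y(i := t)) :: ennreal) \<in> borel_measurable (lborel_PiM I \<Otimes>\<^sub>M lborel)"
    using measurable_compose[OF upd_m borel_measurable_indicator[OF N(1)]] by (simp add: split_beta')
  have ind: "(\<integral>\<^sup>+y. indicator N y \<partial>lborel_PiM (insert i I)) = 0" using N by simp
  then have "(\<integral>\<^sup>+t. \<integral>\<^sup>+y. indicator N (y(i := t)) \<partial>lborel_PiM I \<partial>lborel) = 0"
    "(\<integral>\<^sup>+y. \<integral>\<^sup>+t. indicator N (y(i := t)) \<partial>lborel \<partial>lborel_PiM I) = 0"
    by (subst (asm) lborel_product.product_nn_integral_insert_rev[OF assms(1,2)], simp, simp)
       (use ind in \<open>subst (asm) lborel_product.product_nn_integral_insert[OF assms(1,2)], simp, simp\<close>)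
  then have A: "AE t in lborel. (\<integral>\<^sup>+y. indicator N (y(i := t)) \<partial>lborel_PiM I) = 0"
    "AE y in lborel_PiM I. (\<integral>\<^sup>+t. indicator N (y(i := t)) \<partial>lborel) = 0"
    by (auto simp: nn_integral_0_iff_AE)
  show "AE t in lborel. AE y in lborel_PiM I. P (y(i := t))"
    using A(1)
  proof eventually_elim
    case (elim t)
    have "(\<lambda>y. indicator N (y(i := t)) :: ennreal) \<in> borel_measurable (lborel_PiM I)" by measurable
    then have "AE y in lborel_PiM I. indicator N (y(i := t)) = (0 :: ennreal)"
      using elim by (simp add: nn_integral_0_iff_AE)
    then show ?case
      using AE_space by eventually_elim (use N(3) upd in \<open>auto simp: indicator_def split: if_splits\<close>)
  qed
  show "AE y in lborel_PiM I. AE t in lborel. P (y(i := t))"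
    using A(2) AE_space
  proof eventually_elim
    case (elim y)
    note [measurable] = elim(2)
    have "(\<lambda>t. indicator N (y(i := t)) :: ennreal) \<in> borel_measurable lborel" by measurable
    then have "AE t in lborel. indicator N (y(i := t)) = (0 :: ennreal)"
      using elim(1) by (simp add: nn_integral_0_iff_AE)
    then show ?case
      by eventually_elim (use N(3) upd elim(2) in \<open>auto simp: indicator_def split: if_splits\<close>)
  qed
qed

context frac_exponents
begin

text \<open>The strong operator with side lengths \<open>2 powi k i\<close>, independent in each
  coordinate. Functions on an index set replace vectors so that \<open>I\<close> can grow by
  induction; the index type is finite, so the supremum is countable.\<close>

definition prod_max :: "'i::finite set \<Rightarrow> (('i \<Rightarrow> real) \<Rightarrow> ennreal) \<Rightarrow> ('i \<Rightarrow> real) \<Rightarrow> ennreal" where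
  "prod_max I F x = (SUP k :: 'i \<Rightarrow> int. (\<Prod>i\<in>I. ennreal ((2 powi k i) powr (\<alpha> - 1))) *
     (\<integral>\<^sup>+y. F y * (\<Prod>i\<in>I. indicator {x i - 2 powi k i..x i} (y i)) \<partial>lborel_PiM I))"

lemma indicator_interval_measurable [measurable (raw)]:
  fixes f g :: "'a \<Rightarrow> real"
  assumes [measurable]: "f \<in> borel_measurable M" "g \<in> borel_measurable M"
  shows "(\<lambda>w. indicator {f w - c..f w} (g w) :: ennreal) \<in> borel_measurable M"
proof -
  have "(\<lambda>w. indicator {f w - c..f w} (g w) :: ennreal) = (\<lambda>w. if f w - c \<le> g w \<and> g w \<le> f w then 1 else 0)"
    by (auto simp: indicator_def)
  then show ?thesis by simp
qed

lemma prod_max_measurable [measurable]: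
  assumes [measurable]: "F \<in> borel_measurable (lborel_PiM I)"
  shows "prod_max I F \<in> borel_measurable (lborel_PiM I)"
proof -
  interpret sigma_finite_measure "lborel_PiM I" by (rule lborel_product.sigma_finite) simp
  have "(\<lambda>(x, y). F y * (\<Prod>i\<in>I. indicator {x i - 2 powi k i..x i} (y i)))
      \<in> borel_measurable (lborel_PiM I \<Otimes>\<^sub>M lborel_PiM I)" for k :: "'a \<Rightarrow> int"
    unfolding split_beta'
    by (intro borel_measurable_times_ennreal borel_measurable_prod_ennreal indicator_interval_measurable) measurable
  from borel_measurable_nn_integral[OF this] show ?thesis
    unfolding prod_max_def[abs_def] by measurable
qed

lemma line_max_measurable:
  assumes [measurable]: "(\<lambda>(x, t). F x t) \<in> borel_measurable (M \<Otimes>\<^sub>M lborel)"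
  shows "(\<lambda>(x, t). line_max (F x) t) \<in> borel_measurable (M \<Otimes>\<^sub>M lborel)"
proof -
  have "(\<lambda>(w, s). F (fst w) s * indicator {snd w - 2 powi k..snd w} s) \<in> borel_measurable ((M \<Otimes>\<^sub>M lborel) \<Otimes>\<^sub>M lborel)"
    for k :: int
    unfolding split_beta' by measurable
  from lborel.borel_measurable_nn_integral[OF this] show ?thesis
    unfolding line_max_def split_beta' by measurable
qed

text \<open>For fixed side lengths the average is an iterated one, and the inner average is at most
  its supremum. So one joint supremum is dominated by iterated ones.\<close>

lemma prod_max_insert_le:
  assumes "i \<notin> I" and [measurable]: "F \<in> borel_measurable (lborel_PiM (insert i I))"
  shows "prod_max (insert i I) F (x(i := t)) \<le> prod_max I (\<lambda>z. line_max (\<lambda>s. F (z(i := s))) t) x"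
  unfolding prod_max_def[of "insert i I"]
proof (rule SUP_least)
  fix k :: "'a \<Rightarrow> int"
  let ?c = "\<lambda>j. ennreal ((2 powi k j) powr (\<alpha> - 1))"
  let ?b = "\<lambda>j z. indicator {x j - 2 powi k j..x j} (z j) :: ennreal"
  let ?G = "\<lambda>z. \<integral>\<^sup>+s. F (z(i := s)) * indicator {t - 2 powi k i..t} s \<partial>lborel"
  have F2 [measurable]: "(\<lambda>(z, s). F (z(i := s))) \<in> borel_measurable (lborel_PiM I \<Otimes>\<^sub>M lborel)"
    using measurable_compose[OF measurable_add_dim assms(2)] by (simp add: split_beta')
  let ?X = "\<integral>\<^sup>+y. F y * (\<Prod>j\<in>insert i I. indicator {(x(i := t)) j - 2 powi k j..(x(i := t)) j} (y j)) \<partial>lborel_PiM (insert i I)"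
  have m: "(\<lambda>y. F y * (\<Prod>j\<in>insert i I. indicator {(x(i := t)) j - 2 powi k j..(x(i := t)) j} (y j)))
      \<in> borel_measurable (lborel_PiM (insert i I))"
    by (intro borel_measurable_times_ennreal borel_measurable_prod_ennreal indicator_interval_measurable) measurable
  have "?X = (\<integral>\<^sup>+z. \<integral>\<^sup>+s. F (z(i := s)) * (\<Prod>j\<in>insert i I. indicator {(x(i := t)) j - 2 powi k j..(x(i := t)) j} ((z(i := s)) j)) \<partial>lborel \<partial>lborel_PiM I)"
    using assms(1) by (intro lborel_product.product_nn_integral_insert m) auto
  also have "\<dots> = (\<integral>\<^sup>+z. ?G z * (\<Prod>j\<in>I. ?b j z) \<partial>lborel_PiM I)"
  proof (rule nn_integral_cong)
    fix z assume z: "z \<in> space (lborel_PiM I)"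
    have "(\<Prod>j\<in>I. indicator {(x(i := t)) j - 2 powi k j..(x(i := t)) j} ((z(i := s)) j) :: ennreal)
        = (\<Prod>j\<in>I. ?b j z)" for s
      using assms(1) by (intro prod.cong) auto
    then have "(\<Prod>j\<in>insert i I. indicator {(x(i := t)) j - 2 powi k j..(x(i := t)) j} ((z(i := s)) j) :: ennreal)
        = indicator {t - 2 powi k i..t} s * (\<Prod>j\<in>I. ?b j z)" for s
      using assms(1) by simp
    moreover have "(\<lambda>s. F (z(i := s))) \<in> borel_measurable lborel"
      using measurable_compose[OF measurable_Pair1'[OF z] F2] by simp
    ultimately show "(\<integral>\<^sup>+s. F (z(i := s)) * (\<Prod>j\<in>insert i I. indicator {(x(i := t)) j - 2 powi k j..(x(i := t)) j} ((z(i := s)) j)) \<partial>lborel)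
        = ?G z * (\<Prod>j\<in>I. ?b j z)"
      by (simp add: mult.assoc[symmetric]) (rule nn_integral_multc, simp)
  qed
  finally have split: "?X = (\<integral>\<^sup>+z. ?G z * (\<Prod>j\<in>I. ?b j z) \<partial>lborel_PiM I)" .
  have G_m: "(\<lambda>z. ?G z * (\<Prod>j\<in>I. ?b j z)) \<in> borel_measurable (lborel_PiM I)"
  proof -
    have "(\<lambda>(z, s). F (z(i := s)) * indicator {t - 2 powi k i..t} s) \<in> borel_measurable (lborel_PiM I \<Otimes>\<^sub>M lborel)"
      unfolding split_beta' by measurable
    then have "?G \<in> borel_measurable (lborel_PiM I)"
      by (rule lborel.borel_measurable_nn_integral)
    then show ?thesis
      by (intro borel_measurable_times_ennreal borel_measurable_prod_ennreal indicator_interval_measurable) auto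
  qed
  have "(\<Prod>j\<in>insert i I. ?c j) * ?X = (\<Prod>j\<in>I. ?c j) * (?c i * ?X)"
    using assms(1) by (simp add: mult.assoc mult.left_commute[of "?c i"])
  also have "\<dots> = (\<Prod>j\<in>I. ?c j) * (\<integral>\<^sup>+z. ?c i * (?G z * (\<Prod>j\<in>I. ?b j z)) \<partial>lborel_PiM I)"
    unfolding split nn_integral_cmult[OF G_m] ..
  also have "\<dots> \<le> (\<Prod>j\<in>I. ?c j) * (\<integral>\<^sup>+z. line_max (\<lambda>s. F (z(i := s))) t * (\<Prod>j\<in>I. ?b j z) \<partial>lborel_PiM I)"
    unfolding line_max_def mult.assoc[symmetric]
    by (intro mult_left_mono nn_integral_mono mult_right_mono SUP_upper) auto
  also have "\<dots> \<le> prod_max I (\<lambda>z. line_max (\<lambda>s. F (z(i := s))) t) x"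
    unfolding prod_max_def by (rule SUP_upper[of k UNIV]) simp
  finally show "(\<Prod>j\<in>insert i I. ?c j) * ?X \<le> prod_max I (\<lambda>z. line_max (\<lambda>s. F (z(i := s))) t) x" .
qed

text \<open>Freezing the new variable \<open>t\<close> and using the induction hypothesis leaves a
  \<open>p\<close>-norm in \<open>x\<close> inside a \<open>q\<close>-norm in \<open>t\<close>.
  Minkowski's inequality with exponent \<open>q / p\<close> makes the norm in \<open>t\<close> the
  inner one, where the bound on the line applies for almost every \<open>x\<close>. \<open>W\<close>
  and \<open>F\<close> stay arbitrary, as the hypothesis is applied to slices.\<close>

theorem prod_max_bound:
  fixes W :: "('i::finite \<Rightarrow> real) \<Rightarrow> real" and A :: "'i \<Rightarrow> real"
  assumes "W \<in> borel_measurable (lborel_PiM I)" "F \<in> borel_measurable (lborel_PiM I)" "\<And>x. 0 < W x"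
    "\<And>i. i \<in> I \<Longrightarrow> 1 \<le> A i"
    "\<And>i. i \<in> I \<Longrightarrow> AE y in lborel_PiM (I - {i}). one_sided_cond (A i) (\<lambda>t. W (y(i := t)))"
  shows "(\<integral>\<^sup>+x. ennreal (W x powr q) * epowr (prod_max I F x) q \<partial>lborel_PiM I)
    \<le> (\<Prod>i\<in>I. ennreal (C_line * A i powr \<tau>)) * epowr (\<integral>\<^sup>+x. epowr (F x * ennreal (W x)) p \<partial>lborel_PiM I) (q / p)"
  using finite[of I] assms
proof (induction I arbitrary: W F rule: finite_induct)
  case empty
  \<comment> \<open>Without coordinates the space is a single point and the operator is evaluation,
    so both sides agree.\<close>
  have "prod_max {} F (\<lambda>_. undefined) = F (\<lambda>_. undefined)"
    by (simp add: prod_max_def lborel_product.nn_integral_empty)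
  moreover have "ennreal (W x powr q) = epowr (ennreal (W x)) q" for x
    using empty.prems(3)[of x] by (simp add: epowr_ennreal)
  ultimately show ?case
    using p by (simp add: lborel_product.nn_integral_empty epowr_epowr epowr_mult mult.commute)
next
  case (insert i I)
  let ?M = "lborel_PiM I" and ?J = "lborel_PiM (insert i I)"
  interpret I: sigma_finite_measure ?M using lborel_product.sigma_finite insert.hyps(1) .
  note Wm = insert.prems(1) and Fm = insert.prems(2)
  define G where "G t x = line_max (\<lambda>s. F (x(i := s))) t" for t x
  have F2 [measurable]: "(\<lambda>(x, t). F (x(i := t))) \<in> borel_measurable (?M \<Otimes>\<^sub>M lborel)"
    using measurable_compose[OF measurable_add_dim Fm] by (simp add: split_beta' fun_upd_def)
  have W2 [measurable]: "(\<lambda>(x, t). W (x(i := t))) \<in> borel_measurable (?M \<Otimes>\<^sub>M lborel)"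
    using measurable_compose[OF measurable_add_dim Wm] by (simp add: split_beta' fun_upd_def)
  have G2 [measurable]: "(\<lambda>(x, t). G t x) \<in> borel_measurable (?M \<Otimes>\<^sub>M lborel)"
    unfolding G_def using F2 by (rule line_max_measurable)
  have Gt [measurable]: "G t \<in> borel_measurable ?M" for t
    using measurable_compose[OF measurable_Pair2'[of t lborel ?M] G2] by simp
  have Wt [measurable]: "(\<lambda>x. W (x(i := t))) \<in> borel_measurable ?M" for t
    using measurable_compose[OF measurable_Pair2'[of t lborel ?M] W2] by simp
  let ?c = "\<lambda>j. ennreal (C_line * A j powr \<tau>)"
  let ?P = "\<Prod>j\<in>I. ?c j"
  let ?h = "\<lambda>x t. epowr (G t x * ennreal (W (x(i := t)))) p"
  \<comment> \<open>The assumption on coordinate \<open>j\<close> holds for almost all values of the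
    other variables, \<open>t\<close> included; for almost every frozen \<open>t\<close> it holds in
    the rest.\<close>
  have cond: "AE t in lborel. \<forall>j\<in>I. AE y in lborel_PiM (I - {j}). one_sided_cond (A j) (\<lambda>s. W (y(j := s, i := t)))"
  proof (intro AE_finite_allI insert.hyps(1))
    fix j assume j: "j \<in> I"
    have "insert i I - {j} = insert i (I - {j})" using insert.hyps(2) j by auto
    moreover have "AE y in lborel_PiM (insert i I - {j}). one_sided_cond (A j) (\<lambda>t. W (y(j := t)))"
      using j by (intro insert.prems(5)) auto
    ultimately have "AE y in lborel_PiM (insert i (I - {j})). one_sided_cond (A j) (\<lambda>t. W (y(j := t)))"
      by metis
    from AE_PiM_insert(1)[OF _ _ this]
    have "AE t in lborel. AE y in lborel_PiM (I - {j}). one_sided_cond (A j) (\<lambda>s. W (y(i := t, j := s)))"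
      using insert.hyps by auto
    then show "AE t in lborel. AE y in lborel_PiM (I - {j}). one_sided_cond (A j) (\<lambda>s. W (y(j := s, i := t)))"
      using insert.hyps(2) j by (subst fun_upd_twist) auto
  qed
  have "(\<integral>\<^sup>+x. ennreal (W x powr q) * epowr (prod_max (insert i I) F x) q \<partial>?J)
    = (\<integral>\<^sup>+t. \<integral>\<^sup>+x. ennreal (W (x(i := t)) powr q) * epowr (prod_max (insert i I) F (x(i := t))) q \<partial>?M \<partial>lborel)"
    using insert.hyps insert.prems by (intro lborel_product.product_nn_integral_insert_rev) auto
  also have "\<dots> \<le> (\<integral>\<^sup>+t. \<integral>\<^sup>+x. ennreal (W (x(i := t)) powr q) * epowr (prod_max I (G t) x) q \<partial>?M \<partial>lborel)"
    unfolding G_def using q_pos insert.hyps Fm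
    by (intro nn_integral_mono mult_left_mono epowr_mono prod_max_insert_le) auto
  also have "\<dots> \<le> (\<integral>\<^sup>+t. ?P * epowr (\<integral>\<^sup>+x. ?h x t \<partial>?M) (q / p) \<partial>lborel)"
  proof (rule nn_integral_mono_AE, use cond in eventually_elim)
    case (elim t)
    then show ?case
      using insert.prems(3,4) by (intro insert.IH Wt Gt) blast+
  qed
  also have "\<dots> = ?P * (\<integral>\<^sup>+t. epowr (\<integral>\<^sup>+x. ?h x t \<partial>?M) (q / p) \<partial>lborel)"
    by (rule nn_integral_cmult) measurable
  also have "\<dots> \<le> ?P * epowr (\<integral>\<^sup>+x. epowr (\<integral>\<^sup>+t. epowr (?h x t) (q / p) \<partial>lborel) (1 / (q / p)) \<partial>?M) (q / p)"
    using p p_less_q I.sigma_finite_measure_axioms lborel.sigma_finite_measure_axioms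
    by (intro mult_left_mono minkowski_integral) (auto, measurable)
  also have "\<dots> \<le> ?P * epowr (epowr (?c i) (p / q) * (\<integral>\<^sup>+x. \<integral>\<^sup>+t. epowr (F (x(i := t)) * ennreal (W (x(i := t)))) p \<partial>lborel \<partial>?M)) (q / p)"
  proof (intro mult_left_mono epowr_mono)
    have "AE x in ?M. one_sided_cond (A i) (\<lambda>t. W (x(i := t)))"
      using insert.prems(5)[OF insertI1] insert.hyps(2) by (metis Diff_insert_absorb)
    then have "AE x in ?M. epowr (\<integral>\<^sup>+t. epowr (?h x t) (q / p) \<partial>lborel) (1 / (q / p))
      \<le> epowr (?c i) (p / q) * (\<integral>\<^sup>+t. epowr (F (x(i := t)) * ennreal (W (x(i := t)))) p \<partial>lborel)"
      using AE_space
    proof eventually_elim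
      case (elim x)
      note [measurable] = elim(2)
      have [measurable]: "(\<lambda>t. W (x(i := t))) \<in> borel_measurable borel" "(\<lambda>t. F (x(i := t))) \<in> borel_measurable borel"
        using measurable_compose[OF measurable_Pair1'[OF elim(2)] W2]
          measurable_compose[OF measurable_Pair1'[OF elim(2)] F2] by simp_all
      have "(\<integral>\<^sup>+t. epowr (?h x t) (q / p) \<partial>lborel) = (\<integral>\<^sup>+t. ennreal (W (x(i := t)) powr q) * epowr (line_max (\<lambda>s. F (x(i := s))) t) q \<partial>lborel)"
        using p insert.prems(3)[THEN less_imp_le]
        by (intro nn_integral_cong) (simp add: epowr_epowr epowr_mult epowr_ennreal powr_powr G_def mult.commute)
      also have "\<dots> \<le> ?c i * epowr (\<integral>\<^sup>+t. epowr (F (x(i := t)) * ennreal (W (x(i := t)))) p \<partial>lborel) (q / p)"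
        using insert.prems elim by (intro line_max_bound) auto
      finally have "epowr (\<integral>\<^sup>+t. epowr (?h x t) (q / p) \<partial>lborel) (p / q) \<le> epowr (\<dots>) (p / q)"
        using p q_pos by (intro epowr_mono) auto
      then show ?case
        using p q_pos by (simp add: epowr_mult epowr_epowr)
    qed
    then have "(\<integral>\<^sup>+x. epowr (\<integral>\<^sup>+t. epowr (?h x t) (q / p) \<partial>lborel) (1 / (q / p)) \<partial>?M)
      \<le> (\<integral>\<^sup>+x. epowr (?c i) (p / q) * (\<integral>\<^sup>+t. epowr (F (x(i := t)) * ennreal (W (x(i := t)))) p \<partial>lborel) \<partial>?M)"
      by (rule nn_integral_mono_AE)
    then show "(\<integral>\<^sup>+x. epowr (\<integral>\<^sup>+t. epowr (?h x t) (q / p) \<partial>lborel) (1 / (q / p)) \<partial>?M)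
      \<le> epowr (?c i) (p / q) * (\<integral>\<^sup>+x. \<integral>\<^sup>+t. epowr (F (x(i := t)) * ennreal (W (x(i := t)))) p \<partial>lborel \<partial>?M)"
      by (subst (asm) nn_integral_cmult) (auto, measurable)
  qed (use p q_pos in auto)
  also have "(\<integral>\<^sup>+x. \<integral>\<^sup>+t. epowr (F (x(i := t)) * ennreal (W (x(i := t)))) p \<partial>lborel \<partial>?M) = (\<integral>\<^sup>+x. epowr (F x * ennreal (W x)) p \<partial>?J)"
    using insert.hyps Wm Fm by (intro lborel_product.product_nn_integral_insert[symmetric]) auto
  finally show ?case
    using insert.hyps p q_pos by (simp add: epowr_mult epowr_epowr mult_ac)
qed

end

subsection \<open>Transfer to Euclidean space\<close>

lemma Basis_cart: "(Basis :: (real ^ 'n::finite) set) = (\<lambda>i. axis i 1) ` UNIV"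
  by (auto simp: Basis_vec_def)

lemma vec_lambda_measurable [measurable]:
  "vec_lambda \<in> measurable (lborel_PiM UNIV) (borel :: (real ^ 'n::finite) measure)"
  by (subst borel_measurable_euclidean_space) (auto simp: Basis_cart inner_axis)

lemma vec_nth_measurable [measurable]:
  "vec_nth \<in> measurable (borel :: (real ^ 'n::finite) measure) (lborel_PiM UNIV)"
  by (intro measurable_PiM_single') auto

lemma lborel_eq_distr_PiM:
  "(lborel :: (real ^ 'n::finite) measure) = distr (lborel_PiM UNIV) borel vec_lambda"
proof (rule lborel_eqI)
  fix l u :: "real ^ 'n"
  assume lu: "\<And>b. b \<in> Basis \<Longrightarrow> l \<bullet> b \<le> u \<bullet> b"
  have le: "l $ i \<le> u $ i" for i
    using lu[of "axis i 1"] by (simp add: Basis_cart inner_axis)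
  have "vec_lambda -` box l u \<inter> space (lborel_PiM UNIV) = Pi\<^sub>E UNIV (\<lambda>i. {l $ i<..<u $ i})"
    by (auto simp: space_PiM mem_box_cart PiE_iff)
  then have "emeasure (distr (lborel_PiM UNIV) borel vec_lambda) (box l u)
      = (\<Prod>i\<in>UNIV. emeasure lborel {l $ i<..<u $ i})"
    by (simp add: emeasure_distr lborel_product.emeasure_PiM)
  also have "\<dots> = (\<Prod>i\<in>UNIV. ennreal (u $ i - l $ i))"
    using le by simp
  also have "\<dots> = ennreal (\<Prod>i\<in>UNIV. u $ i - l $ i)"
    using le by (intro prod_ennreal) auto
  also have "(\<Prod>i\<in>UNIV. u $ i - l $ i) = (\<Prod>b\<in>Basis. (u - l) \<bullet> b)"
    unfolding Basis_cart by (subst prod.reindex) (auto simp: inj_on_def axis_eq_axis inner_axis)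
  finally show "emeasure (distr (lborel_PiM UNIV) borel vec_lambda) (box l u) = ennreal (\<Prod>b\<in>Basis. (u - l) \<bullet> b)" .
qed simp

lemma nn_integral_lborel_cart:
  assumes [measurable]: "g \<in> borel_measurable borel"
  shows "(\<integral>\<^sup>+x. g x \<partial>(lborel :: (real ^ 'n::finite) measure)) = (\<integral>\<^sup>+y. g (vec_lambda y) \<partial>lborel_PiM UNIV)"
  unfolding lborel_eq_distr_PiM by (subst nn_integral_distr) auto

lemma AE_lborel_cart:
  assumes "AE x in (lborel :: (real ^ 'n::finite) measure). P x"
  shows "AE y in lborel_PiM UNIV. P (vec_lambda y)"
  using AE_distrD[OF vec_lambda_measurable] assms unfolding lborel_eq_distr_PiM by blast

text \<open>Guarantees that a slice with an almost sure property exists. The unit cube has measure 1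
  also for \<open>I = {}\<close>, which occurs in dimension one.\<close>

lemma lborel_PiM_not_AE_False:
  assumes "finite I"
  shows "\<not> (AE y in lborel_PiM I. False)"
proof
  assume "AE y in lborel_PiM I. False"
  then have "emeasure (lborel_PiM I) (space (lborel_PiM I)) = 0"
    by (subst AE_iff_measurable[symmetric, where P = "\<lambda>_. False"]) auto
  moreover have "emeasure (lborel_PiM I) (Pi\<^sub>E I (\<lambda>_. {0..1::real})) = 1"
    using assms by (subst lborel_product.emeasure_PiM) auto
  moreover have "emeasure (lborel_PiM I) (Pi\<^sub>E I (\<lambda>_. {0..1::real})) \<le> emeasure (lborel_PiM I) (space (lborel_PiM I))"
    by (rule emeasure_space)
  ultimately show False by simp
qed

lemma powi_between:
  assumes "0 < (h::real)"
  shows "\<exists>k::int. h \<le> 2 powi k \<and> 2 powi k \<le> 2 * h"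
proof (intro exI conjI)
  let ?k = "\<lceil>log 2 h\<rceil>"
  have e: "(2::real) powi ?k = 2 powr of_int ?k" by (simp add: powr_real_of_int')
  have "h = 2 powr (log 2 h)" using assms by simp
  also have "\<dots> \<le> 2 powr of_int ?k" by (intro powr_mono) auto
  finally show "h \<le> 2 powi ?k" using e by simp
  have "2 powr of_int ?k \<le> 2 powr (log 2 h + 1)" by (intro powr_mono) linarith+
  then show "2 powi ?k \<le> 2 * h" using assms e by (simp add: powr_add)
qed

section \<open>Characteristics on slices and the bound on Euclidean space\<close>

context frac_exponents
begin

lemma one_sided_cond_A_char_line:
  assumes A: "A_char_line p q v \<le> ennreal a" and "0 \<le> a" and eq: "AE t in lborel. v t = v' t"
  shows "one_sided_cond a v'"
  unfolding one_sided_cond_def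
proof (intro allI impI)
  fix x h :: real assume h: "0 < h"
  let ?X = "\<integral>\<^sup>+t\<in>{x..x + h}. ennreal (v' t powr q) \<partial>lborel"
  let ?Y = "\<integral>\<^sup>+t\<in>{x - h..x}. ennreal (v' t powr (- dual_exp p)) \<partial>lborel"
  have "(\<integral>\<^sup>+t\<in>{x..x + h}. ennreal (v t powr q) \<partial>lebesgue) = ?X"
    "(\<integral>\<^sup>+t\<in>{x - h..x}. ennreal (v t powr (- dual_exp p)) \<partial>lebesgue) = ?Y"
    unfolding nn_integral_completion using eq by (auto intro!: nn_integral_cong_AE)
  then have "(ennreal (1 / h) * ?X) * epowr (ennreal (1 / h) * ?Y) \<rho> \<le> A_char_line p q v"
    unfolding A_char_line_def \<rho>_def using h by (intro SUP_upper2[of "(x, h)"]) auto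
  then have "(ennreal (1 / h) * ?X) * epowr (ennreal (1 / h) * ?Y) \<rho> \<le> ennreal a"
    using A by (rule order_trans)
  then have "ennreal (h powr (1 + \<rho>)) * ((ennreal (1 / h) * ?X) * epowr (ennreal (1 / h) * ?Y) \<rho>) \<le> ennreal (h powr (1 + \<rho>)) * ennreal a"
    by (rule mult_left_mono) simp
  also have "ennreal (h powr (1 + \<rho>)) * ((ennreal (1 / h) * ?X) * epowr (ennreal (1 / h) * ?Y) \<rho>)
     = (ennreal (h powr (1 + \<rho>)) * (ennreal (1 / h) * ennreal ((1 / h) powr \<rho>))) * (?X * epowr ?Y \<rho>)"
    using h by (simp add: epowr_mult epowr_ennreal mult_ac)
  also have "ennreal (h powr (1 + \<rho>)) * (ennreal (1 / h) * ennreal ((1 / h) powr \<rho>)) = 1"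
    using h by (simp add: powr_add powr_divide flip: ennreal_mult)
  finally show "?X * epowr ?Y \<rho> \<le> ennreal (a * h powr (1 + \<rho>))"
    using h \<open>0 \<le> a\<close> by (simp add: ennreal_mult mult.commute)
qed

text \<open>Each side is enlarged to a length \<open>2 powi k i\<close> of at most twice its size.
  The integral grows, and the normalisation loses at most \<open>2 powr (1 - \<alpha>)\<close> per
  coordinate.\<close>

lemma strong_frac_max_le_prod_max:
  fixes f :: "real ^ 'n::finite \<Rightarrow> real"
  assumes [measurable]: "f' \<in> borel_measurable borel" and eq: "AE x in lborel. f x = f' x"
  shows "strong_frac_max \<alpha> f x
    \<le> ennreal ((2 powr (1 - \<alpha>)) ^ CARD('n)) * prod_max UNIV (\<lambda>y. ennreal \<bar>f' (vec_lambda y)\<bar>) (vec_nth x)"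
  unfolding strong_frac_max_def
proof (rule SUP_least)
  fix h :: "real ^ 'n" assume "h \<in> pos_vecs"
  then have h: "0 < h $ i" for i by (simp add: pos_vecs_def)
  have "\<forall>i. \<exists>k::int. h $ i \<le> 2 powi k \<and> 2 powi k \<le> 2 * h $ i"
    using powi_between[OF h] by blast
  then obtain k where k: "\<And>i. h $ i \<le> 2 powi k i" "\<And>i. 2 powi k i \<le> 2 * h $ i"
    by (subst (asm) choice_iff) blast
  have "(\<integral>\<^sup>+y\<in>cbox (x - h) x. ennreal \<bar>f y\<bar> \<partial>lebesgue) = (\<integral>\<^sup>+y\<in>cbox (x - h) x. ennreal \<bar>f' y\<bar> \<partial>lborel)"
    unfolding nn_integral_completion using eq by (auto intro!: nn_integral_cong_AE)
  also have "\<dots> = (\<integral>\<^sup>+y. ennreal \<bar>f' (vec_lambda y)\<bar> * indicator (cbox (x - h) x) (vec_lambda y) \<partial>lborel_PiM UNIV)"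
    by (rule nn_integral_lborel_cart) simp
  also have "\<dots> \<le> (\<integral>\<^sup>+y. ennreal \<bar>f' (vec_lambda y)\<bar> * (\<Prod>i\<in>UNIV. indicator {x $ i - 2 powi k i..x $ i} (y i)) \<partial>lborel_PiM UNIV)"
  proof (intro nn_integral_mono mult_left_mono)
    fix y :: "'n \<Rightarrow> real"
    show "indicator (cbox (x - h) x) (vec_lambda y) \<le> (\<Prod>i\<in>UNIV. indicator {x $ i - 2 powi k i..x $ i} (y i) :: ennreal)"
    proof (cases "vec_lambda y \<in> cbox (x - h) x")
      case True
      then have "y i \<in> {x $ i - 2 powi k i..x $ i}" for i
        using k(1)[of i] by (simp add: mem_box_cart) (metis add_le_cancel_left diff_add_cancel diff_left_mono order_trans)
      then show ?thesis by (simp add: indicator_def)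
    qed simp
  qed simp
  finally have int: "(\<integral>\<^sup>+y\<in>cbox (x - h) x. ennreal \<bar>f y\<bar> \<partial>lebesgue) \<le> \<dots>" .
  have "1 / (\<Prod>i\<in>UNIV. (h $ i) powr (1 - \<alpha>)) = (\<Prod>i\<in>UNIV. (h $ i) powr (\<alpha> - 1))"
  proof -
    have "(h $ i) powr (\<alpha> - 1) = inverse ((h $ i) powr (1 - \<alpha>))" for i
      using powr_minus[of "h $ i" "1 - \<alpha>"] by simp
    then show ?thesis
      using prod_inversef[of "\<lambda>i. (h $ i) powr (1 - \<alpha>)" UNIV] by (simp add: divide_inverse comp_def)
  qed
  also have "\<dots> \<le> (\<Prod>i\<in>UNIV. 2 powr (1 - \<alpha>) * (2 powi k i) powr (\<alpha> - 1))"
  proof (intro prod_mono conjI)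
    fix i
    have "(h $ i) powr (\<alpha> - 1) \<le> (2 powi k i / 2) powr (\<alpha> - 1)"
      using k(2)[of i] \<alpha> by (intro powr_mono2') auto
    also have "\<dots> = 2 powr (1 - \<alpha>) * (2 powi k i) powr (\<alpha> - 1)"
      using powr_minus_divide[of 2 "\<alpha> - 1"] by (simp add: powr_divide)
    finally show "(h $ i) powr (\<alpha> - 1) \<le> 2 powr (1 - \<alpha>) * (2 powi k i) powr (\<alpha> - 1)" .
  qed simp
  also have "\<dots> = (2 powr (1 - \<alpha>)) ^ CARD('n) * (\<Prod>i\<in>UNIV. (2 powi k i) powr (\<alpha> - 1))"
    by (simp add: prod.distrib)
  finally have "ennreal (1 / (\<Prod>i\<in>UNIV. (h $ i) powr (1 - \<alpha>))) \<le> ennreal ((2 powr (1 - \<alpha>)) ^ CARD('n)) * (\<Prod>i\<in>UNIV. ennreal ((2 powi k i) powr (\<alpha> - 1)))"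
    by (simp add: prod_ennreal prod_nonneg ennreal_leI flip: ennreal_mult)
  then have "ennreal (1 / (\<Prod>i\<in>UNIV. (h $ i) powr (1 - \<alpha>))) * (\<integral>\<^sup>+y\<in>cbox (x - h) x. ennreal \<bar>f y\<bar> \<partial>lebesgue)
     \<le> (ennreal ((2 powr (1 - \<alpha>)) ^ CARD('n)) * (\<Prod>i\<in>UNIV. ennreal ((2 powi k i) powr (\<alpha> - 1))))
       * (\<integral>\<^sup>+y. ennreal \<bar>f' (vec_lambda y)\<bar> * (\<Prod>i\<in>UNIV. indicator {x $ i - 2 powi k i..x $ i} (y i)) \<partial>lborel_PiM UNIV)"
    using int by (rule mult_mono) auto
  also have "\<dots> \<le> ennreal ((2 powr (1 - \<alpha>)) ^ CARD('n)) * prod_max UNIV (\<lambda>y. ennreal \<bar>f' (vec_lambda y)\<bar>) (vec_nth x)"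
    unfolding mult.assoc prod_max_def by (intro mult_left_mono SUP_upper[of k UNIV]) auto
  finally show "ennreal (1 / (\<Prod>i\<in>UNIV. (h $ i) powr (1 - \<alpha>))) * (\<integral>\<^sup>+y\<in>cbox (x - h) x. ennreal \<bar>f y\<bar> \<partial>lebesgue)
     \<le> ennreal ((2 powr (1 - \<alpha>)) ^ CARD('n)) * prod_max UNIV (\<lambda>y. ennreal \<bar>f' (vec_lambda y)\<bar>) (vec_nth x)" .
qed

text \<open>The testing argument asks for positivity at every point, hence the value 1 where a Borel
  version fails to be positive.\<close>

lemma weight_representative:
  fixes w :: "real ^ 'n::finite \<Rightarrow> real"
  assumes "weight w"
  obtains w' where "w' \<in> borel_measurable borel" "\<And>x. 0 < w' x" "AE x in lborel. w x = w' x"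
proof -
  have "w \<in> borel_measurable (completion lborel)" using assms by (simp add: weight_def)
  then obtain g where g: "g \<in> borel_measurable borel" "AE x in lborel. w x = g x"
    using completion_ex_borel_measurable_real by fastforce
  have "AE x in lborel. 0 < w x" using assms by (simp add: weight_def AE_completion_iff)
  then have "AE x in lborel. w x = (if 0 < g x then g x else 1)"
    using g(2) by eventually_elim auto
  then show ?thesis using g(1) by (intro that[of "\<lambda>x. if 0 < g x then g x else 1"]) auto
qed

text \<open>The essential supremum bounds almost every slice of \<open>w\<close>, and almost every
  slice of \<open>w\<close> agrees almost everywhere with that of \<open>w'\<close>. This is the
  form that \<open>prod_max_bound\<close> assumes.\<close>

lemma AE_slice_cond:
  fixes w :: "real ^ 'n::finite \<Rightarrow> real"
  assumes w': "AE x in lborel. w x = w' x" and "A_char p q i w < top"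
  shows "AE y in lborel_PiM (UNIV - {i}). one_sided_cond (enn2real (A_char p q i w)) (\<lambda>t. w' (vec_lambda (y(i := t))))"
proof -
  have "AE y in completion (lborel_PiM (UNIV - {i})). A_char_line p q (slice i w y) \<le> A_char p q i w"
    unfolding A_char_def by (rule esssup_AE)
  then have "AE y in lborel_PiM (UNIV - {i}). A_char_line p q (slice i w y) \<le> A_char p q i w"
    by (simp only: AE_completion_iff)
  moreover have "AE y in lborel_PiM (UNIV - {i}). AE t in lborel. w (vec_lambda (y(i := t))) = w' (vec_lambda (y(i := t)))"
  proof (rule AE_PiM_insert(2))
    have "insert i (UNIV - {i}) = UNIV" by auto
    then show "AE y in lborel_PiM (insert i (UNIV - {i})). w (vec_lambda y) = w' (vec_lambda y)"
      using AE_lborel_cart[OF w'] by metis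
  qed auto
  ultimately show ?thesis
  proof eventually_elim
    case (elim y)
    have "slice i w y = (\<lambda>t. w (vec_lambda (y(i := t))))"
      by (simp add: slice_def[abs_def] fun_upd_def)
    then show ?case
      using elim assms(2) by (intro one_sided_cond_A_char_line[of "slice i w y"]) (auto simp: less_top)
  qed
qed

text \<open>One good slice suffices to apply the bound on the line. The result supplies
  \<open>1 \<le> a\<close>, prevents \<open>0 * top\<close> in products of characteristics, and
  keeps the argument of \<psi> where \<psi> is controlled.\<close>

lemma A_char_ge_1:
  fixes w :: "real ^ 'n::finite \<Rightarrow> real"
  assumes "weight w"
  shows "1 \<le> A_char p q i w"
proof (cases "A_char p q i w < top")
  case True
  obtain w' where w': "w' \<in> borel_measurable borel" "\<And>x. 0 < w' x" "AE x in lborel. w x = w' x"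
    using weight_representative[OF assms] by blast
  note [measurable] = w'(1)
  have "\<exists>y \<in> space (lborel_PiM (UNIV - {i})). one_sided_cond (enn2real (A_char p q i w)) (\<lambda>t. w' (vec_lambda (y(i := t))))"
  proof (rule ccontr)
    assume "\<not> ?thesis"
    then have "AE y in lborel_PiM (UNIV - {i}).
        one_sided_cond (enn2real (A_char p q i w)) (\<lambda>t. w' (vec_lambda (y(i := t)))) \<longrightarrow> False"
      by (intro AE_I2) blast
    with AE_slice_cond[OF w'(3) True] have "AE y in lborel_PiM (UNIV - {i}). False"
      by (rule AE_mp)
    then show False using lborel_PiM_not_AE_False[of "UNIV - {i}"] by simp
  qed
  then obtain y where y: "one_sided_cond (enn2real (A_char p q i w)) (\<lambda>t. w' (vec_lambda (y(i := t))))"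
    by blast
  have "(\<lambda>t. vec_lambda (y(i := t))) \<in> borel_measurable borel"
    by (subst borel_measurable_euclidean_space) (auto simp: Basis_cart inner_axis)
  then have "(\<lambda>t. w' (vec_lambda (y(i := t)))) \<in> borel_measurable borel"
    by (rule measurable_compose) simp
  then have "1 \<le> enn2real (A_char p q i w)"
    using y w'(2) by (intro one_sided_cond_ge_1[OF _ _ _ y]) auto
  then have "ennreal 1 \<le> ennreal (enn2real (A_char p q i w))" by (rule ennreal_leI)
  then show ?thesis using True by (simp add: less_top)
qed (simp add: less_top[symmetric])

text \<open>Per coordinate: the loss from enlarging a side, and the \<open>q\<close>-th root of the
  constant on the line.\<close>

definition C_strong :: "nat \<Rightarrow> real" where
  "C_strong n = (2 powr (1 - \<alpha>) * C_line powr (1 / q)) ^ n"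

lemma C_strong_pos: "0 < C_strong n"
  using C_line_pos by (simp add: C_strong_def)

theorem strong_max_bound:
  fixes w f :: "real ^ 'n::finite \<Rightarrow> real"
  assumes w: "weight w" and f: "f \<in> borel_measurable lebesgue"
  shows "weighted_max_norm q \<alpha> w f
    \<le> ennreal (C_strong CARD('n)) * epowr (\<Prod>i\<in>UNIV. A_char p q i w) (dual_exp p / q * (1 - \<alpha>)) * weighted_norm p w f"
proof -
  obtain w' where w': "w' \<in> borel_measurable borel" "\<And>x. 0 < w' x" "AE x in lborel. w x = w' x"
    using weight_representative[OF w] by blast
  obtain f' where f': "f' \<in> borel_measurable borel" "AE x in lborel. f x = f' x"
    using completion_ex_borel_measurable_real[OF f] by auto
  note [measurable] = w'(1) f'(1)
  define F where "F y = ennreal \<bar>f' (vec_lambda y)\<bar>" for y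
  have F_m [measurable]: "F \<in> borel_measurable (lborel_PiM UNIV)" unfolding F_def[abs_def] by measurable
  define W where "W y = w' (vec_lambda y)" for y
  have W_m [measurable]: "W \<in> borel_measurable (lborel_PiM UNIV)" unfolding W_def[abs_def] by measurable
  let ?D = "ennreal ((2 powr (1 - \<alpha>)) ^ CARD('n))"
  let ?A = "\<lambda>i. A_char p q i w"
  define NF where "NF = (\<integral>\<^sup>+x. epowr (F x * ennreal (W x)) p \<partial>lborel_PiM UNIV)"
  have norm_f: "weighted_norm p w f = epowr NF (1 / p)"
  proof -
    have "(\<integral>\<^sup>+x. epowr (ennreal \<bar>w x * f x\<bar>) p \<partial>lebesgue) = (\<integral>\<^sup>+x. epowr (ennreal \<bar>f' x\<bar> * ennreal (w' x)) p \<partial>lborel)"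
      unfolding nn_integral_completion
      by (rule nn_integral_cong_AE, use w'(3) f'(2) in eventually_elim)
         (use w'(2) in \<open>simp add: abs_mult abs_of_pos mult.commute less_imp_le flip: ennreal_mult\<close>)
    also have "\<dots> = NF"
      unfolding NF_def F_def W_def by (rule nn_integral_lborel_cart) simp
    finally show ?thesis by (simp add: weighted_norm_def Lp_norm_def)
  qed
  have "weighted_max_norm q \<alpha> w f \<le> epowr (\<integral>\<^sup>+y. epowr ?D q * (ennreal (W y powr q) * epowr (prod_max UNIV F y) q) \<partial>lborel_PiM UNIV) (1 / q)"
    (is "_ \<le> epowr ?R (1 / q)")
  proof -
    have "(\<integral>\<^sup>+x. epowr (ennreal \<bar>w x\<bar> * strong_frac_max \<alpha> f x) q \<partial>lebesgue)
      \<le> (\<integral>\<^sup>+x. epowr ?D q * (ennreal (w' x powr q) * epowr (prod_max UNIV F (vec_nth x)) q) \<partial>lborel)"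
      unfolding nn_integral_completion
    proof (rule nn_integral_mono_AE, use w'(3) in eventually_elim)
      case (elim x)
      have "epowr (ennreal \<bar>w x\<bar> * strong_frac_max \<alpha> f x) q \<le> epowr (ennreal (w' x) * (?D * prod_max UNIV F (vec_nth x))) q"
        using q_pos w'(2)[of x] elim strong_frac_max_le_prod_max[OF f', of x]
        by (intro epowr_mono mult_mono) (auto simp: F_def[abs_def])
      then show ?case
        using w'(2)[of x] by (simp add: epowr_mult epowr_ennreal[of "w' x"] mult_ac)
    qed
    also have "\<dots> = (\<integral>\<^sup>+y. epowr ?D q * (ennreal (w' (vec_lambda y) powr q) * epowr (prod_max UNIV F (vec_nth (vec_lambda y))) q) \<partial>lborel_PiM UNIV)"
      using measurable_compose[OF vec_nth_measurable prod_max_measurable[OF F_m]]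
      by (intro nn_integral_lborel_cart) measurable
    finally show ?thesis
      unfolding weighted_max_norm_def Lp_norm_def W_def using q_pos by (intro epowr_mono) (auto simp: vec_lambda_inverse)
  qed
  also have "\<dots> \<le> ennreal (C_strong CARD('n)) * epowr (\<Prod>i\<in>UNIV. ?A i) (dual_exp p / q * (1 - \<alpha>)) * epowr NF (1 / p)"
  proof (cases "\<forall>i. ?A i < top")
    case True
    define a where "a i = enn2real (?A i)" for i
    have a: "?A i = ennreal (a i)" for i using True by (simp add: a_def less_top)
    have a1: "1 \<le> a i" for i using A_char_ge_1[OF w, of i] unfolding a by (cases "a i \<ge> 0") (auto simp: ennreal_neg)
    have "?R = epowr ?D q * (\<integral>\<^sup>+y. ennreal (W y powr q) * epowr (prod_max UNIV F y) q \<partial>lborel_PiM UNIV)"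
      by (rule nn_integral_cmult) measurable
    also have "\<dots> \<le> epowr ?D q * ((\<Prod>i\<in>UNIV. ennreal (C_line * a i powr \<tau>)) * epowr NF (q / p))"
      unfolding NF_def
    proof (intro mult_left_mono prod_max_bound)
      fix i
      show "AE y in lborel_PiM (UNIV - {i}). one_sided_cond (a i) (\<lambda>t. W (y(i := t)))"
        using AE_slice_cond[OF w'(3), of i] True unfolding W_def a_def by blast
    qed (use w' a1 W_def in auto)
    finally have "epowr ?R (1 / q) \<le> epowr (epowr ?D q * ((\<Prod>i\<in>UNIV. ennreal (C_line * a i powr \<tau>)) * epowr NF (q / p))) (1 / q)"
      using q_pos by (intro epowr_mono) auto
    also have "\<dots> = (?D * (\<Prod>i\<in>(UNIV :: 'n set). ennreal ((C_line * a i powr \<tau>) powr (1 / q)))) * epowr NF (1 / p)"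
      using q_pos C_line_pos by (simp add: epowr_mult epowr_epowr epowr_prod epowr_ennreal powr_powr mult.assoc)
    also have "?D * (\<Prod>i\<in>(UNIV :: 'n set). ennreal ((C_line * a i powr \<tau>) powr (1 / q)))
      = ennreal (C_strong CARD('n)) * epowr (\<Prod>i\<in>UNIV. ?A i) (dual_exp p / q * (1 - \<alpha>))"
    proof -
      have "\<tau> * (1 / q) = dual_exp p / q * (1 - \<alpha>)"
        using \<tau>_beta q_pos by (metis nonzero_mult_div_cancel_right order_less_irrefl times_divide_eq_right mult_1_right)
      then have "(C_line * a i powr \<tau>) powr (1 / q) = C_line powr (1 / q) * a i powr (dual_exp p / q * (1 - \<alpha>))" for i
        using C_line_pos a1[of i] by (simp only: powr_mult powr_powr)
      moreover have "0 \<le> a i" for i using a1[of i] by simp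
      ultimately show ?thesis
        unfolding a using C_line_pos
        by (simp add: epowr_prod epowr_ennreal C_strong_def ennreal_mult prod.distrib power_mult_distrib mult.assoc ennreal_power)
    qed
    finally show ?thesis .
  next
    case False
    \<comment> \<open>One infinite characteristic makes the product infinite, the others being at
      least 1. The right side is then \<open>top\<close>, unless \<open>w f\<close> vanishes almost
      everywhere and both sides are 0.\<close>
    then obtain i where i: "?A i = top" by (meson less_top)
    have "(\<Prod>i\<in>UNIV. ?A i) = top"
    proof -
      have "(\<Prod>j\<in>UNIV - {i}. ?A j) \<noteq> 0"
        using A_char_ge_1[OF w] by (auto dest: spec[where P="\<lambda>i. 1 \<le> ?A i"] simp: prod_zero_iff) (metis not_one_le_zero)
      then show ?thesis
        using i by (subst prod.remove[of UNIV i]) (auto simp: ennreal_top_mult)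
    qed
    show ?thesis
    proof (cases "NF = 0")
      case True
      have F0: "AE x in lborel_PiM UNIV. F x = 0"
      proof -
        have "AE x in lborel_PiM UNIV. epowr (F x * ennreal (W x)) p = 0"
          using True unfolding NF_def by (subst (asm) nn_integral_0_iff_AE) auto
        then show ?thesis
        proof eventually_elim
          case (elim x)
          have "ennreal (W x) \<noteq> 0" using w'(2)[of "vec_lambda x"] by (simp add: W_def)
          then show ?case using elim by simp
        qed
      qed
      have "(\<integral>\<^sup>+y. F y * (\<Prod>i\<in>UNIV. indicator {x i - 2 powi k i..x i} (y i)) \<partial>lborel_PiM UNIV) = (\<integral>\<^sup>+y. 0 \<partial>lborel_PiM (UNIV :: 'n set))"
        for x :: "'n \<Rightarrow> real" and k :: "'n \<Rightarrow> int"
        by (rule nn_integral_cong_AE, use F0 in eventually_elim) simp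
      then have "prod_max UNIV F y = 0" for y
        by (simp add: prod_max_def)
      then show ?thesis by simp
    next
      case False
      then show ?thesis
        using \<open>(\<Prod>i\<in>UNIV. ?A i) = top\<close> C_strong_pos[of "CARD('n)"]
        by (simp add: ennreal_mult_top ennreal_top_mult ennreal_eq_0_iff)
    qed
  qed
  finally show ?thesis by (simp add: norm_f)
qed

end

subsection \<open>Power weights\<close>

lemma nn_integral_powr_interval:
  assumes "0 < c" "0 \<le> b"
  shows "(\<integral>\<^sup>+t. ennreal (t powr (c - 1)) * indicator {0<..<b} t \<partial>lborel) = ennreal (b powr c / c)"
proof -
  have eq: "{t. 0 < t \<and> ennreal t < ennreal b} = {0<..<b}"
    using assms(2) by (auto simp: ennreal_less_iff)
  have "ennreal c * (\<integral>\<^sup>+t. ennreal (t powr (c - 1)) * indicator {0<..<b} t \<partial>lborel)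
      = (\<integral>\<^sup>+t. ennreal (c * t powr (c - 1)) * indicator {0<..<b} t \<partial>lborel)"
    using assms(1) by (subst nn_integral_cmult[symmetric]) (auto simp: ennreal_mult mult.assoc)
  also have "\<dots> = ennreal (b powr c)"
    using epowr_layer_cake[OF assms(1), of "ennreal b"] assms by (simp add: eq epowr_ennreal)
  finally have "ennreal (1 / c) * (ennreal c * (\<integral>\<^sup>+t. ennreal (t powr (c - 1)) * indicator {0<..<b} t \<partial>lborel)) = ennreal (1 / c) * ennreal (b powr c)"
    by simp
  then show ?thesis
    using assms by (simp add: mult.assoc[symmetric] flip: ennreal_mult)
qed

lemma nn_integral_prod_cart:
  assumes [measurable]: "\<And>i. g i \<in> borel_measurable borel"
  shows "(\<integral>\<^sup>+x. (\<Prod>i\<in>UNIV. g i (x $ i)) \<partial>(lborel :: (real ^ 'n::finite) measure)) = (\<Prod>i\<in>UNIV. \<integral>\<^sup>+t. g i t \<partial>lborel)"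
proof -
  have "(\<integral>\<^sup>+x. (\<Prod>i\<in>UNIV. g i (x $ i)) \<partial>(lborel :: (real ^ 'n) measure))
      = (\<integral>\<^sup>+y. (\<Prod>i\<in>UNIV. g i (vec_lambda y $ i)) \<partial>lborel_PiM UNIV)"
    by (rule nn_integral_lborel_cart) measurable
  also have "\<dots> = (\<integral>\<^sup>+y. (\<Prod>i\<in>UNIV. g i (y i)) \<partial>lborel_PiM UNIV)"
    by simp
  also have "\<dots> = (\<Prod>i\<in>UNIV. \<integral>\<^sup>+t. g i t \<partial>lborel)"
    by (rule lborel_product.product_nn_integral_prod) auto
  finally show ?thesis .
qed

lemma indicator_cbox_cart:
  fixes x l u :: "real ^ 'n::finite"
  shows "indicator (cbox l u) x = (\<Prod>i\<in>UNIV. indicator {l $ i..u $ i} (x $ i) :: ennreal)"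
proof (cases "x \<in> cbox l u")
  case True
  then have "(\<Prod>i\<in>UNIV. indicator {l $ i..u $ i} (x $ i) :: ennreal) = 1"
    by (intro prod.neutral) (auto simp: mem_box_cart)
  then show ?thesis using True by simp
next
  case False
  then obtain i where "x $ i \<notin> {l $ i..u $ i}" by (auto simp: mem_box_cart)
  then have "(\<Prod>i\<in>UNIV. indicator {l $ i..u $ i} (x $ i) :: ennreal) = 0"
    by (intro prod_zero bexI[of _ i]) auto
  then show ?thesis using False by simp
qed

lemma nn_integral_prod_cbox:
  fixes l u :: "real ^ 'n::finite"
  assumes [measurable]: "g \<in> borel_measurable borel"
  shows "(\<integral>\<^sup>+x\<in>cbox l u. (\<Prod>i\<in>UNIV. g (x $ i)) \<partial>lborel) = (\<Prod>i\<in>UNIV. \<integral>\<^sup>+t\<in>{l $ i..u $ i}. g t \<partial>lborel)"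
  unfolding indicator_cbox_cart prod.distrib[symmetric] by (rule nn_integral_prod_cart) measurable

text \<open>The power \<open>q / dual_exp p\<close> balances the two homogeneities. It is needed
  because a slice of a product weight is a multiple of one factor.\<close>

lemma A_char_line_scale:
  assumes "0 < c" "\<And>t. 0 < v t" and [measurable]: "v \<in> borel_measurable borel" and "1 < p" "0 < q"
  shows "A_char_line p q (\<lambda>t. c * v t) = A_char_line p q v"
proof -
  have p': "0 < dual_exp p" using assms by (simp add: dual_exp_def)
  have [measurable]: "{a..b} \<in> sets borel" for a b :: real by simp
  have U: "(\<integral>\<^sup>+t\<in>{a..b}. ennreal ((c * v t) powr r) \<partial>lebesgue) = ennreal (c powr r) * (\<integral>\<^sup>+t\<in>{a..b}. ennreal (v t powr r) \<partial>lebesgue)" for a b r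
    unfolding nn_integral_completion using assms(1,2)[THEN less_imp_le]
    by (subst nn_integral_cmult[symmetric]) (auto simp: powr_mult ennreal_mult mult.assoc)
  have one: "ennreal (c powr q) * epowr (ennreal (c powr (- dual_exp p))) (q / dual_exp p) = 1"
    using assms(1) p' by (simp add: epowr_ennreal powr_powr flip: ennreal_mult powr_add)
  have "(ennreal (1 / h) * (ennreal (c powr q) * X)) * epowr (ennreal (1 / h) * (ennreal (c powr (- dual_exp p)) * Y)) (q / dual_exp p)
      = (ennreal (c powr q) * epowr (ennreal (c powr (- dual_exp p))) (q / dual_exp p)) * ((ennreal (1 / h) * X) * epowr (ennreal (1 / h) * Y) (q / dual_exp p))" for h X Y
    by (simp add: epowr_mult mult_ac)
  then show ?thesis unfolding A_char_line_def U one by simp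
qed

locale power_weight = frac_exponents +
  fixes \<epsilon> :: real
  assumes \<epsilon>: "0 < \<epsilon>" "\<epsilon> < 1"
begin

definition "\<gamma> = (1 - \<epsilon>) / dual_exp p"

text \<open>The value at 0 serves only positivity. As \<epsilon> tends to 0,
  \<open>v powr (- dual_exp p)\<close> approaches the non-integrable \<open>1 / abs t\<close>, and
  the characteristic blows up.\<close>

definition v :: "real \<Rightarrow> real" where
  "v t = (if t = 0 then 1 else \<bar>t\<bar> powr \<gamma>)"

text \<open>On the open unit interval this is \<open>v powr (- dual_exp p)\<close>, for which
  Hoelder's inequality is an equality.\<close>

definition \<phi> :: "real \<Rightarrow> real" where
  "\<phi> t = (if 0 < t \<and> t < 1 then t powr (\<epsilon> - 1) else 0)"

definition w :: "real ^ 'n::finite \<Rightarrow> real" where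
  "w x = (\<Prod>i\<in>UNIV. v (x $ i))"

definition f :: "real ^ 'n::finite \<Rightarrow> real" where
  "f x = (\<Prod>i\<in>UNIV. \<phi> (x $ i))"

lemma \<gamma>_pos: "0 < \<gamma>"
  using \<epsilon> p' by (simp add: \<gamma>_def)

lemma measurable_v [measurable]: "v \<in> borel_measurable borel" "\<phi> \<in> borel_measurable borel"
  unfolding v_def[abs_def] \<phi>_def[abs_def] by measurable

lemma measurable_w [measurable]: "w \<in> borel_measurable borel" "f \<in> borel_measurable borel"
  unfolding w_def[abs_def] f_def[abs_def] by measurable

lemma v_pos: "0 < v t"
  by (simp add: v_def)

lemma w_pos: "0 < w x"
  by (simp add: w_def v_pos prod_pos)

lemma \<phi>_nonneg: "0 \<le> \<phi> t"
  by (simp add: \<phi>_def)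

lemma f_nonneg: "0 \<le> f x"
  by (simp add: f_def \<phi>_nonneg prod_nonneg)

lemma v_powr_q: "t \<noteq> 0 \<Longrightarrow> v t powr q = \<bar>t\<bar> powr ((1 - \<epsilon>) * \<rho>)"
  by (simp add: v_def powr_powr \<gamma>_def \<rho>_def)

lemma v_powr_dual: "t \<noteq> 0 \<Longrightarrow> v t powr (- dual_exp p) = \<bar>t\<bar> powr (\<epsilon> - 1)"
  using p' by (simp add: v_def powr_powr \<gamma>_def)

lemma nn_integral_abs_powr:
  assumes "0 \<le> b"
  shows "(\<integral>\<^sup>+t\<in>{- b..b}. ennreal (v t powr (- dual_exp p)) \<partial>lborel) \<le> ennreal (2 * b powr \<epsilon> / \<epsilon>)"
proof -
  let ?g = "\<lambda>t. ennreal (t powr (\<epsilon> - 1)) * indicator {0<..<b} t"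
  have "AE t in lborel. t \<noteq> 0 \<and> t \<noteq> b \<and> t \<noteq> - b"
    using AE_lborel_singleton[of 0] AE_lborel_singleton[of b] AE_lborel_singleton[of "- b"] by auto
  then have "(\<integral>\<^sup>+t\<in>{- b..b}. ennreal (v t powr (- dual_exp p)) \<partial>lborel) \<le> (\<integral>\<^sup>+t. ?g t + ?g (0 + (-1) * t) \<partial>lborel)"
    by (intro nn_integral_mono_AE, elim eventually_mono) (auto simp: v_powr_dual indicator_def)
  also have "\<dots> = (\<integral>\<^sup>+t. ?g t \<partial>lborel) + (\<integral>\<^sup>+t. ?g (0 + (-1) * t) \<partial>lborel)"
    by (rule nn_integral_add) measurable
  also have "(\<integral>\<^sup>+t. ?g (0 + (-1) * t) \<partial>lborel) = (\<integral>\<^sup>+t. ?g t \<partial>lborel)"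
    by (subst nn_integral_real_affine[of ?g "-1" 0]) (auto simp del: mult_minus1)
  also have "(\<integral>\<^sup>+t. ?g t \<partial>lborel) = ennreal (b powr \<epsilon> / \<epsilon>)"
    using \<epsilon> assms by (intro nn_integral_powr_interval) auto
  also have "ennreal (b powr \<epsilon> / \<epsilon>) + ennreal (b powr \<epsilon> / \<epsilon>) = ennreal (2 * b powr \<epsilon> / \<epsilon>)"
    using \<epsilon> by (simp flip: ennreal_plus)
  finally show ?thesis .
qed

text \<open>The 6 is a factor 2 for the two sides of the origin times a factor 3 for the radius
  \<open>3 * h\<close>; integrating \<open>t powr (\<epsilon> - 1)\<close> gives
  \<open>1 / \<epsilon>\<close>.\<close>

definition K :: real where "K = (6 / \<epsilon>) powr \<rho>"

lemma nn_integral_le_const: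
  fixes a b :: real
  assumes "AE t in lborel. t \<in> {a..b} \<longrightarrow> g t \<le> c" "a \<le> b" "0 \<le> c"
  shows "(\<integral>\<^sup>+t\<in>{a..b}. ennreal (g t) \<partial>lborel) \<le> ennreal ((b - a) * c)"
proof -
  have "(\<integral>\<^sup>+t\<in>{a..b}. ennreal (g t) \<partial>lborel) \<le> (\<integral>\<^sup>+t. ennreal c * indicator {a..b} t \<partial>lborel)"
    by (rule nn_integral_mono_AE, use assms(1) in eventually_elim) (auto simp: indicator_def ennreal_leI)
  also have "\<dots> = ennreal ((b - a) * c)"
    using assms by (simp add: nn_integral_cmult_indicator mult.commute flip: ennreal_mult)
  finally show ?thesis .
qed

text \<open>If \<open>2 * h \<le> \<bar>x\<bar>\<close>, both intervals stay between
  \<open>\<bar>x\<bar> / 2\<close> and \<open>3 / 2 * \<bar>x\<bar>\<close> in absolute value, and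
  the ratio 3 bounds everything. Otherwise they lie within \<open>3 * h\<close> of the origin, where
  the singularity is integrated.\<close>

lemma A_char_line_v: "A_char_line p q v \<le> ennreal K"
  unfolding A_char_line_def
proof (rule SUP_least)
  fix xh :: "real \<times> real" assume "xh \<in> UNIV \<times> {0<..}"
  then obtain x h where xh: "xh = (x, h)" and h: "0 < h" by auto
  let ?U = "\<integral>\<^sup>+t\<in>{x..x + h}. ennreal (v t powr q) \<partial>lebesgue"
  let ?S = "\<integral>\<^sup>+t\<in>{x - h..x}. ennreal (v t powr (- dual_exp p)) \<partial>lebesgue"
  have ne: "AE t in lborel. t \<noteq> (0::real)" by (rule AE_lborel_singleton)
  have e\<rho>: "0 \<le> (1 - \<epsilon>) * \<rho>" using \<epsilon> \<rho>_pos by simp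
  have mono_bound: "(ennreal (1 / h) * ?U) * epowr (ennreal (1 / h) * ?S) \<rho> \<le> ennreal (1 / h * U * (1 / h * S) powr \<rho>)"
    if "?U \<le> ennreal U" "?S \<le> ennreal S" "0 \<le> U" "0 \<le> S" for U S
  proof -
    have "(ennreal (1 / h) * ?U) * epowr (ennreal (1 / h) * ?S) \<rho> \<le> (ennreal (1 / h) * ennreal U) * epowr (ennreal (1 / h) * ennreal S) \<rho>"
      using that \<rho>_pos by (intro mult_mono epowr_mono mult_left_mono) auto
    also have "\<dots> = ennreal (1 / h * U * (1 / h * S) powr \<rho>)"
      using that h by (simp add: epowr_ennreal flip: ennreal_mult)
    finally show ?thesis .
  qed
  have "(ennreal (1 / h) * ?U) * epowr (ennreal (1 / h) * ?S) \<rho> \<le> ennreal K"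
  proof (cases "\<bar>x\<bar> \<ge> 2 * h")
    case True
    then have x: "0 < \<bar>x\<bar>" using h by linarith
    have "?U \<le> ennreal ((x + h - x) * (3 / 2 * \<bar>x\<bar>) powr ((1 - \<epsilon>) * \<rho>))"
      unfolding nn_integral_completion
    proof (rule nn_integral_le_const, use ne in eventually_elim)
      case (elim t)
      then show ?case
        using True h e\<rho> by (auto simp: v_powr_q intro!: powr_mono2)
    qed (use h in auto)
    moreover have "?S \<le> ennreal ((x - (x - h)) * (\<bar>x\<bar> / 2) powr (\<epsilon> - 1))"
      unfolding nn_integral_completion
    proof (rule nn_integral_le_const, use ne in eventually_elim)
      case (elim t)
      then show ?case
        using True h \<epsilon> x by (auto simp: v_powr_dual intro!: powr_mono2')
    qed (use h in auto)
    ultimately have "(ennreal (1 / h) * ?U) * epowr (ennreal (1 / h) * ?S) \<rho>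
      \<le> ennreal (1 / h * ((x + h - x) * (3 / 2 * \<bar>x\<bar>) powr ((1 - \<epsilon>) * \<rho>)) * (1 / h * ((x - (x - h)) * (\<bar>x\<bar> / 2) powr (\<epsilon> - 1))) powr \<rho>)"
      using h by (intro mono_bound) auto
    also have "\<dots> = ennreal ((3 / 2 * \<bar>x\<bar>) powr ((1 - \<epsilon>) * \<rho>) * (\<bar>x\<bar> / 2) powr ((\<epsilon> - 1) * \<rho>))"
      using h by (simp add: powr_powr)
    also have "(3 / 2 * \<bar>x\<bar>) powr ((1 - \<epsilon>) * \<rho>) = 3 powr ((1 - \<epsilon>) * \<rho>) * (\<bar>x\<bar> / 2) powr ((1 - \<epsilon>) * \<rho>)"
      using powr_mult[of 3 "\<bar>x\<bar> / 2" "(1 - \<epsilon>) * \<rho>"] by simp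
    also have "\<dots> * (\<bar>x\<bar> / 2) powr ((\<epsilon> - 1) * \<rho>) = 3 powr ((1 - \<epsilon>) * \<rho>)"
      using x by (simp add: mult.assoc powr_add[symmetric] algebra_simps)
    also have "3 powr ((1 - \<epsilon>) * \<rho>) \<le> 3 powr \<rho>"
      using \<epsilon> \<rho>_pos by (intro powr_mono) (auto simp: algebra_simps)
    also have "3 powr \<rho> \<le> K"
      unfolding K_def using \<epsilon> \<rho>_pos by (intro powr_mono2) (auto simp: field_simps)
    finally show ?thesis by (simp add: ennreal_leI)
  next
    case False
    have "?U \<le> ennreal ((x + h - x) * (3 * h) powr ((1 - \<epsilon>) * \<rho>))"
      unfolding nn_integral_completion
    proof (rule nn_integral_le_const, use ne in eventually_elim)
      case (elim t)
      then show ?case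
        using False h e\<rho> by (auto simp: v_powr_q intro!: powr_mono2)
    qed (use h in auto)
    moreover have "?S \<le> ennreal (2 * (3 * h) powr \<epsilon> / \<epsilon>)"
    proof -
      have "{x - h..x} \<subseteq> {- (3 * h)..3 * h}" using False h by auto
      then have "?S \<le> (\<integral>\<^sup>+t\<in>{- (3 * h)..3 * h}. ennreal (v t powr (- dual_exp p)) \<partial>lborel)"
        unfolding nn_integral_completion by (intro nn_integral_mono) (auto simp: indicator_def)
      also have "\<dots> \<le> ennreal (2 * (3 * h) powr \<epsilon> / \<epsilon>)"
        using h by (intro nn_integral_abs_powr) auto
      finally show ?thesis .
    qed
    ultimately have "(ennreal (1 / h) * ?U) * epowr (ennreal (1 / h) * ?S) \<rho>
      \<le> ennreal (1 / h * ((x + h - x) * (3 * h) powr ((1 - \<epsilon>) * \<rho>)) * (1 / h * (2 * (3 * h) powr \<epsilon> / \<epsilon>)) powr \<rho>)"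
      using h \<epsilon> by (intro mono_bound) auto
    also have "1 / h * ((x + h - x) * (3 * h) powr ((1 - \<epsilon>) * \<rho>)) * (1 / h * (2 * (3 * h) powr \<epsilon> / \<epsilon>)) powr \<rho> = K"
    proof -
      have "1 / h * (2 * (3 * h) powr \<epsilon> / \<epsilon>) = (6 / \<epsilon>) * (3 * h) powr (\<epsilon> - 1)"
        using h by (simp add: powr_diff field_simps)
      then have "(1 / h * (2 * (3 * h) powr \<epsilon> / \<epsilon>)) powr \<rho> = K * (3 * h) powr ((\<epsilon> - 1) * \<rho>)"
        using h \<epsilon> by (simp only: powr_mult powr_powr K_def)
      moreover have "(3 * h) powr ((1 - \<epsilon>) * \<rho>) * (3 * h) powr ((\<epsilon> - 1) * \<rho>) = 1"
        using h by (simp add: powr_add[symmetric] algebra_simps)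
      ultimately show ?thesis using h by simp
    qed
    finally show ?thesis .
  qed
  then show "(case xh of (x, h) \<Rightarrow>
      (ennreal (1 / h) * (\<integral>\<^sup>+t\<in>{x..x + h}. ennreal (v t powr q) \<partial>lebesgue)) *
      epowr (ennreal (1 / h) * (\<integral>\<^sup>+t\<in>{x - h..x}. ennreal (v t powr (- dual_exp p)) \<partial>lebesgue)) (q / dual_exp p)) \<le> ennreal K"
    by (simp add: xh \<rho>_def)
qed

lemma A_char_w: "A_char p q i (w :: real ^ 'n::finite \<Rightarrow> real) \<le> ennreal K"
proof -
  have "A_char_line p q (slice i w y) = A_char_line p q v" for y
  proof -
    have "slice i w y = (\<lambda>t. (\<Prod>j\<in>UNIV - {i}. v (y j)) * v t)"
    proof
      fix t
      have "slice i w y t = v t * (\<Prod>j\<in>UNIV - {i}. v (if j = i then t else y j))"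
        unfolding slice_def w_def by (subst prod.remove[of UNIV i]) auto
      also have "(\<Prod>j\<in>UNIV - {i}. v (if j = i then t else y j)) = (\<Prod>j\<in>UNIV - {i}. v (y j))"
        by (rule prod.cong) auto
      finally show "slice i w y t = (\<Prod>j\<in>UNIV - {i}. v (y j)) * v t" by simp
    qed
    then show ?thesis
      using p q_pos by (simp add: A_char_line_scale v_pos prod_pos)
  qed
  then show ?thesis
    unfolding A_char_def using A_char_line_v by (intro esssup_I) auto
qed

lemma weight_w: "weight (w :: real ^ 'n::finite \<Rightarrow> real)"
  unfolding weight_def
proof (intro conjI allI impI)
  show "(w :: real ^ 'n \<Rightarrow> real) \<in> borel_measurable lebesgue" by (intro measurable_completion) simp
  show "AE x::real ^ 'n in lebesgue. 0 < w x" by (simp add: w_pos)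
  fix C :: "(real ^ 'n) set" assume C: "compact C"
  obtain R where R: "0 < R" "\<And>x. x \<in> C \<Longrightarrow> norm x \<le> R"
    using compact_imp_bounded[OF C] by (auto simp: bounded_pos)
  have bound: "w x \<le> (1 + R) ^ CARD('n)" if "x \<in> C" for x
  proof -
    have "v (x $ i) \<le> 1 + R" for i
    proof -
      have "\<bar>x $ i\<bar> \<le> R" using R(2)[OF that] component_le_norm_cart[of x i] by linarith
      then have "\<bar>x $ i\<bar> powr \<gamma> \<le> (1 + R) powr \<gamma>" using \<gamma>_pos R by (intro powr_mono2) auto
      also have "\<dots> \<le> (1 + R) powr 1"
        using R \<epsilon> p' by (intro powr_mono) (auto simp: \<gamma>_def divide_le_eq)
      finally show ?thesis using R by (simp add: v_def)
    qed
    then have "w x \<le> (\<Prod>i\<in>(UNIV :: 'n set). 1 + R)"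
      unfolding w_def using v_pos less_imp_le by (intro prod_mono) auto
    then show ?thesis by simp
  qed
  have [measurable]: "C \<in> sets borel" using C by (simp add: borel_compact)
  have "integrable lborel (\<lambda>x. indicator C x *\<^sub>R w x)"
  proof (rule integrableI_bounded)
    show "(\<lambda>x. indicator C x *\<^sub>R w x) \<in> borel_measurable lborel" by measurable
    have "(\<integral>\<^sup>+x. ennreal (norm (indicator C x *\<^sub>R w x)) \<partial>lborel) \<le> (\<integral>\<^sup>+x. ennreal ((1 + R) ^ CARD('n)) * indicator C x \<partial>lborel)"
      using bound w_pos less_imp_le by (intro nn_integral_mono) (auto simp: indicator_def abs_of_pos[OF w_pos] ennreal_leI)
    also have "\<dots> < \<infinity>"
      using emeasure_compact_finite[OF C] by (simp add: nn_integral_cmult_indicator ennreal_mult_less_top)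
    finally show "(\<integral>\<^sup>+x. ennreal (norm (indicator C x *\<^sub>R w x)) \<partial>lborel) < \<infinity>" .
  qed
  then show "set_integrable lebesgue C w"
    unfolding set_integrable_def by (rule integrable_completion[THEN iffD2, rotated]) measurable
qed

text \<open>Averages of a product weight over boxes factor, so the strong condition reduces to one
  variable in each coordinate.\<close>

lemma w_strong_A: "(w :: real ^ 'n::finite \<Rightarrow> real) \<in> strong_A p q"
proof -
  have bound: "epowr (ennreal (1 / (\<Prod>i\<in>UNIV. h $ i)) * (\<integral>\<^sup>+y\<in>cbox x (x + h). ennreal (w y powr q) \<partial>lebesgue)) (1 / q) *
        epowr (ennreal (1 / (\<Prod>i\<in>UNIV. h $ i)) * (\<integral>\<^sup>+y\<in>cbox (x - h) x. ennreal (w y powr (- dual_exp p)) \<partial>lebesgue)) (1 / dual_exp p)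
      \<le> ennreal (K powr (1 / q)) ^ CARD('n)" if "h \<in> pos_vecs" for x h :: "real ^ 'n"
  proof -
    have h: "0 < h $ i" for i using that by (simp add: pos_vecs_def)
    have int: "ennreal (1 / (\<Prod>i\<in>UNIV. h $ i)) * (\<integral>\<^sup>+y\<in>cbox l u. ennreal (w y powr r) \<partial>lebesgue)
      = (\<Prod>i\<in>UNIV. ennreal (1 / h $ i) * (\<integral>\<^sup>+t\<in>{l $ i..u $ i}. ennreal (v t powr r) \<partial>lebesgue))" for l u :: "real ^ 'n" and r
    proof -
      have "ennreal (w y powr r) = (\<Prod>i\<in>UNIV. ennreal (v (y $ i) powr r))" for y :: "real ^ 'n"
        by (simp add: w_def prod_powr_distrib v_pos less_imp_le prod_ennreal)
      moreover have "ennreal (1 / (\<Prod>i\<in>UNIV. h $ i)) = (\<Prod>i\<in>UNIV. ennreal (1 / h $ i))"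
        using h by (simp add: prod_ennreal prod_dividef less_imp_le)
      ultimately show ?thesis
        by (simp add: nn_integral_completion nn_integral_prod_cbox[where g = "\<lambda>t. ennreal (v t powr r)"] prod.distrib)
    qed
    have "epowr (ennreal (1 / h $ i) * (\<integral>\<^sup>+t\<in>{x $ i..(x + h) $ i}. ennreal (v t powr q) \<partial>lebesgue)) (1 / q) *
       epowr (ennreal (1 / h $ i) * (\<integral>\<^sup>+t\<in>{(x - h) $ i..x $ i}. ennreal (v t powr (- dual_exp p)) \<partial>lebesgue)) (1 / dual_exp p)
       \<le> ennreal (K powr (1 / q))" (is "epowr ?U _ * epowr ?S _ \<le> _") for i
    proof -
      have "?U * epowr ?S (q / dual_exp p) \<le> A_char_line p q v"
        unfolding A_char_line_def using h[of i] by (intro SUP_upper2[of "(x $ i, h $ i)"]) auto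
      also have "\<dots> \<le> ennreal K" by (rule A_char_line_v)
      finally have "epowr (?U * epowr ?S (q / dual_exp p)) (1 / q) \<le> epowr (ennreal K) (1 / q)"
        using q_pos by (intro epowr_mono) auto
      then show ?thesis
        using q_pos by (simp add: epowr_mult epowr_epowr epowr_ennreal K_def)
    qed
    then have "(\<Prod>i\<in>UNIV. epowr (ennreal (1 / h $ i) * (\<integral>\<^sup>+t\<in>{x $ i..(x + h) $ i}. ennreal (v t powr q) \<partial>lebesgue)) (1 / q) *
       epowr (ennreal (1 / h $ i) * (\<integral>\<^sup>+t\<in>{(x - h) $ i..x $ i}. ennreal (v t powr (- dual_exp p)) \<partial>lebesgue)) (1 / dual_exp p))
       \<le> (\<Prod>i\<in>(UNIV :: 'n set). ennreal (K powr (1 / q)))"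
      by (intro prod_mono_ennreal)
    then show ?thesis
      unfolding int epowr_prod prod.distrib[symmetric] by simp
  qed
  have "(SUP (x, h) \<in> (UNIV :: (real ^ 'n) set) \<times> pos_vecs.
       epowr (ennreal (1 / (\<Prod>i\<in>UNIV. h $ i)) * (\<integral>\<^sup>+y\<in>cbox x (x + h). ennreal (w y powr q) \<partial>lebesgue)) (1 / q) *
        epowr (ennreal (1 / (\<Prod>i\<in>UNIV. h $ i)) * (\<integral>\<^sup>+y\<in>cbox (x - h) x. ennreal (w y powr (- dual_exp p)) \<partial>lebesgue)) (1 / dual_exp p))
     \<le> ennreal (K powr (1 / q)) ^ CARD('n)"
    using bound by (intro SUP_least) auto
  also have "\<dots> < \<infinity>"
    by (simp add: ennreal_power)
  finally show ?thesis
    using weight_w by (simp add: strong_A_def)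
qed

text \<open>Here \<open>(\<gamma> + (\<epsilon> - 1)) * p = \<epsilon> - 1\<close>, so each
  coordinate contributes the integral \<open>1 / \<epsilon>\<close>.\<close>

lemma norm_f: "weighted_norm p w (f :: real ^ 'n::finite \<Rightarrow> real) = ennreal ((1 / \<epsilon>) powr (CARD('n) / p))"
proof -
  have "(\<integral>\<^sup>+x. epowr (ennreal \<bar>w x * f x\<bar>) p \<partial>(lebesgue :: (real ^ 'n) measure))
      = (\<integral>\<^sup>+x. (\<Prod>i\<in>UNIV. ennreal ((x $ i) powr (\<epsilon> - 1)) * indicator {0<..<1} (x $ i)) \<partial>(lborel :: (real ^ 'n) measure))"
    unfolding nn_integral_completion
  proof (rule nn_integral_cong)
    fix x :: "real ^ 'n"
    have one: "(v t * \<phi> t) powr p = t powr (\<epsilon> - 1) * indicator {0<..<1} t" for t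
    proof (cases "0 < t \<and> t < 1")
      case True
      have "\<gamma> * p = (1 - \<epsilon>) * (p - 1)"
        using p by (simp add: \<gamma>_def dual_exp_def)
      then have "(\<gamma> + (\<epsilon> - 1)) * p = \<epsilon> - 1"
        by (simp add: algebra_simps)
      then show ?thesis
        using True by (simp add: v_def \<phi>_def powr_add[symmetric] powr_powr)
    qed (use p in \<open>auto simp: \<phi>_def\<close>)
    have "epowr (ennreal \<bar>w x * f x\<bar>) p = ennreal ((\<Prod>i\<in>UNIV. v (x $ i) * \<phi> (x $ i)) powr p)"
      using w_pos[of x] f_nonneg[of x] by (simp add: epowr_ennreal w_def f_def prod.distrib abs_mult)
    also have "\<dots> = ennreal (\<Prod>i\<in>UNIV. (v (x $ i) * \<phi> (x $ i)) powr p)"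
      using v_pos \<phi>_nonneg by (subst prod_powr_distrib) (auto intro!: mult_nonneg_nonneg less_imp_le)
    also have "\<dots> = (\<Prod>i\<in>UNIV. ennreal ((x $ i) powr (\<epsilon> - 1)) * indicator {0<..<1} (x $ i))"
      unfolding one by (subst prod_ennreal[symmetric]) (auto intro!: prod.cong simp: indicator_def)
    finally show "epowr (ennreal \<bar>w x * f x\<bar>) p = (\<Prod>i\<in>UNIV. ennreal ((x $ i) powr (\<epsilon> - 1)) * indicator {0<..<1} (x $ i))" .
  qed
  also have "\<dots> = (\<Prod>i\<in>(UNIV :: 'n set). \<integral>\<^sup>+t. ennreal (t powr (\<epsilon> - 1)) * indicator {0<..<1} t \<partial>lborel)"
    by (rule nn_integral_prod_cart) measurable
  also have "\<dots> = ennreal (1 / \<epsilon>) ^ CARD('n)"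
    using \<epsilon> by (simp add: nn_integral_powr_interval)
  finally show ?thesis
    using \<epsilon> by (simp add: weighted_norm_def Lp_norm_def ennreal_power epowr_ennreal powr_realpow[symmetric] powr_powr)
qed

text \<open>The box is chosen with \<open>h = x\<close>, so that in each variable it reaches back to
  the singularity at 0.\<close>

lemma strong_frac_max_ge:
  fixes x :: "real ^ 'n::finite"
  assumes x: "\<And>i. 0 < x $ i" "\<And>i. x $ i < 1"
  shows "ennreal (\<Prod>i\<in>UNIV. (x $ i) powr (\<alpha> - 1 + \<epsilon>) / \<epsilon>) \<le> strong_frac_max \<alpha> f x"
proof -
  have "(\<integral>\<^sup>+y\<in>cbox (x - x) x. ennreal \<bar>f y\<bar> \<partial>lebesgue) = (\<integral>\<^sup>+y\<in>cbox (x - x) x. (\<Prod>i\<in>UNIV. ennreal (\<phi> (y $ i))) \<partial>lborel)"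
    unfolding nn_integral_completion
    by (intro nn_integral_cong) (simp add: f_nonneg prod_ennreal \<phi>_nonneg flip: f_def)
  also have "\<dots> = (\<Prod>i\<in>UNIV. \<integral>\<^sup>+t\<in>{(x - x) $ i..x $ i}. ennreal (\<phi> t) \<partial>lborel)"
    by (rule nn_integral_prod_cbox) simp
  also have "\<dots> = (\<Prod>i\<in>UNIV. ennreal ((x $ i) powr \<epsilon> / \<epsilon>))"
  proof (rule prod.cong[OF refl])
    fix i
    have "(\<integral>\<^sup>+t\<in>{(x - x) $ i..x $ i}. ennreal (\<phi> t) \<partial>lborel) = (\<integral>\<^sup>+t. ennreal (t powr (\<epsilon> - 1)) * indicator {0<..<x $ i} t \<partial>lborel)"
      by (rule nn_integral_cong_AE, use AE_lborel_singleton[of "x $ i"] in eventually_elim)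
         (use x[of i] in \<open>auto simp: \<phi>_def indicator_def\<close>)
    also have "\<dots> = ennreal ((x $ i) powr \<epsilon> / \<epsilon>)"
      using \<epsilon> x[of i] by (intro nn_integral_powr_interval) auto
    finally show "(\<integral>\<^sup>+t\<in>{(x - x) $ i..x $ i}. ennreal (\<phi> t) \<partial>lborel) = ennreal ((x $ i) powr \<epsilon> / \<epsilon>)" .
  qed
  finally have int: "(\<integral>\<^sup>+y\<in>cbox (x - x) x. ennreal \<bar>f y\<bar> \<partial>lebesgue) = ennreal (\<Prod>i\<in>UNIV. (x $ i) powr \<epsilon> / \<epsilon>)"
    using \<epsilon> by (simp add: prod_ennreal)
  have "(\<Prod>i\<in>UNIV. (x $ i) powr (\<alpha> - 1 + \<epsilon>) / \<epsilon>) = 1 / (\<Prod>i\<in>UNIV. (x $ i) powr (1 - \<alpha>)) * (\<Prod>i\<in>UNIV. (x $ i) powr \<epsilon> / \<epsilon>)"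
  proof -
    have "(x $ i) powr (\<alpha> - 1 + \<epsilon>) / \<epsilon> = inverse ((x $ i) powr (1 - \<alpha>)) * ((x $ i) powr \<epsilon> / \<epsilon>)" for i
      using x(1)[of i] powr_minus[of "x $ i" "1 - \<alpha>"] by (simp add: powr_add)
    then have "(\<Prod>i\<in>UNIV. (x $ i) powr (\<alpha> - 1 + \<epsilon>) / \<epsilon>)
        = (\<Prod>i\<in>UNIV. inverse ((x $ i) powr (1 - \<alpha>))) * (\<Prod>i\<in>UNIV. (x $ i) powr \<epsilon> / \<epsilon>)"
      by (simp only: prod.distrib)
    then show ?thesis
      using prod_inversef[of "\<lambda>i. (x $ i) powr (1 - \<alpha>)" UNIV] by (simp only: divide_inverse comp_def mult_1)
  qed
  then have "ennreal (\<Prod>i\<in>UNIV. (x $ i) powr (\<alpha> - 1 + \<epsilon>) / \<epsilon>)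
     = ennreal (1 / (\<Prod>i\<in>UNIV. (x $ i) powr (1 - \<alpha>))) * (\<integral>\<^sup>+y\<in>cbox (x - x) x. ennreal \<bar>f y\<bar> \<partial>lebesgue)"
    unfolding int using \<epsilon> by (simp only:) (rule ennreal_mult; auto intro!: prod_nonneg)
  also have "\<dots> \<le> strong_frac_max \<alpha> f x"
    unfolding strong_frac_max_def using x by (intro SUP_upper) (auto simp: pos_vecs_def)
  finally show ?thesis .
qed

text \<open>By \<open>inverse_q\<close> the integrand has exponent
  \<open>\<epsilon> * q / p - 1\<close> in each variable, barely integrable at 0. This yields a
  further \<open>1 / \<epsilon>\<close> besides \<open>\<epsilon> powr (- q)\<close>.\<close>

lemma max_norm_ge:
  "ennreal ((\<epsilon> powr (- q) * (p / (\<epsilon> * q))) powr (CARD('n) / q)) \<le> weighted_max_norm q \<alpha> w (f :: real ^ 'n::finite \<Rightarrow> real)"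
proof -
  define c where "c = \<epsilon> * q / p"
  have c: "0 < c" using \<epsilon> p q_pos by (simp add: c_def)
  have "(\<Prod>i\<in>(UNIV :: 'n set). \<integral>\<^sup>+t. ennreal (\<epsilon> powr (- q)) * (ennreal (t powr (c - 1)) * indicator {0<..<1} t) \<partial>lborel)
      = (\<integral>\<^sup>+x. (\<Prod>i\<in>UNIV. ennreal (\<epsilon> powr (- q)) * (ennreal ((x $ i) powr (c - 1)) * indicator {0<..<1} (x $ i))) \<partial>(lborel :: (real ^ 'n) measure))"
    by (rule nn_integral_prod_cart[symmetric]) measurable
  also have "\<dots> \<le> (\<integral>\<^sup>+x. epowr (ennreal \<bar>w x\<bar> * strong_frac_max \<alpha> f x) q \<partial>(lborel :: (real ^ 'n) measure))"
  proof (rule nn_integral_mono)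
    fix x :: "real ^ 'n"
    show "(\<Prod>i\<in>UNIV. ennreal (\<epsilon> powr (- q)) * (ennreal ((x $ i) powr (c - 1)) * indicator {0<..<1} (x $ i)))
        \<le> epowr (ennreal \<bar>w x\<bar> * strong_frac_max \<alpha> f x) q"
    proof (cases "\<forall>i. 0 < x $ i \<and> x $ i < 1")
      case True
      have one: "(v t * (t powr (\<alpha> - 1 + \<epsilon>) / \<epsilon>)) powr q = \<epsilon> powr (- q) * t powr (c - 1)" if "0 < t" for t
      proof -
        have "\<gamma> = (1 - \<epsilon>) * (1 - 1 / p)"
          using p by (simp add: \<gamma>_def dual_exp_def field_simps)
        then have "\<gamma> + (\<alpha> - 1 + \<epsilon>) = \<epsilon> / p - 1 / q"
          unfolding inverse_q by (simp add: algebra_simps diff_divide_distrib)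
        then have ex: "(\<gamma> + (\<alpha> - 1 + \<epsilon>)) * q = c - 1"
          using q_pos by (simp add: c_def left_diff_distrib)
        have "v t * (t powr (\<alpha> - 1 + \<epsilon>) / \<epsilon>) = t powr (\<gamma> + (\<alpha> - 1 + \<epsilon>)) / \<epsilon>"
          using that by (simp add: v_def powr_add)
        also have "\<dots> powr q = t powr ((\<gamma> + (\<alpha> - 1 + \<epsilon>)) * q) / \<epsilon> powr q"
          using that \<epsilon> by (simp add: powr_divide powr_powr)
        finally show ?thesis
          unfolding ex by (simp add: powr_minus divide_inverse mult.commute)
      qed
      have "(\<Prod>i\<in>UNIV. ennreal (\<epsilon> powr (- q)) * (ennreal ((x $ i) powr (c - 1)) * indicator {0<..<1} (x $ i)))
          = (\<Prod>i\<in>UNIV. ennreal ((v (x $ i) * ((x $ i) powr (\<alpha> - 1 + \<epsilon>) / \<epsilon>)) powr q))"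
        using True by (intro prod.cong) (auto simp: one simp del: times_divide_eq_right simp flip: ennreal_mult)
      also have "\<dots> = ennreal ((\<Prod>i\<in>UNIV. v (x $ i) * ((x $ i) powr (\<alpha> - 1 + \<epsilon>) / \<epsilon>)) powr q)"
        using v_pos \<epsilon> by (subst prod_powr_distrib) (auto simp: prod_ennreal intro!: mult_nonneg_nonneg less_imp_le)
      also have "\<dots> = epowr (ennreal (w x * (\<Prod>i\<in>UNIV. (x $ i) powr (\<alpha> - 1 + \<epsilon>) / \<epsilon>))) q"
      proof -
        have "0 \<le> w x * (\<Prod>i\<in>UNIV. (x $ i) powr (\<alpha> - 1 + \<epsilon>) / \<epsilon>)"
          using w_pos[of x] \<epsilon> by (intro mult_nonneg_nonneg prod_nonneg) auto
        then show ?thesis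
          by (simp only: epowr_ennreal w_def prod.distrib)
      qed
      also have "\<dots> = epowr (ennreal \<bar>w x\<bar> * ennreal (\<Prod>i\<in>UNIV. (x $ i) powr (\<alpha> - 1 + \<epsilon>) / \<epsilon>)) q"
        using w_pos[of x] \<epsilon> by (subst ennreal_mult) (auto intro!: prod_nonneg)
      also have "\<dots> \<le> epowr (ennreal \<bar>w x\<bar> * strong_frac_max \<alpha> f x) q"
        using True q_pos by (intro epowr_mono mult_left_mono strong_frac_max_ge) auto
      finally show ?thesis .
    next
      case False
      then have "(\<Prod>i\<in>UNIV. ennreal (\<epsilon> powr (- q)) * (ennreal ((x $ i) powr (c - 1)) * indicator {0<..<1} (x $ i))) = 0"
        by (intro prod_zero) (auto simp: indicator_def)
      then show ?thesis by (simp only: zero_le)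
    qed
  qed
  finally have "epowr ((\<Prod>i\<in>(UNIV :: 'n set). \<integral>\<^sup>+t. ennreal (\<epsilon> powr (- q)) * (ennreal (t powr (c - 1)) * indicator {0<..<1} t) \<partial>lborel)) (1 / q)
     \<le> weighted_max_norm q \<alpha> w (f :: real ^ 'n \<Rightarrow> real)"
    unfolding weighted_max_norm_def Lp_norm_def nn_integral_completion using q_pos by (intro epowr_mono) auto
  moreover have "(\<integral>\<^sup>+t. ennreal (\<epsilon> powr (- q)) * (ennreal (t powr (c - 1)) * indicator {0<..<1} t) \<partial>lborel)
      = ennreal (\<epsilon> powr (- q) * (p / (\<epsilon> * q)))"
  proof -
    have eq: "1 / c = p / (\<epsilon> * q)" by (simp add: c_def)
    have "0 \<le> p / (\<epsilon> * q)" using \<epsilon> p q_pos by simp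
    then show ?thesis
      using c by (subst nn_integral_cmult, simp)
        (simp add: nn_integral_powr_interval ennreal_mult eq del: times_divide_eq_right)
  qed
  moreover have "0 < \<epsilon> powr (- q) * (p / (\<epsilon> * q))" using \<epsilon> p q_pos by simp
  ultimately show ?thesis
    by (simp add: ennreal_power epowr_ennreal powr_realpow[symmetric] powr_powr)
qed

end

subsection \<open>Sharpness of the exponent\<close>

context frac_exponents
begin

text \<open>Only upper bounds for the characteristics of the examples are available, and
  monotonicity of \<psi> makes them enough. Comparing the two norms leaves \<epsilon> to the power
  \<open>- (1 - \<alpha>) * n\<close>, which is a constant times \<open>s\<close> to the power
  \<beta>.\<close>

lemma sharp_lower_bound:
  fixes \<psi> :: "real \<Rightarrow> real"
  assumes pos: "\<forall>t\<ge>1. 0 < \<psi> t" and mono: "mono_on {1..} \<psi>"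
    and bound: "\<And>w f :: real ^ 'n::finite \<Rightarrow> real. w \<in> strong_A p q \<Longrightarrow> f \<in> weighted_Lp p w \<Longrightarrow>
      weighted_max_norm q \<alpha> w f \<le> ennreal (\<psi> (enn2real (\<Prod>i\<in>UNIV. A_char p q i w))) * weighted_norm p w f"
    and s: "6 powr (\<rho> * CARD('n)) < s"
  shows "(p / q) powr (CARD('n) / q) * 6 powr (- (1 - \<alpha>) * CARD('n)) * s powr (dual_exp p / q * (1 - \<alpha>)) \<le> \<psi> s"
proof -
  define n where "n = real CARD('n)"
  have n: "0 < n" by (simp add: n_def)
  have s6: "6 powr (\<rho> * n) < s" using s by (simp add: n_def)
  have s1: "1 < s"
  proof -
    have "1 \<le> (6::real) powr (\<rho> * n)" using \<rho>_pos n by (intro ge_one_powr_ge_zero) auto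
    then show ?thesis using s6 by simp
  qed
  \<comment> \<open>Chosen so that the bound for the product of the characteristics is exactly
    \<open>s\<close>; the threshold on \<open>s\<close> amounts to
    \<open>\<epsilon> < 1\<close>.\<close>
  define \<epsilon> where "\<epsilon> = 6 * s powr (- (1 / (\<rho> * n)))"
  have "6 = (6 powr (\<rho> * n)) powr (1 / (\<rho> * n))"
    using \<rho>_pos n by (simp add: powr_powr)
  also have "\<dots> < s powr (1 / (\<rho> * n))"
    using s6 \<rho>_pos n by (intro powr_less_mono2) auto
  finally have \<epsilon>: "0 < \<epsilon>" "\<epsilon> < 1"
    using s1 by (auto simp: \<epsilon>_def powr_minus field_simps)
  interpret pw: power_weight \<alpha> p q \<epsilon>
    using \<epsilon> by unfold_locales
  have Ks: "pw.K powr n = s"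
  proof -
    have "6 / \<epsilon> = s powr (1 / (\<rho> * n))"
      using s1 by (simp add: \<epsilon>_def powr_minus_divide)
    then have "pw.K powr n = s powr (1 / (\<rho> * n) * \<rho> * n)"
      by (simp only: pw.K_def powr_powr)
    then show ?thesis using \<rho>_pos n s1 by simp
  qed
  have K_pos: "0 < pw.K" using \<epsilon> by (simp add: pw.K_def)
  let ?P = "\<Prod>i\<in>(UNIV :: 'n set). A_char p q i pw.w"
  have "?P \<le> (\<Prod>i\<in>(UNIV :: 'n set). ennreal pw.K)"
    by (intro prod_mono_ennreal pw.A_char_w)
  also have "\<dots> = ennreal s"
    using Ks K_pos by (simp add: ennreal_power n_def powr_realpow)
  finally have P: "?P \<le> ennreal s" .
  have "(\<Prod>i\<in>(UNIV :: 'n set). 1) \<le> ?P"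
    by (intro prod_mono_ennreal A_char_ge_1 pw.weight_w)
  then have P1: "1 \<le> ?P" by simp
  obtain r where r: "?P = ennreal r" "0 \<le> r" using P by (cases ?P) (auto simp: top_unique)
  have "1 \<le> r" "r \<le> s" using P P1 r s1 by (auto simp flip: ennreal_1)
  then have "\<psi> r \<le> \<psi> s" using mono s1 by (auto simp: mono_on_def)
  have "pw.f \<in> weighted_Lp p (pw.w :: real ^ 'n \<Rightarrow> real)"
    using measurable_completion[of pw.f lborel borel] by (simp add: weighted_Lp_def pw.norm_f)
  from bound[OF pw.w_strong_A this] have "weighted_max_norm q \<alpha> pw.w (pw.f :: real ^ 'n \<Rightarrow> real) \<le> ennreal (\<psi> r) * ennreal ((1 / \<epsilon>) powr (n / p))"
    unfolding pw.norm_f n_def using r by simp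
  with pw.max_norm_ge have "ennreal ((\<epsilon> powr (- q) * (p / (\<epsilon> * q))) powr (n / q)) \<le> ennreal (\<psi> r) * ennreal ((1 / \<epsilon>) powr (n / p))"
    unfolding n_def by (rule order_trans)
  moreover have "0 \<le> \<psi> r" using pos \<open>1 \<le> r\<close> by (simp add: less_imp_le)
  ultimately have main: "(\<epsilon> powr (- q) * (p / (\<epsilon> * q))) powr (n / q) \<le> \<psi> r * (1 / \<epsilon>) powr (n / p)"
    by (simp flip: ennreal_mult)
  have pq: "0 < p" "0 < q" using p q_pos by auto
  have "(\<epsilon> powr (- q) * (p / (\<epsilon> * q))) powr (n / q) = (\<epsilon> powr (- q - 1) * (p / q)) powr (n / q)"
    using \<epsilon> by (simp add: powr_diff)
  also have "\<dots> = \<epsilon> powr (- n - n / q) * (p / q) powr (n / q)"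
  proof -
    have "(- q - 1) * (n / q) = - n - n / q" using pq by (simp add: field_simps)
    then show ?thesis by (simp only: powr_mult powr_powr)
  qed
  finally have "\<epsilon> powr (n / p) * (\<epsilon> powr (- n - n / q) * (p / q) powr (n / q)) \<le> \<epsilon> powr (n / p) * (\<psi> r * (1 / \<epsilon>) powr (n / p))"
    using main by (intro mult_left_mono) auto
  also have "\<dots> = \<psi> r" using \<epsilon> by (simp add: powr_divide)
  also have "\<epsilon> powr (n / p) * (\<epsilon> powr (- n - n / q) * (p / q) powr (n / q)) = \<epsilon> powr (- (1 - \<alpha>) * n) * (p / q) powr (n / q)"
  proof -
    have "n / p + (- n - n / q) = n * (1 / p - 1 / q) - n" by (simp add: right_diff_distrib)
    also have "\<dots> = - (1 - \<alpha>) * n" by (simp add: inverse_q algebra_simps)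
    finally show ?thesis by (simp add: mult.assoc[symmetric] powr_add[symmetric])
  qed
  also have "\<epsilon> powr (- (1 - \<alpha>) * n) = 6 powr (- (1 - \<alpha>) * n) * s powr (dual_exp p / q * (1 - \<alpha>))"
  proof -
    have "- (1 / (\<rho> * n)) * (- (1 - \<alpha>) * n) = (1 - \<alpha>) / \<rho>" using \<rho>_pos n by (simp add: field_simps)
    also have "\<dots> = dual_exp p / q * (1 - \<alpha>)" by (simp add: \<rho>_def)
    finally show ?thesis by (simp only: \<epsilon>_def powr_mult powr_powr)
  qed
  finally show ?thesis
    using \<open>\<psi> r \<le> \<psi> s\<close> by (simp add: n_def mult_ac)
qed

end

theorem theorem4p20:
  fixes \<alpha> p q \<beta> :: real
  assumes "0 < \<alpha>" and "\<alpha> < 1" and "1 < p" and "p < 1 / \<alpha>"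
    and "q = p / (1 - \<alpha> * p)"
    and "\<beta> = dual_exp p / q * (1 - \<alpha>)"
  shows "(\<exists>c::real. 0 < c \<and>
            (\<forall>w :: real ^ 'n::finite \<Rightarrow> real. w \<in> strong_A p q \<longrightarrow>
              (\<forall>f \<in> weighted_Lp p w.
                 weighted_max_norm q \<alpha> w f
                   \<le> ennreal c * epowr (\<Prod>i\<in>UNIV. A_char p q i w) \<beta> * weighted_norm p w f))) \<and>
         \<not> (\<exists>\<psi> :: real \<Rightarrow> real.
               (\<forall>t\<ge>1. 0 < \<psi> t) \<and> mono_on {1..} \<psi> \<and>
               ((\<lambda>t. \<psi> t / t powr \<beta>) \<longlongrightarrow> 0) at_top \<and>
               (\<forall>w :: real ^ 'n \<Rightarrow> real. w \<in> strong_A p q \<longrightarrow>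
                 (\<forall>f \<in> weighted_Lp p w.
                    weighted_max_norm q \<alpha> w f
                      \<le> ennreal (\<psi> (enn2real (\<Prod>i\<in>UNIV. A_char p q i w))) * weighted_norm p w f)))"
proof -
  interpret frac_exponents \<alpha> p q
    using assms by unfold_locales
  show ?thesis
  proof
    show "\<exists>c::real. 0 < c \<and>
            (\<forall>w :: real ^ 'n \<Rightarrow> real. w \<in> strong_A p q \<longrightarrow>
              (\<forall>f \<in> weighted_Lp p w.
                 weighted_max_norm q \<alpha> w f
                   \<le> ennreal c * epowr (\<Prod>i\<in>UNIV. A_char p q i w) \<beta> * weighted_norm p w f))"
      using strong_max_bound C_strong_pos assms(6)
      by (intro exI[of _ "C_strong CARD('n)"]) (auto simp: strong_A_def weighted_Lp_def)
    show "\<not> (\<exists>\<psi> :: real \<Rightarrow> real.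
               (\<forall>t\<ge>1. 0 < \<psi> t) \<and> mono_on {1..} \<psi> \<and>
               ((\<lambda>t. \<psi> t / t powr \<beta>) \<longlongrightarrow> 0) at_top \<and>
               (\<forall>w :: real ^ 'n \<Rightarrow> real. w \<in> strong_A p q \<longrightarrow>
                 (\<forall>f \<in> weighted_Lp p w.
                    weighted_max_norm q \<alpha> w f
                      \<le> ennreal (\<psi> (enn2real (\<Prod>i\<in>UNIV. A_char p q i w))) * weighted_norm p w f)))"
    proof (rule notI, elim exE conjE)
      fix \<psi> :: "real \<Rightarrow> real"
      assume \<psi>: "\<forall>t\<ge>1. 0 < \<psi> t" "mono_on {1..} \<psi>" and lim: "((\<lambda>t. \<psi> t / t powr \<beta>) \<longlongrightarrow> 0) at_top"
        and bound: "\<forall>w :: real ^ 'n \<Rightarrow> real. w \<in> strong_A p q \<longrightarrow>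
                 (\<forall>f \<in> weighted_Lp p w.
                    weighted_max_norm q \<alpha> w f
                      \<le> ennreal (\<psi> (enn2real (\<Prod>i\<in>UNIV. A_char p q i w))) * weighted_norm p w f)"
      \<comment> \<open>The constant of \<open>sharp_lower_bound\<close>: the quotient that should
        tend to 0 stays at least \<delta>.\<close>
      define \<delta> where "\<delta> = (p / q) powr (CARD('n) / q) * 6 powr (- (1 - \<alpha>) * CARD('n))"
      have "0 < \<delta>" using p q_pos by (simp add: \<delta>_def)
      have "eventually (\<lambda>s. \<psi> s / s powr \<beta> < \<delta>) at_top"
        using order_tendstoD(2)[OF lim \<open>0 < \<delta>\<close>] .
      moreover have "eventually (\<lambda>s. max 1 (6 powr (\<rho> * CARD('n))) < s) at_top"
        by (rule eventually_gt_at_top)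
      ultimately have "eventually (\<lambda>s::real. False) at_top"
      proof eventually_elim
        case (elim s)
        have "\<delta> * s powr \<beta> \<le> \<psi> s"
          unfolding \<delta>_def assms(6)
          by (rule sharp_lower_bound[OF \<psi>]) (use bound elim in auto)
        then show False using elim by (simp add: divide_less_eq)
      qed
      then show False by simp
    qed
  qed
qed

end
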